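(* Let $g_0\in H^2(\mathbb{R})$ be a zero mean initial data. Then there exist $T>0$ and a solution $g$, satisfying $$g\in C([0,T],H^2(\mathbb{R})),$$ of the equation $$g_t+2\mathcal{N}g=-\mathcal{N}(g^2)+2\mathcal{Q}\left(g_{zz}\,\mathcal{N}g-g\,\mathcal{N}g_{zz}\right)\quad\text{for }(z,t)\in\mathbb{R}\times[0,T],$$ with $g(\cdot,0)=g_0$.
   Context: The operators $\mathcal{Q}$ and $\mathcal{N}$ act in the spatial variable $z\in\mathbb{R}$ and are defined as Fourier multipliers by $$\widehat{\mathcal{Q}F}(\xi)=\frac{1}{1+\xi^2}\hat F(\xi),\qquad \widehat{\mathcal{N}F}(\xi)=\widehat{\partial_z\mathcal{Q}F}(\xi)=\frac{i\xi}{1+\xi^2}\hat F(\xi),$$ i.e. $\mathcal{Q}=(1-\partial_z^2)^{-1}$ and $\mathcal{N}=\partial_z\mathcal{Q}$. The unknown $g=g(z,t)$ is real-valued and $\mathcal{N}g_{zz}$ means $\mathcal{N}(\partial_z^2 g)$. Zero mean initial data means that $g_0$ is integrable with $\int_{\mathbb{R}}g_0(z)\,dz=0$. *)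

theory Defs
  imports "HOL-Analysis.Analysis"
begin

text \<open>
  Elements of \<open>L\<^sup>2(\<real>)\<close> and \<open>H\<^sup>2(\<real>)\<close> are represented by Borel functions; functions that
  agree almost everywhere represent the same element.
\<close>

definition L2 :: "(real \<Rightarrow> 'a::real_normed_vector) set" where
  "L2 = {f. f \<in> borel_measurable lborel \<and> integrable lborel (\<lambda>x. (norm (f x))\<^sup>2)}"

definition fourier_trunc :: "(real \<Rightarrow> real) \<Rightarrow> real \<Rightarrow> real \<Rightarrow> complex" where
  "fourier_trunc f R \<xi> = (LBINT x:{-R..R}. of_real (f x) * exp (- (\<i> * of_real (x * \<xi>))))"

text \<open>
  The Fourier transform on \<open>L\<^sup>2\<close>, normalised by \<open>\<integral> f(x) exp(-i x \<xi>) dx\<close>, is the \<open>L\<^sup>2\<close>-limit of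
  the transforms of the truncations of \<open>f\<close> to \<open>[-n, n]\<close>; by Plancherel's theorem it exists
  for all \<open>f \<in> L\<^sup>2\<close> and is unique almost everywhere. The limit is stated with the nonnegative
  integral because the Bochner integral of a non-integrable function is \<open>0\<close>.
\<close>

definition has_fourier :: "(real \<Rightarrow> real) \<Rightarrow> (real \<Rightarrow> complex) \<Rightarrow> bool" where
  "has_fourier f \<phi> \<longleftrightarrow> f \<in> L2 \<and> \<phi> \<in> L2 \<and>
     (\<lambda>n. \<integral>\<^sup>+ \<xi>. ennreal ((norm (fourier_trunc f (real n) \<xi> - \<phi> \<xi>))\<^sup>2) \<partial>lborel) \<longlonglongrightarrow> 0"

definition fourier :: "(real \<Rightarrow> real) \<Rightarrow> real \<Rightarrow> complex" where
  "fourier f = (SOME \<phi>. has_fourier f \<phi>)"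

text \<open>
  For \<open>F \<in> L\<^sup>2\<close>, the result is determined almost everywhere. A real-valued result exists
  whenever \<open>m\<close> is bounded, measurable and satisfies \<open>m (-\<xi>) = cnj (m \<xi>)\<close>, as both symbols
  below do.
\<close>

definition fourier_multiplier :: "(real \<Rightarrow> complex) \<Rightarrow> (real \<Rightarrow> real) \<Rightarrow> real \<Rightarrow> real" where
  "fourier_multiplier m F =
     (SOME G. G \<in> L2 \<and> (AE \<xi> in lborel. fourier G \<xi> = m \<xi> * fourier F \<xi>))"

definition Q_op :: "(real \<Rightarrow> real) \<Rightarrow> real \<Rightarrow> real" where
  "Q_op = fourier_multiplier (\<lambda>\<xi>. 1 / (1 + (of_real \<xi>)\<^sup>2))"

definition N_op :: "(real \<Rightarrow> real) \<Rightarrow> real \<Rightarrow> real" where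
  "N_op = fourier_multiplier (\<lambda>\<xi>. \<i> * of_real \<xi> / (1 + (of_real \<xi>)\<^sup>2))"

definition H2 :: "(real \<Rightarrow> real) set" where
  "H2 = {f \<in> L2. (\<lambda>\<xi>. of_real (1 + \<xi>\<^sup>2) * fourier f \<xi>) \<in> L2}"

definition H2_norm :: "(real \<Rightarrow> real) \<Rightarrow> real" where
  "H2_norm f = sqrt (\<integral>\<xi>. ((1 + \<xi>\<^sup>2) * norm (fourier f \<xi>))\<^sup>2 \<partial>lborel)"

definition test_function :: "(real \<Rightarrow> real) \<Rightarrow> bool" where
  "test_function \<phi> \<longleftrightarrow> (\<forall>n x. (deriv ^^ n) \<phi> differentiable (at x)) \<and>
     (\<exists>R. \<forall>x. \<bar>x\<bar> > R \<longrightarrow> \<phi> x = 0)"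

text \<open>The second distributional derivative, for functions whose second derivative is in \<open>L\<^sup>2\<close>.\<close>

definition weak_deriv2 :: "(real \<Rightarrow> real) \<Rightarrow> real \<Rightarrow> real" where
  "weak_deriv2 f = (SOME h. h \<in> L2 \<and>
     (\<forall>\<phi>. test_function \<phi> \<longrightarrow>
        (\<integral>x. f x * deriv (deriv \<phi>) x \<partial>lborel) = (\<integral>x. h x * \<phi> x \<partial>lborel)))"

text \<open>Curves in \<open>H\<^sup>2\<close> take the time first: \<open>g t z\<close> stands for \<open>g(z,t)\<close>.\<close>

definition continuous_H2_on :: "real set \<Rightarrow> (real \<Rightarrow> real \<Rightarrow> real) \<Rightarrow> bool" where
  "continuous_H2_on S g \<longleftrightarrow> (\<forall>t\<in>S. g t \<in> H2 \<and>
     ((\<lambda>s. H2_norm (\<lambda>z. g s z - g t z)) \<longlongrightarrow> 0) (at t within S))"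

definition has_H2_derivative ::
    "(real \<Rightarrow> real \<Rightarrow> real) \<Rightarrow> (real \<Rightarrow> real) \<Rightarrow> real \<Rightarrow> real set \<Rightarrow> bool" where
  "has_H2_derivative g g' t S \<longleftrightarrow> g' \<in> H2 \<and>
     ((\<lambda>s. H2_norm (\<lambda>z. (g s z - g t z) / (s - t) - g' z)) \<longlongrightarrow> 0) (at t within S)"

end

theory Submission
  imports Defs "HOL-Probability.Characteristic_Functions" "HOL-Real_Asymp.Real_Asymp"
begin

text \<open>
  Put \<open>g = Q w\<close> with \<open>w \<in> L\<^sup>2\<close>, so that \<open>g\<^sub>z = N w\<close>, \<open>g\<^sub>z\<^sub>z = g - w\<close> and \<open>N g\<^sub>z\<^sub>z = N g - N w\<close>. Since
  \<open>N (g\<^sup>2) = Q (2 g g\<^sub>z)\<close>, all terms of the equation are of the form \<open>Q (\<dots>)\<close>; cancelling \<open>Q\<close> leaves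
  the ordinary differential equation \<open>w\<^sub>t = - 2 N w - 2 w N Q w\<close> in \<open>L\<^sup>2\<close>, whose right-hand side is
  quadratic in \<open>w\<close> and bounded. Its power series solution \<open>w(t) = \<Sum> w\<^sub>n t\<^sup>n\<close> has
  \<open>\<parallel>w\<^sub>n\<parallel> \<le> A M\<^sup>n\<close> with \<open>A = \<parallel>w\<^sub>0\<parallel>\<close> and \<open>M = 2 (1 + A)\<close>. The operators are identified with
  convolutions by \<open>exp (- |x|) / 2\<close> and its derivative by means of Plancherel's theorem, which is proved by
  Gaussian regularisation.
\<close>

section \<open>The space of square integrable functions\<close>

text \<open>The reduction rests on a cancellation. With g = Q w the left-hand side is Q (w_t + 2 N
  w), as N and Q commute. On the right, - N (g^2) = - 2 Q (g N w), while g_zz N g - g N g_zz = (g -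
  w) N g - g (N g - N w) = g N w - w N g. The two multiples of Q (g N w) cancel and only - 2 Q (w N
  g) survives. The kernels of both operators have mass one and L2 norm at most one. The first
  property makes the operators contractions of L2, the second makes their values bounded functions,
  so that w N Q w is the product of an L2 function and a bounded function. The constant M comes from
  the recursion: (n + 1) w_(n+1) consists of one linear term and n + 1 quadratic ones, together at
  most (n + 1) A M^n times 2 (1 + A). Fourier transform, multipliers and weak derivative are given
  by choice operators, hence known only up to null sets. All analysis is done with convolutions,
  which are defined at every point and insensitive to null sets; the chosen objects are merely
  compared with them almost everywhere.\<close>

definition l2norm :: "(real \<Rightarrow> 'a::real_normed_vector) \<Rightarrow> real" where
  "l2norm f = sqrt (\<integral>x. (norm (f x))\<^sup>2 \<partial>lborel)"

lemma l2norm_nonneg [simp]: "0 \<le> l2norm f"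
  by (simp add: l2norm_def)

lemma L2_measurable [measurable_dest]: "f \<in> L2 \<Longrightarrow> f \<in> borel_measurable borel"
  by (simp add: L2_def)

lemma L2_integrable: "f \<in> L2 \<Longrightarrow> integrable lborel (\<lambda>x. (norm (f x))\<^sup>2)"
  by (simp add: L2_def)

lemma l2norm_square: "(l2norm f)\<^sup>2 = (\<integral>x. (norm (f x))\<^sup>2 \<partial>lborel)"
  by (simp add: l2norm_def)

lemma nn_integral_L2:
  "f \<in> L2 \<Longrightarrow> (\<integral>\<^sup>+x. ennreal ((norm (f x))\<^sup>2) \<partial>lborel) = ennreal ((l2norm f)\<^sup>2)"
  by (simp add: l2norm_square L2_integrable nn_integral_eq_integral)

text \<open>A bound on \<open>l2norm\<close> alone would prove nothing, because the Bochner integral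
  of a non-integrable function is 0. Bounding the nonnegative integral yields membership and the
  norm estimate together.\<close>

lemma L2_I:
  fixes f :: "real \<Rightarrow> 'a::{banach, second_countable_topology}"
  assumes [measurable]: "f \<in> borel_measurable borel" and "0 \<le> c"
    and le: "(\<integral>\<^sup>+x. ennreal ((norm (f x))\<^sup>2) \<partial>lborel) \<le> ennreal (c\<^sup>2)"
  shows "f \<in> L2" and "l2norm f \<le> c"
proof -
  have "integrable lborel (\<lambda>x. (norm (f x))\<^sup>2)"
    using le_less_trans[OF le ennreal_less_top] by (intro integrableI_bounded) (simp_all add: abs_mult)
  then show f: "f \<in> L2"
    by (simp add: L2_def)
  from le have "(l2norm f)\<^sup>2 \<le> c\<^sup>2"
    by (simp add: nn_integral_L2[OF f])
  then show "l2norm f \<le> c"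
    using \<open>0 \<le> c\<close> by (rule power2_le_imp_le)
qed

lemma L2_mono:
  fixes f :: "real \<Rightarrow> 'a::{banach, second_countable_topology}" and g :: "real \<Rightarrow> 'b::{banach, second_countable_topology}"
  assumes [measurable]: "f \<in> borel_measurable borel" and "0 \<le> c"
    and g: "g \<in> L2" and le: "AE x in lborel. norm (f x) \<le> c * norm (g x)"
  shows "f \<in> L2" and "l2norm f \<le> c * l2norm g"
proof -
  note [measurable] = L2_measurable[OF g]
  have "(\<integral>\<^sup>+x. ennreal ((norm (f x))\<^sup>2) \<partial>lborel) \<le> (\<integral>\<^sup>+x. ennreal (c\<^sup>2) * ennreal ((norm (g x))\<^sup>2) \<partial>lborel)"
    using le
    by (intro nn_integral_mono_AE) (auto elim!: eventually_mono
        simp: power_mult_distrib[symmetric] ennreal_mult[symmetric] intro!: power_mono)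
  also have "\<dots> = ennreal ((c * l2norm g)\<^sup>2)"
    by (subst nn_integral_cmult) (simp_all add: nn_integral_L2[OF g] ennreal_mult[symmetric] power_mult_distrib)
  finally have "(\<integral>\<^sup>+x. ennreal ((norm (f x))\<^sup>2) \<partial>lborel) \<le> ennreal ((c * l2norm g)\<^sup>2)" .
  from L2_I[OF _ _ this] show "f \<in> L2" "l2norm f \<le> c * l2norm g"
    using \<open>0 \<le> c\<close> by auto
qed

lemma L2_cong_AE:
  fixes f g :: "real \<Rightarrow> 'a::{banach, second_countable_topology}"
  assumes "f \<in> borel_measurable borel" "g \<in> L2" "AE x in lborel. f x = g x"
  shows "f \<in> L2" and "l2norm f = l2norm g"
proof -
  show f: "f \<in> L2"
    using assms by (intro L2_mono[of f 1 g]) auto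
  show "l2norm f = l2norm g"
    unfolding l2norm_def using assms by (intro arg_cong[where f = sqrt] integral_cong_AE) (auto simp: L2_def)
qed

lemma l2norm_zero [simp]: "l2norm (\<lambda>x. 0) = 0" "(\<lambda>x. 0) \<in> L2"
  by (simp_all add: l2norm_def L2_def)

lemma l2norm_eq_0_imp:
  fixes f :: "real \<Rightarrow> 'a::{banach, second_countable_topology}"
  assumes "f \<in> L2" "l2norm f = 0"
  shows "AE x in lborel. f x = 0"
proof -
  have "(\<integral>x. (norm (f x))\<^sup>2 \<partial>lborel) = 0"
    using assms(2) by (simp add: l2norm_def)
  then show ?thesis
    by (subst (asm) integral_nonneg_eq_0_iff_AE) (auto simp: L2_integrable[OF assms(1)])
qed

text \<open>Takes the square root in the Cauchy-Schwarz inequality for nonnegative integrals. A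
  priori \<open>I\<close> may be infinite; the finite right-hand side excludes this.\<close>

lemma ennreal_power2_le_imp_le:
  assumes "I\<^sup>2 \<le> (ennreal c)\<^sup>2" "0 \<le> c"
  shows "I \<le> ennreal c"
proof (cases I)
  case (real r)
  with assms have "r\<^sup>2 \<le> c\<^sup>2"
    by (simp add: ennreal_power)
  with real assms show ?thesis
    using power2_le_imp_le[of r c] by (simp add: ennreal_leI)
next
  case top
  with assms show ?thesis
    by (simp add: ennreal_power top_unique)
qed

lemma L2_Cauchy_Schwarz:
  fixes f :: "real \<Rightarrow> 'a::{banach, second_countable_topology}" and g :: "real \<Rightarrow> 'b::{banach, second_countable_topology}"
  assumes f: "f \<in> L2" and g: "g \<in> L2"
  shows "integrable lborel (\<lambda>x. norm (f x) * norm (g x))"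
    and "(\<integral>x. norm (f x) * norm (g x) \<partial>lborel) \<le> l2norm f * l2norm g"
proof -
  note [measurable] = L2_measurable[OF f] L2_measurable[OF g]
  have "(\<integral>\<^sup>+x. ennreal (norm (f x)) * ennreal (norm (g x)) \<partial>lborel)\<^sup>2
      \<le> (\<integral>\<^sup>+x. (ennreal (norm (f x)))\<^sup>2 \<partial>lborel) * (\<integral>\<^sup>+x. (ennreal (norm (g x)))\<^sup>2 \<partial>lborel)"
    by (rule Cauchy_Schwarz_nn_integral) auto
  also have "\<dots> = (ennreal (l2norm f * l2norm g))\<^sup>2"
    by (simp add: ennreal_power nn_integral_L2 f g ennreal_mult[symmetric] power_mult_distrib)
  finally have le: "(\<integral>\<^sup>+x. ennreal (norm (f x) * norm (g x)) \<partial>lborel) \<le> ennreal (l2norm f * l2norm g)"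
    using ennreal_power2_le_imp_le[of _ "l2norm f * l2norm g"] by (simp add: ennreal_mult')
  then show int: "integrable lborel (\<lambda>x. norm (f x) * norm (g x))"
    using le_less_trans[OF le ennreal_less_top] by (intro integrableI_bounded) (simp_all add: abs_mult)
  from le show "(\<integral>x. norm (f x) * norm (g x) \<partial>lborel) \<le> l2norm f * l2norm g"
    by (subst (asm) nn_integral_eq_integral[OF int]) auto
qed

text \<open>Minkowski's inequality: Cauchy-Schwarz controls the mixed term of the expanded square,
  and domination by the integrable \<open>?h\<close> gives membership at the same time.\<close>

lemma L2_add:
  fixes f g :: "real \<Rightarrow> 'a::{banach, second_countable_topology}"
  assumes f: "f \<in> L2" and g: "g \<in> L2"
  shows "(\<lambda>x. f x + g x) \<in> L2" and "l2norm (\<lambda>x. f x + g x) \<le> l2norm f + l2norm g"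
proof -
  note [measurable] = L2_measurable[OF f] L2_measurable[OF g]
  let ?h = "\<lambda>x. (norm (f x))\<^sup>2 + (2 * (norm (f x) * norm (g x)) + (norm (g x))\<^sup>2)"
  have int: "integrable lborel ?h"
    using L2_integrable[OF f] L2_integrable[OF g] L2_Cauchy_Schwarz(1)[OF f g] by auto
  have "(\<integral>\<^sup>+x. ennreal ((norm (f x + g x))\<^sup>2) \<partial>lborel) \<le> (\<integral>\<^sup>+x. ennreal (?h x) \<partial>lborel)"
  proof (intro nn_integral_mono ennreal_leI)
    fix x
    have "(norm (f x + g x))\<^sup>2 \<le> (norm (f x) + norm (g x))\<^sup>2"
      by (intro power_mono norm_triangle_ineq) auto
    then show "(norm (f x + g x))\<^sup>2 \<le> ?h x"
      by (simp add: power2_sum)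
  qed
  also have "\<dots> = ennreal (\<integral>x. ?h x \<partial>lborel)"
    by (intro nn_integral_eq_integral[OF int]) auto
  also have "(\<integral>x. ?h x \<partial>lborel) = (l2norm f)\<^sup>2 + (2 * (\<integral>x. norm (f x) * norm (g x) \<partial>lborel) + (l2norm g)\<^sup>2)"
    using L2_integrable[OF f] L2_integrable[OF g] L2_Cauchy_Schwarz(1)[OF f g]
    by (simp add: l2norm_square)
  also have "\<dots> \<le> (l2norm f + l2norm g)\<^sup>2"
    using L2_Cauchy_Schwarz(2)[OF f g] by (simp add: power2_sum)
  finally have le: "(\<integral>\<^sup>+x. ennreal ((norm (f x + g x))\<^sup>2) \<partial>lborel) \<le> ennreal ((l2norm f + l2norm g)\<^sup>2)"
    by (simp add: ennreal_leI)
  show "(\<lambda>x. f x + g x) \<in> L2" "l2norm (\<lambda>x. f x + g x) \<le> l2norm f + l2norm g"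
    using L2_I[OF _ _ le] by auto
qed

lemma L2_scale:
  fixes f :: "real \<Rightarrow> 'a::{banach, second_countable_topology, real_normed_field}"
  assumes f: "f \<in> L2"
  shows "(\<lambda>x. c * f x) \<in> L2" and "l2norm (\<lambda>x. c * f x) = norm c * l2norm f"
  using L2_integrable[OF f] L2_measurable[OF f]
  by (auto simp: L2_def l2norm_def norm_mult power_mult_distrib real_sqrt_mult)

lemma L2_uminus:
  fixes f :: "real \<Rightarrow> 'a::{banach, second_countable_topology}"
  assumes f: "f \<in> L2"
  shows "(\<lambda>x. - f x) \<in> L2" and "l2norm (\<lambda>x. - f x) = l2norm f"
  using L2_integrable[OF f] L2_measurable[OF f]
  by (auto simp: L2_def l2norm_def)

lemma L2_diff:
  fixes f g :: "real \<Rightarrow> 'a::{banach, second_countable_topology}"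
  assumes f: "f \<in> L2" and g: "g \<in> L2"
  shows "(\<lambda>x. f x - g x) \<in> L2" and "l2norm (\<lambda>x. f x - g x) \<le> l2norm f + l2norm g"
  using L2_add[OF f L2_uminus(1)[OF g]] by (simp_all add: L2_uminus(2)[OF g])

lemma l2norm_diff_commute: "l2norm (\<lambda>x. f x - g x) = l2norm (\<lambda>x. g x - f x)"
  by (simp add: l2norm_def norm_minus_commute)

lemma l2norm_triangle3:
  fixes f g h :: "real \<Rightarrow> 'a::{banach, second_countable_topology}"
  assumes "f \<in> L2" "g \<in> L2" "h \<in> L2"
  shows "l2norm (\<lambda>x. f x - h x) \<le> l2norm (\<lambda>x. f x - g x) + l2norm (\<lambda>x. g x - h x)"
  using L2_add(2)[OF L2_diff(1)[OF assms(1,2)] L2_diff(1)[OF assms(2,3)]] by simp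

lemma l2norm_reverse_triangle:
  fixes f g :: "real \<Rightarrow> 'a::{banach, second_countable_topology}"
  assumes f: "f \<in> L2" and g: "g \<in> L2"
  shows "\<bar>l2norm f - l2norm g\<bar> \<le> l2norm (\<lambda>x. f x - g x)"
  using L2_add(2)[OF g L2_diff(1)[OF f g]] L2_add(2)[OF f L2_diff(1)[OF g f]]
    l2norm_diff_commute[of f g]
  by simp

lemma L2_bounded_mult:
  fixes f m :: "real \<Rightarrow> 'a::{banach, second_countable_topology, real_normed_field}"
  assumes f: "f \<in> L2" and [measurable]: "m \<in> borel_measurable borel" and m: "\<And>x. norm (m x) \<le> B"
  shows "(\<lambda>x. m x * f x) \<in> L2" and "l2norm (\<lambda>x. m x * f x) \<le> B * l2norm f"
proof -
  note [measurable] = L2_measurable[OF f]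
  have B: "0 \<le> B"
    using m[of 0] norm_ge_zero order_trans by blast
  have *: "AE x in lborel. norm (m x * f x) \<le> B * norm (f x)"
    using m by (auto simp: norm_mult intro!: mult_right_mono)
  from L2_mono[OF _ B f *] show "(\<lambda>x. m x * f x) \<in> L2" "l2norm (\<lambda>x. m x * f x) \<le> B * l2norm f"
    by auto
qed

lemma L2_sum:
  fixes f :: "'i \<Rightarrow> real \<Rightarrow> 'a::{banach, second_countable_topology}"
  assumes "finite I" "\<And>i. i \<in> I \<Longrightarrow> f i \<in> L2"
  shows "(\<lambda>x. \<Sum>i\<in>I. f i x) \<in> L2 \<and> l2norm (\<lambda>x. \<Sum>i\<in>I. f i x) \<le> (\<Sum>i\<in>I. l2norm (f i))"
  using assms
proof (induction I rule: finite_induct)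
  case (insert i I)
  then have *: "f i \<in> L2" "(\<lambda>x. \<Sum>i\<in>I. f i x) \<in> L2"
    by auto
  show ?case
    using L2_add[OF *] insert by auto
qed simp

lemma L2_norm:
  fixes f :: "real \<Rightarrow> 'a::{banach, second_countable_topology}"
  assumes "f \<in> L2"
  shows "(\<lambda>x. norm (f x)) \<in> L2" and "l2norm (\<lambda>x. norm (f x)) = l2norm f"
  using assms by (auto simp: L2_def l2norm_def)

lemma L2_integrable_mult:
  fixes f g :: "real \<Rightarrow> 'a::{banach, second_countable_topology, real_normed_field}"
  assumes f: "f \<in> L2" and g: "g \<in> L2"
  shows "integrable lborel (\<lambda>x. f x * g x)"
    and "norm (\<integral>x. f x * g x \<partial>lborel) \<le> l2norm f * l2norm g"
proof -
  note [measurable] = L2_measurable[OF f] L2_measurable[OF g]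
  show "integrable lborel (\<lambda>x. f x * g x)"
    by (rule Bochner_Integration.integrable_bound[OF L2_Cauchy_Schwarz(1)[OF f g]]) (auto simp: norm_mult)
  have "norm (\<integral>x. f x * g x \<partial>lborel) \<le> (\<integral>x. norm (f x * g x) \<partial>lborel)"
    by (rule integral_norm_bound)
  then show "norm (\<integral>x. f x * g x \<partial>lborel) \<le> l2norm f * l2norm g"
    using L2_Cauchy_Schwarz(2)[OF f g] by (simp add: norm_mult)
qed

section \<open>Convergence in L2 and completeness\<close>

lemma L2_dominated:
  fixes f :: "real \<Rightarrow> 'a::{banach, second_countable_topology}" and g :: "real \<Rightarrow> 'b::{banach, second_countable_topology}"
  assumes s [measurable]: "\<And>n. s n \<in> borel_measurable borel" and f [measurable]: "f \<in> borel_measurable borel"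
    and g: "g \<in> L2" and bound: "\<And>n. AE x in lborel. norm (s n x - f x) \<le> norm (g x)"
    and lim: "AE x in lborel. (\<lambda>n. s n x) \<longlonglongrightarrow> f x"
  shows "(\<lambda>n. l2norm (\<lambda>x. s n x - f x)) \<longlonglongrightarrow> 0"
proof -
  have "(\<lambda>n. \<integral>x. (norm (s n x - f x))\<^sup>2 \<partial>lborel) \<longlonglongrightarrow> (\<integral>x. 0 \<partial>(lborel :: real measure))"
  proof (rule integral_dominated_convergence[where w = "\<lambda>x. (norm (g x))\<^sup>2"])
    show "AE x in lborel. (\<lambda>n. (norm (s n x - f x))\<^sup>2) \<longlonglongrightarrow> 0"
      using lim
    proof eventually_elim
      case (elim x)
      then have "(\<lambda>n. s n x - f x) \<longlonglongrightarrow> 0"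
        by (simp add: LIM_zero_iff)
      then show ?case
        using tendsto_power[OF tendsto_norm_zero, of "\<lambda>n. s n x - f x" _ 2] by simp
    qed
    show "AE x in lborel. norm ((norm (s n x - f x))\<^sup>2) \<le> (norm (g x))\<^sup>2" for n
      using bound[of n] by eventually_elim (simp add: power_mono)
  qed (auto simp: L2_integrable[OF g])
  then show ?thesis
    unfolding l2norm_def using tendsto_real_sqrt[of _ 0] by fastforce
qed

lemma L2_truncate:
  fixes f :: "real \<Rightarrow> 'a::{banach, second_countable_topology, real_normed_field}"
  assumes f: "f \<in> L2"
  shows "(\<lambda>n. l2norm (\<lambda>x. indicator {- real n..real n} x * f x - f x)) \<longlonglongrightarrow> 0"
proof (rule L2_dominated[OF _ _ f])
  note [measurable] = L2_measurable[OF f]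
  show "AE x in lborel. (\<lambda>n. indicator {- real n..real n} x * f x) \<longlonglongrightarrow> f x"
  proof (intro AE_I2 tendsto_eventually)
    fix x :: real
    obtain N where "\<bar>x\<bar> \<le> real N"
      using real_arch_simple by blast
    then show "eventually (\<lambda>n. indicator {- real n..real n} x * f x = f x) sequentially"
      by (intro eventually_sequentiallyI[of N]) (auto simp: indicator_def)
  qed
  show "AE x in lborel. norm (indicator {- real n..real n} x * f x - f x) \<le> norm (f x)" for n
    by (auto simp: indicator_def)
qed (use L2_measurable[OF f] in auto)

text \<open>A truncated L2 function is a product of two L2 functions, hence also in L1. This
  supplies arguments for the Fourier transform given by an integral.\<close>

lemma L2_indicator:
  fixes f :: "real \<Rightarrow> 'a::{banach, second_countable_topology, real_normed_field}"
  assumes f: "f \<in> L2"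
  shows "(\<lambda>x. indicator {a..b} x * f x) \<in> L2" and "integrable lborel (\<lambda>x. indicator {a..b} x * f x)"
proof -
  show "(\<lambda>x. indicator {a..b} x * f x) \<in> L2"
    by (rule L2_bounded_mult[OF f, of _ 1]) (auto simp: indicator_def)
  have "(\<lambda>x. indicator {a..b} x :: 'a) \<in> L2"
  proof -
    have "(\<lambda>x. (norm (indicator {a..b} x :: 'a))\<^sup>2) = (indicator {a..b} :: real \<Rightarrow> real)"
      by (auto simp: indicator_def)
    then show ?thesis
      by (simp add: L2_def emeasure_lborel_Icc_eq)
  qed
  from L2_integrable_mult(1)[OF this f] show "integrable lborel (\<lambda>x. indicator {a..b} x * f x)" .
qed

text \<open>Fatou's lemma for the squared norms: a norm bound passes to almost everywhere limits
  without any dominating function.\<close>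

lemma L2_limit:
  fixes f :: "real \<Rightarrow> 'a::{banach, second_countable_topology}"
  assumes s: "\<And>n. s n \<in> L2" "\<And>n. l2norm (s n) \<le> c" and f: "f \<in> borel_measurable borel"
    and lim: "AE x in lborel. (\<lambda>n. s n x) \<longlonglongrightarrow> f x"
  shows "f \<in> L2" and "l2norm f \<le> c"
proof -
  have c: "0 \<le> c"
    using s(2)[of 0] l2norm_nonneg order_trans by blast
  have [measurable]: "\<And>n. s n \<in> borel_measurable borel"
    using s L2_measurable by blast
  have "(\<integral>\<^sup>+x. ennreal ((norm (f x))\<^sup>2) \<partial>lborel) = (\<integral>\<^sup>+x. liminf (\<lambda>n. ennreal ((norm (s n x))\<^sup>2)) \<partial>lborel)"
  proof (rule nn_integral_cong_AE, use lim in eventually_elim)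
    fix x assume "(\<lambda>n. s n x) \<longlonglongrightarrow> f x"
    then have "(\<lambda>n. ennreal ((norm (s n x))\<^sup>2)) \<longlonglongrightarrow> ennreal ((norm (f x))\<^sup>2)"
      by (intro tendsto_ennrealI tendsto_power tendsto_norm)
    then show "ennreal ((norm (f x))\<^sup>2) = liminf (\<lambda>n. ennreal ((norm (s n x))\<^sup>2))"
      using lim_imp_Liminf[OF trivial_limit_sequentially] by metis
  qed
  also have "\<dots> \<le> liminf (\<lambda>n. \<integral>\<^sup>+x. ennreal ((norm (s n x))\<^sup>2) \<partial>lborel)"
    by (rule nn_integral_liminf) auto
  also have "\<dots> \<le> liminf (\<lambda>n. ennreal (c\<^sup>2))"
    using s by (intro Liminf_mono always_eventually allI) (simp add: nn_integral_L2 ennreal_leI power_mono)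
  also have "\<dots> = ennreal (c\<^sup>2)"
    by (simp add: Liminf_const)
  finally have le: "(\<integral>\<^sup>+x. ennreal ((norm (f x))\<^sup>2) \<partial>lborel) \<le> ennreal (c\<^sup>2)" .
  show "f \<in> L2" "l2norm f \<le> c"
    using L2_I[OF f c le] by auto
qed

text \<open>Monotone convergence for the squared partial sums of \<open>norm (f n x)\<close> shows
  that their supremum is finite almost everywhere. The value of \<open>suminf\<close> at points of
  divergence thus matters only on a null set.\<close>

lemma L2_series:
  fixes f :: "nat \<Rightarrow> real \<Rightarrow> 'a::{banach, second_countable_topology}"
  assumes f: "\<And>n. f n \<in> L2" and sum: "summable (\<lambda>n. l2norm (f n))"
  shows "AE x in lborel. summable (\<lambda>n. norm (f n x))"
    and "(\<lambda>x. \<Sum>n. f n x) \<in> L2"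
    and "l2norm (\<lambda>x. \<Sum>n. f n x) \<le> (\<Sum>n. l2norm (f n))"
proof -
  have [measurable]: "\<And>n. f n \<in> borel_measurable borel"
    using f L2_measurable by blast
  let ?C = "\<Sum>n. l2norm (f n)"
  let ?S = "\<lambda>N x. \<Sum>n<N. norm (f n x)"
  have S: "?S N \<in> L2" "l2norm (?S N) \<le> ?C" for N
  proof -
    have *: "?S N \<in> L2 \<and> l2norm (?S N) \<le> (\<Sum>n<N. l2norm (\<lambda>x. norm (f n x)))"
      by (rule L2_sum) (auto intro: L2_norm f)
    also have "(\<Sum>n<N. l2norm (\<lambda>x. norm (f n x))) = (\<Sum>n<N. l2norm (f n))"
      by (simp add: L2_norm f)
    finally show "?S N \<in> L2" "l2norm (?S N) \<le> ?C"
      using sum_le_suminf[OF sum, of "{..<N}"] by auto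
  qed
  have "(\<integral>\<^sup>+x. (SUP N. ennreal ((?S N x)\<^sup>2)) \<partial>lborel) = (SUP N. \<integral>\<^sup>+x. ennreal ((?S N x)\<^sup>2) \<partial>lborel)"
    by (rule nn_integral_monotone_convergence_SUP)
       (auto simp: incseq_def le_fun_def intro!: power_mono ennreal_leI sum_mono2 sum_nonneg)
  also have "\<dots> \<le> ennreal (?C\<^sup>2)"
  proof (rule SUP_least)
    fix N
    have "(\<integral>\<^sup>+x. ennreal ((?S N x)\<^sup>2) \<partial>lborel) = ennreal ((l2norm (?S N))\<^sup>2)"
      using nn_integral_L2[OF S(1), of N] by simp
    also have "\<dots> \<le> ennreal (?C\<^sup>2)"
      using S(2)[of N] by (intro ennreal_leI power_mono) auto
    finally show "(\<integral>\<^sup>+x. ennreal ((?S N x)\<^sup>2) \<partial>lborel) \<le> ennreal (?C\<^sup>2)" .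
  qed
  finally have "(\<integral>\<^sup>+x. (SUP N. ennreal ((?S N x)\<^sup>2)) \<partial>lborel) \<noteq> \<infinity>"
    by (auto simp: top_unique)
  then have "AE x in lborel. (SUP N. ennreal ((?S N x)\<^sup>2)) \<noteq> \<infinity>"
    by (intro nn_integral_PInf_AE) auto
  then show ae: "AE x in lborel. summable (\<lambda>n. norm (f n x))"
  proof eventually_elim
    case (elim x)
    then obtain r where r: "0 \<le> r" "(SUP N. ennreal ((?S N x)\<^sup>2)) = ennreal r"
      by (cases "SUP N. ennreal ((?S N x)\<^sup>2)") auto
    have "?S N x \<le> sqrt r" for N
    proof -
      have "ennreal ((?S N x)\<^sup>2) \<le> ennreal r"
        unfolding r(2)[symmetric] by (rule SUP_upper) simp
      then have "(?S N x)\<^sup>2 \<le> r"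
        using r(1) by simp
      then show ?thesis
        by (rule real_le_rsqrt)
    qed
    then show ?case
      by (intro summableI_nonneg_bounded[where x = "sqrt r"]) auto
  qed
  have part: "(\<lambda>x. \<Sum>n<N. f n x) \<in> L2" "l2norm (\<lambda>x. \<Sum>n<N. f n x) \<le> ?C" for N
    using L2_sum[of "{..<N}" f] f sum_le_suminf[OF sum, of "{..<N}"] by auto
  have lim: "AE x in lborel. (\<lambda>N. \<Sum>n<N. f n x) \<longlonglongrightarrow> (\<Sum>n. f n x)"
    using ae by eventually_elim (simp add: summable_LIMSEQ summable_norm_cancel)
  show "(\<lambda>x. \<Sum>n. f n x) \<in> L2" "l2norm (\<lambda>x. \<Sum>n. f n x) \<le> ?C"
    using L2_limit[OF part _ lim] by auto
qed

text \<open>Riesz-Fischer: along a subsequence with increments below (1/2)^k the sequence is a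
  telescoping series that converges almost everywhere; \<open>L2_limit\<close>, applied to the
  differences with a fixed member, turns this into convergence in norm of the whole
  sequence.\<close>

lemma L2_complete:
  fixes s :: "nat \<Rightarrow> real \<Rightarrow> 'a::{banach, second_countable_topology}"
  assumes s: "\<And>n. s n \<in> L2"
    and Cauchy: "\<And>e. 0 < e \<Longrightarrow> \<exists>N. \<forall>m\<ge>N. \<forall>n\<ge>N. l2norm (\<lambda>x. s m x - s n x) < e"
  shows "\<exists>f\<in>L2. (\<lambda>n. l2norm (\<lambda>x. s n x - f x)) \<longlonglongrightarrow> 0"
proof -
  have [measurable]: "\<And>n. s n \<in> borel_measurable borel"
    using s L2_measurable by blast
  have "\<exists>N. \<forall>m\<ge>N. \<forall>n\<ge>N. l2norm (\<lambda>x. s m x - s n x) < (1/2)^k" for k :: nat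
    by (rule Cauchy) simp
  then obtain N where N: "\<And>k m n. m \<ge> N k \<Longrightarrow> n \<ge> N k \<Longrightarrow> l2norm (\<lambda>x. s m x - s n x) < (1/2)^k"
    by metis
  \<comment> \<open>Summing \<open>N\<close> makes \<open>r j\<close> at least \<open>N k\<close>
    for all k \<le> j, so that a late member of the subsequence meets every earlier
    accuracy.\<close>
  define r where "r k = (\<Sum>i\<le>k. N i)" for k
  have r: "N k \<le> r j" if "k \<le> j" for k j
    unfolding r_def using that by (intro member_le_sum) auto
  define f where "f k x = s (r (Suc k)) x - s (r k) x" for k x
  have f: "f k \<in> L2" for k
    unfolding f_def by (intro L2_diff s)
  have "summable (\<lambda>k. l2norm (f k))"
  proof (rule summable_comparison_test')
    show "summable (\<lambda>k. (1/2) ^ k :: real)"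
      by (rule summable_geometric) simp
    show "norm (l2norm (f k)) \<le> (1/2)^k" if "k \<ge> 0" for k
      using N[OF r[of k "Suc k"] r[of k k]] by (simp add: f_def[abs_def])
  qed
  from L2_series[OF f this] have ae: "AE x in lborel. summable (\<lambda>k. norm (f k x))"
    and F: "(\<lambda>x. \<Sum>k. f k x) \<in> L2"
    by auto
  define g where "g x = s (r 0) x + (\<Sum>k. f k x)" for x
  have g: "g \<in> L2"
    unfolding g_def by (intro L2_add s F)
  note [measurable] = L2_measurable[OF g]
  have lim: "AE x in lborel. (\<lambda>j. s (r j) x) \<longlonglongrightarrow> g x"
    using ae
  proof eventually_elim
    case (elim x)
    have "s (r 0) x + (\<Sum>k<j. f k x) = s (r j) x" for j
      using sum_lessThan_telescope[of "\<lambda>k. s (r k) x" j] by (simp add: f_def)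
    moreover have "(\<lambda>j. s (r 0) x + (\<Sum>k<j. f k x)) \<longlonglongrightarrow> g x"
      unfolding g_def using elim
      by (intro tendsto_add[OF tendsto_const summable_LIMSEQ[OF summable_norm_cancel]])
    ultimately show ?case
      by simp
  qed
  have bound: "l2norm (\<lambda>x. s m x - g x) \<le> (1/2)^k" if m: "m \<ge> N k" for m k
  proof (rule L2_limit(2))
    show "(\<lambda>x. s m x - s (r (j + k)) x) \<in> L2" for j
      by (intro L2_diff s)
    show "l2norm (\<lambda>x. s m x - s (r (j + k)) x) \<le> (1/2)^k" for j
      using N[OF m r[of k "j + k"]] by simp
    show "AE x in lborel. (\<lambda>j. s m x - s (r (j + k)) x) \<longlonglongrightarrow> s m x - g x"
      using lim by eventually_elim (intro tendsto_intros LIMSEQ_ignore_initial_segment)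
  qed measurable
  have "(\<lambda>n. l2norm (\<lambda>x. s n x - g x)) \<longlonglongrightarrow> 0"
  proof (rule LIMSEQ_I)
    fix e :: real assume "0 < e"
    then obtain k where "(1/2)^k < e"
      using real_arch_pow_inv[of e "1/2"] by auto
    with bound show "\<exists>no. \<forall>n\<ge>no. norm (l2norm (\<lambda>x. s n x - g x) - 0) < e"
      by (intro exI[of _ "N k"]) (auto intro: le_less_trans)
  qed
  with g show ?thesis
    by blast
qed

section \<open>Density of continuous functions with compact support\<close>

lemma L2_compact_support:
  fixes g :: "real \<Rightarrow> 'a::{banach, second_countable_topology}"
  assumes [measurable]: "g \<in> borel_measurable borel" and B: "\<And>x. norm (g x) \<le> B"
    and R: "\<And>x. \<bar>x\<bar> > R \<Longrightarrow> g x = 0"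
  shows "g \<in> L2" and "integrable lborel g"
proof -
  have ind: "integrable lborel (\<lambda>x. c * indicator {-R..R} x :: real)" for c
    by (intro integrable_mult_right integrable_real_indicator) (auto simp: emeasure_lborel_Icc_eq)
  have B0: "0 \<le> B"
    using B[of 0] norm_ge_zero order_trans by blast
  show "integrable lborel g"
    by (rule Bochner_Integration.integrable_bound[OF ind[of B]])
       (use B B0 R in \<open>auto simp: indicator_def abs_le_iff not_le intro!: AE_I2\<close>)
  have "integrable lborel (\<lambda>x. (norm (g x))\<^sup>2)"
    by (rule Bochner_Integration.integrable_bound[OF ind[of "B\<^sup>2"]])
       (use B B0 R in \<open>auto simp: indicator_def abs_le_iff not_le intro!: AE_I2 power_mono\<close>)
  then show "g \<in> L2"
    by (simp add: L2_def)
qed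

text \<open>Measurability provides continuous functions that converge almost everywhere but are not
  controlled in size; after a modification that does not affect the limit, dominated convergence
  applies.\<close>

lemma L2_dense_continuous_bounded:
  fixes f :: "real \<Rightarrow> real"
  assumes [measurable]: "f \<in> borel_measurable borel" and b: "\<And>x. \<bar>f x\<bar> \<le> b"
    and R: "\<And>x. \<bar>x\<bar> > R \<Longrightarrow> f x = 0" and e: "0 < e"
  shows "\<exists>g. continuous_on UNIV g \<and> (\<forall>x. \<bar>g x\<bar> \<le> b) \<and> (\<forall>x. \<bar>x\<bar> > R + 1 \<longrightarrow> g x = 0) \<and>
    l2norm (\<lambda>x. g x - f x) < e"
proof -
  have b0: "0 \<le> b"
    using b[of 0] by linarith
  have "f measurable_on UNIV"
    by (intro lebesgue_measurable_imp_measurable_on_real measurable_completion) auto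
  then obtain N h where N: "negligible N" and h: "\<And>n. continuous_on UNIV (h n)"
    and lim: "\<And>x. x \<notin> N \<Longrightarrow> (\<lambda>n. h n x) \<longlonglongrightarrow> f x"
    unfolding measurable_on_def by auto
  \<comment> \<open>Clamping to [-b, b] and multiplying by a piecewise linear cutoff, equal to 1 on
    [-R, R] and to 0 beyond R + 1, leaves the limit \<open>f\<close> unchanged, because
    \<open>f\<close> itself is bounded by \<open>b\<close> and vanishes outside [-R, R].\<close>
  define g where "g n x = max (- b) (min b (h n x)) * max 0 (min 1 (R + 1 - \<bar>x\<bar>))" for n x
  have g: "continuous_on UNIV (g n)" for n
    unfolding g_def by (intro continuous_intros h)
  then have [measurable]: "g n \<in> borel_measurable borel" for n
    by (rule borel_measurable_continuous_onI)
  have gb: "\<bar>g n x\<bar> \<le> b" for n x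
  proof -
    have "\<bar>g n x\<bar> \<le> b * 1"
      unfolding g_def abs_mult using b0 by (intro mult_mono) auto
    then show ?thesis
      by simp
  qed
  have gR: "g n x = 0" if "\<bar>x\<bar> > R + 1" for n x
    using that by (simp add: g_def)
  have "AE x in lebesgue. x \<notin> N"
    using N by (intro AE_not_in) (simp add: negligible_iff_null_sets)
  then have "AE x in lborel. x \<notin> N"
    by (simp add: AE_completion_iff)
  then have ae: "AE x in lborel. (\<lambda>n. g n x) \<longlonglongrightarrow> f x"
  proof eventually_elim
    case (elim x)
    have "(\<lambda>n. g n x) \<longlonglongrightarrow> max (- b) (min b (f x)) * max 0 (min 1 (R + 1 - \<bar>x\<bar>))"
      unfolding g_def by (intro tendsto_intros lim elim)
    also have "max (- b) (min b (f x)) = f x"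
      using b[of x] by (auto simp: min_def max_def)
    also have "f x * max 0 (min 1 (R + 1 - \<bar>x\<bar>)) = f x"
      using R[of x] by (cases "\<bar>x\<bar> > R") auto
    finally show ?case .
  qed
  have "(\<lambda>n. l2norm (\<lambda>x. g n x - f x)) \<longlonglongrightarrow> 0"
  proof (rule L2_dominated[OF _ _ _ _ ae])
    show "(\<lambda>x. 2 * b * indicator {-(R + 1)..R + 1} x :: real) \<in> L2"
      using b0 by (intro L2_compact_support[where B = "2 * b" and R = "R + 1"]) (auto simp: indicator_def)
    show "AE x in lborel. norm (g n x - f x) \<le> norm (2 * b * indicator {-(R + 1)..R + 1} x :: real)" for n
    proof (rule AE_I2)
      fix x
      show "norm (g n x - f x) \<le> norm (2 * b * indicator {-(R + 1)..R + 1} x :: real)"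
      proof (cases "\<bar>x\<bar> > R + 1")
        case True
        with R[of x] gR[of x n] show ?thesis
          by simp
      next
        case False
        then show ?thesis
          using gb[of n x] b[of x] b0 by (auto simp: indicator_def)
      qed
    qed
  qed auto
  from LIMSEQ_D[OF this e] obtain n where "l2norm (\<lambda>x. g n x - f x) < e"
    by auto
  with g gb gR show ?thesis
    by blast
qed

lemma L2_dense_continuous:
  fixes f :: "real \<Rightarrow> real"
  assumes f: "f \<in> L2" and e: "0 < e"
  shows "\<exists>g b R. continuous_on UNIV g \<and> (\<forall>x. \<bar>g x\<bar> \<le> b) \<and> (\<forall>x. \<bar>x\<bar> > R \<longrightarrow> g x = 0) \<and>
    l2norm (\<lambda>x. g x - f x) < e"
proof -
  note [measurable] = L2_measurable[OF f]
  \<comment> \<open>Cutting off both argument and value makes \<open>h n\<close> bounded with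
    bounded support, while the error stays below \<bar>f\<bar>.\<close>
  define h where "h n x = (if \<bar>x\<bar> \<le> real n \<and> \<bar>f x\<bar> \<le> real n then f x else 0)" for n x
  have [measurable]: "h n \<in> borel_measurable borel" for n
    unfolding h_def by measurable
  have "(\<lambda>n. l2norm (\<lambda>x. h n x - f x)) \<longlonglongrightarrow> 0"
  proof (rule L2_dominated[OF _ _ f])
    show "AE x in lborel. (\<lambda>n. h n x) \<longlonglongrightarrow> f x"
    proof (intro AE_I2 tendsto_eventually)
      fix x :: real
      obtain N where "max \<bar>x\<bar> \<bar>f x\<bar> \<le> real N"
        using real_arch_simple by blast
      then show "eventually (\<lambda>n. h n x = f x) sequentially"
        by (intro eventually_sequentiallyI[of N]) (auto simp: h_def)
    qed
  qed (auto simp: h_def)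
  from LIMSEQ_D[OF this, of "e/2"] e obtain n where n: "l2norm (\<lambda>x. h n x - f x) < e / 2"
    by auto
  obtain g where g: "continuous_on UNIV g" "\<forall>x. \<bar>g x\<bar> \<le> real n" "\<forall>x. \<bar>x\<bar> > real n + 1 \<longrightarrow> g x = 0"
    "l2norm (\<lambda>x. g x - h n x) < e / 2"
  proof -
    have "\<exists>g. continuous_on UNIV g \<and> (\<forall>x. \<bar>g x\<bar> \<le> real n) \<and> (\<forall>x. \<bar>x\<bar> > real n + 1 \<longrightarrow> g x = 0) \<and>
      l2norm (\<lambda>x. g x - h n x) < e / 2"
      by (rule L2_dense_continuous_bounded) (use e in \<open>auto simp: h_def\<close>)
    with that show thesis
      by blast
  qed
  have "h n \<in> L2"
    by (rule L2_compact_support(1)[where B = "real n" and R = "real n"]) (auto simp: h_def)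
  moreover have "g \<in> L2"
    by (rule L2_compact_support(1)[where B = "real n" and R = "real n + 1"])
       (use g in \<open>auto intro: borel_measurable_continuous_onI\<close>)
  ultimately have "h n \<in> L2" "g \<in> L2"
    by auto
  from l2norm_triangle3[OF this(2,1) f] g(4) n have "l2norm (\<lambda>x. g x - f x) < e"
    by simp
  with g show ?thesis
    by blast
qed

section \<open>Convolution\<close>

definition conv :: "(real \<Rightarrow> real) \<Rightarrow> (real \<Rightarrow> real) \<Rightarrow> real \<Rightarrow> real" where
  "conv k f z = (\<integral>y. k (z - y) * f y \<partial>lborel)"

lemma borel_measurable_conv [measurable]:
  assumes [measurable]: "k \<in> borel_measurable borel" "f \<in> borel_measurable borel"
  shows "conv k f \<in> borel_measurable borel"
  unfolding conv_def by measurable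

text \<open>Convolution removes the ambiguity on null sets: the conclusion holds at every point.
  Objects that are fixed only almost everywhere may therefore be exchanged under a
  convolution.\<close>

lemma conv_cong_AE:
  assumes [measurable]: "k \<in> borel_measurable borel" "f \<in> borel_measurable borel" "g \<in> borel_measurable borel"
    and "AE x in lborel. f x = g x"
  shows "conv k f = conv k g"
  unfolding conv_def using assms(4) by (intro ext integral_cong_AE) auto

lemma lborel_nn_integral_reflect:
  fixes z :: real
  assumes [measurable]: "f \<in> borel_measurable borel"
  shows "(\<integral>\<^sup>+y. f (z - y) \<partial>lborel) = (\<integral>\<^sup>+y. f y \<partial>lborel)"
  using nn_integral_real_affine[of f "-1" z] by simp

lemma lborel_nn_integral_shift:
  fixes y :: real
  assumes [measurable]: "f \<in> borel_measurable borel"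
  shows "(\<integral>\<^sup>+z. f (z - y) \<partial>lborel) = (\<integral>\<^sup>+z. f z \<partial>lborel)"
  using nn_integral_real_affine[of f "1" "- y"] by simp

lemma integrable_reflect_shift:
  fixes f :: "real \<Rightarrow> 'a::{banach, second_countable_topology}"
  assumes "integrable lborel f"
  shows "integrable lborel (\<lambda>y. f (z - y))"
  using lborel_integrable_real_affine[OF assms, of "-1" z] by simp

lemma integral_reflect_shift:
  fixes f :: "real \<Rightarrow> 'a::{banach, second_countable_topology}"
  shows "(\<integral>y. f (z - y) \<partial>lborel) = (\<integral>y. f y \<partial>lborel)"
  using lborel_integral_real_affine[of "-1" f z] by simp

lemma L2_reflect_shift:
  fixes f :: "real \<Rightarrow> real"
  assumes f: "f \<in> L2"
  shows "(\<lambda>y. f (z - y)) \<in> L2" and "l2norm (\<lambda>y. f (z - y)) = l2norm f"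
proof -
  note [measurable] = L2_measurable[OF f]
  show "(\<lambda>y. f (z - y)) \<in> L2"
    using integrable_reflect_shift[OF L2_integrable[OF f], of z] by (auto simp: L2_def)
  show "l2norm (\<lambda>y. f (z - y)) = l2norm f"
    unfolding l2norm_def using integral_reflect_shift[of "\<lambda>y. (norm (f y))\<^sup>2" z] by simp
qed

text \<open>Cauchy-Schwarz at a fixed point \<open>z\<close>. A kernel in L2 maps L2 to bounded
  functions, which later makes the quadratic term of the reduced equation square integrable.\<close>

lemma
  assumes k: "k \<in> L2" and f: "f \<in> L2"
  shows integrable_conv: "integrable lborel (\<lambda>y. k (z - y) * f y)"
    and conv_bound: "\<bar>conv k f z\<bar> \<le> l2norm k * l2norm f"
  using L2_integrable_mult[OF L2_reflect_shift(1)[OF k] f, of z]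
  by (simp_all add: conv_def L2_reflect_shift(2)[OF k])

lemma conv_diff:
  assumes "k \<in> L2" "f \<in> L2" "g \<in> L2"
  shows "conv k (\<lambda>x. f x - g x) z = conv k f z - conv k g z"
  using integrable_conv[OF assms(1)] assms(2,3) by (simp add: conv_def right_diff_distrib)

lemma conv_add:
  assumes "k \<in> L2" "f \<in> L2" "g \<in> L2"
  shows "conv k (\<lambda>x. f x + g x) z = conv k f z + conv k g z"
  using integrable_conv[OF assms(1)] assms(2,3) by (simp add: conv_def distrib_left)

lemma conv_scale: "conv k (\<lambda>x. c * f x) z = c * conv k f z"
  by (simp add: conv_def mult.left_commute)

text \<open>If \<open>f\<close> is not integrable the left side is 0 by convention. Young's
  inequality can so be started before the convolution integral is known to exist.\<close>

lemma integral_norm_bound_nn: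
  fixes f :: "'a \<Rightarrow> 'b::{banach, second_countable_topology}"
  shows "ennreal (norm (\<integral>x. f x \<partial>M)) \<le> (\<integral>\<^sup>+x. ennreal (norm (f x)) \<partial>M)"
  by (cases "integrable M f") (auto simp: integral_norm_bound_ennreal not_integrable_integral_eq)

text \<open>Young's inequality comes from the Cauchy-Schwarz inequality for the measure \<open>|k(z - y)| dy\<close>.\<close>

lemma conv_L2:
  assumes k: "integrable lborel k" and f: "f \<in> L2"
  shows "conv k f \<in> L2" and "l2norm (conv k f) \<le> (\<integral>x. \<bar>k x\<bar> \<partial>lborel) * l2norm f"
proof -
  have [measurable]: "k \<in> borel_measurable borel"
    using k by auto
  note [measurable] = L2_measurable[OF f]
  let ?K = "\<integral>x. \<bar>k x\<bar> \<partial>lborel"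
  have K: "(\<integral>\<^sup>+x. ennreal \<bar>k x\<bar> \<partial>lborel) = ennreal ?K"
    using k by (intro nn_integral_eq_integral) auto
  have point: "ennreal ((norm (conv k f z))\<^sup>2) \<le> ennreal ?K * (\<integral>\<^sup>+y. ennreal (\<bar>k (z - y)\<bar> * (f y)\<^sup>2) \<partial>lborel)" for z
  proof -
    have "ennreal (norm (conv k f z)) \<le> (\<integral>\<^sup>+y. ennreal (norm (k (z - y) * f y)) \<partial>lborel)"
      unfolding conv_def by (rule integral_norm_bound_nn)
    also have "\<dots> = (\<integral>\<^sup>+y. ennreal (sqrt \<bar>k (z - y)\<bar>) * ennreal (sqrt \<bar>k (z - y)\<bar> * \<bar>f y\<bar>) \<partial>lborel)"
      by (intro nn_integral_cong) (simp add: ennreal_mult[symmetric] abs_mult mult.assoc[symmetric])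
    finally have "(ennreal (norm (conv k f z)))\<^sup>2 \<le> (\<integral>\<^sup>+y. ennreal (sqrt \<bar>k (z - y)\<bar>) * ennreal (sqrt \<bar>k (z - y)\<bar> * \<bar>f y\<bar>) \<partial>lborel)\<^sup>2"
      by (rule power_mono) simp
    also have "\<dots> \<le> (\<integral>\<^sup>+y. (ennreal (sqrt \<bar>k (z - y)\<bar>))\<^sup>2 \<partial>lborel) * (\<integral>\<^sup>+y. (ennreal (sqrt \<bar>k (z - y)\<bar> * \<bar>f y\<bar>))\<^sup>2 \<partial>lborel)"
      by (rule Cauchy_Schwarz_nn_integral) auto
    also have "(\<integral>\<^sup>+y. (ennreal (sqrt \<bar>k (z - y)\<bar>))\<^sup>2 \<partial>lborel) = ennreal ?K"
      using lborel_nn_integral_reflect[of "\<lambda>y. ennreal \<bar>k y\<bar>" z] by (simp add: ennreal_power K)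
    also have "(\<integral>\<^sup>+y. (ennreal (sqrt \<bar>k (z - y)\<bar> * \<bar>f y\<bar>))\<^sup>2 \<partial>lborel) = (\<integral>\<^sup>+y. ennreal (\<bar>k (z - y)\<bar> * (f y)\<^sup>2) \<partial>lborel)"
      by (simp add: ennreal_power power_mult_distrib)
    finally show ?thesis
      by (simp add: ennreal_power)
  qed
  have "(\<integral>\<^sup>+z. ennreal ((norm (conv k f z))\<^sup>2) \<partial>lborel)
      \<le> (\<integral>\<^sup>+z. ennreal ?K * (\<integral>\<^sup>+y. ennreal (\<bar>k (z - y)\<bar> * (f y)\<^sup>2) \<partial>lborel) \<partial>lborel)"
    by (rule nn_integral_mono) (rule point)
  also have "\<dots> = ennreal ?K * (\<integral>\<^sup>+z. (\<integral>\<^sup>+y. ennreal (\<bar>k (z - y)\<bar> * (f y)\<^sup>2) \<partial>lborel) \<partial>lborel)"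
    by (rule nn_integral_cmult) measurable
  also have "(\<integral>\<^sup>+z. (\<integral>\<^sup>+y. ennreal (\<bar>k (z - y)\<bar> * (f y)\<^sup>2) \<partial>lborel) \<partial>lborel)
      = (\<integral>\<^sup>+y. (\<integral>\<^sup>+z. ennreal (\<bar>k (z - y)\<bar> * (f y)\<^sup>2) \<partial>lborel) \<partial>lborel)"
    by (rule lborel_pair.Fubini') measurable
  also have "\<dots> = (\<integral>\<^sup>+y. ennreal ?K * ennreal ((norm (f y))\<^sup>2) \<partial>lborel)"
  proof (rule nn_integral_cong)
    fix y
    have "(\<integral>\<^sup>+z. ennreal (\<bar>k (z - y)\<bar> * (f y)\<^sup>2) \<partial>lborel) = (\<integral>\<^sup>+z. ennreal \<bar>k (z - y)\<bar> * ennreal ((f y)\<^sup>2) \<partial>lborel)"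
      by (simp add: ennreal_mult)
    also have "\<dots> = (\<integral>\<^sup>+z. ennreal \<bar>k (z - y)\<bar> \<partial>lborel) * ennreal ((f y)\<^sup>2)"
      by (rule nn_integral_multc) measurable
    also have "(\<integral>\<^sup>+z. ennreal \<bar>k (z - y)\<bar> \<partial>lborel) = ennreal ?K"
      using lborel_nn_integral_shift[of "\<lambda>z. ennreal \<bar>k z\<bar>" y] by (simp add: K)
    finally show "(\<integral>\<^sup>+z. ennreal (\<bar>k (z - y)\<bar> * (f y)\<^sup>2) \<partial>lborel) = ennreal ?K * ennreal ((norm (f y))\<^sup>2)"
      by simp
  qed
  also have "\<dots> = ennreal ?K * ennreal ((l2norm f)\<^sup>2)"
    by (subst nn_integral_cmult) (simp_all add: nn_integral_L2[OF f, simplified])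
  also have "ennreal ?K * (ennreal ?K * ennreal ((l2norm f)\<^sup>2)) = ennreal ((?K * l2norm f)\<^sup>2)"
    by (simp add: ennreal_mult[symmetric] power2_eq_square mult_ac)
  finally have le: "(\<integral>\<^sup>+z. ennreal ((norm (conv k f z))\<^sup>2) \<partial>lborel) \<le> ennreal ((?K * l2norm f)\<^sup>2)" .
  show "conv k f \<in> L2" "l2norm (conv k f) \<le> ?K * l2norm f"
    using L2_I[OF _ _ le] by auto
qed

section \<open>The Fourier transform of integrable functions\<close>

definition ft :: "(real \<Rightarrow> complex) \<Rightarrow> real \<Rightarrow> complex" where
  "ft f \<xi> = (\<integral>x. f x * cis (- (x * \<xi>)) \<partial>lborel)"

lemma borel_measurable_cis [measurable]: "cis \<in> borel_measurable borel"
  by (intro borel_measurable_continuous_onI continuous_on_cis continuous_on_id)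

lemma borel_measurable_ft [measurable]:
  assumes [measurable]: "f \<in> borel_measurable borel"
  shows "ft f \<in> borel_measurable borel"
  unfolding ft_def by measurable

lemma integrable_ft:
  assumes "integrable lborel f" and [measurable]: "g \<in> borel_measurable borel"
  shows "integrable lborel (\<lambda>x. f x * cis (g x * \<xi>))"
proof -
  have [measurable]: "f \<in> borel_measurable borel"
    using assms by auto
  show ?thesis
    by (rule Bochner_Integration.integrable_bound[OF assms(1)]) (auto simp: norm_mult)
qed

lemma integrable_ft':
  assumes "integrable lborel f"
  shows "integrable lborel (\<lambda>x. f x * cis (- (x * \<xi>)))"
  using integrable_ft[OF assms, of uminus \<xi>] by simp

lemma ft_bound: "norm (ft f \<xi>) \<le> (\<integral>x. norm (f x) \<partial>lborel)"
  using integral_norm_bound[of lborel "\<lambda>x. f x * cis (- (x * \<xi>))"] by (simp add: ft_def norm_mult)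

lemma ft_diff:
  assumes "integrable lborel f" "integrable lborel g"
  shows "ft (\<lambda>x. f x - g x) \<xi> = ft f \<xi> - ft g \<xi>"
  using integrable_ft'[OF assms(1)] integrable_ft'[OF assms(2)] by (simp add: ft_def left_diff_distrib)

lemma ft_add:
  assumes "integrable lborel f" "integrable lborel g"
  shows "ft (\<lambda>x. f x + g x) \<xi> = ft f \<xi> + ft g \<xi>"
  using integrable_ft'[OF assms(1)] integrable_ft'[OF assms(2)] by (simp add: ft_def distrib_right)

lemma ft_scale: "ft (\<lambda>x. c * f x) \<xi> = c * ft f \<xi>"
  by (simp add: ft_def mult.assoc)

text \<open>Provides the hypothesis of Fubini's theorem for the multiplication formula; the bounded
  factor \<open>k\<close> stands for the Fourier kernel.\<close>

lemma integrable_pair_mult: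
  fixes f g :: "real \<Rightarrow> complex"
  assumes f: "integrable lborel f" and g: "integrable lborel g"
    and [measurable]: "k \<in> borel_measurable (borel \<Otimes>\<^sub>M borel)" and k: "\<And>p. norm (k p) \<le> 1"
  shows "integrable (lborel \<Otimes>\<^sub>M lborel) (\<lambda>(x, y). f x * g y * k (x, y))"
proof -
  have [measurable]: "f \<in> borel_measurable borel" "g \<in> borel_measurable borel"
    using f g by auto
  have "integrable (lborel \<Otimes>\<^sub>M lborel) (\<lambda>(x, y). f x * g y)"
  proof (rule lborel_pair.Fubini_integrable)
    show "integrable lborel (\<lambda>x. \<integral>y. norm (case (x, y) of (x, y) \<Rightarrow> f x * g y) \<partial>lborel)"
      using f by (simp add: norm_mult integrable_mult_left)
    show "AE x in lborel. integrable lborel (\<lambda>y. case (x, y) of (x, y) \<Rightarrow> f x * g y)"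
      using g by simp
  qed simp
  then show ?thesis
  proof (rule Bochner_Integration.integrable_bound)
    show "AE p in lborel \<Otimes>\<^sub>M lborel. norm (case p of (x, y) \<Rightarrow> f x * g y * k (x, y)) \<le> norm (case p of (x, y) \<Rightarrow> f x * g y)"
      using k by (auto simp: norm_mult mult_left_le intro!: AE_I2)
  qed measurable
qed

text \<open>Fubini's theorem: the phase is symmetric in x and \<xi>, so the inner integral may be
  taken in either variable.\<close>

lemma ft_multiplication:
  assumes f: "integrable lborel f" and g: "integrable lborel g"
  shows "(\<integral>\<xi>. ft f \<xi> * g \<xi> \<partial>lborel) = (\<integral>x. f x * ft g x \<partial>lborel)"
proof -
  have [measurable]: "f \<in> borel_measurable borel" "g \<in> borel_measurable borel"
    using f g by auto
  have int: "integrable (lborel \<Otimes>\<^sub>M lborel) (\<lambda>(x, \<xi>). f x * g \<xi> * (\<lambda>(x, \<xi>). cis (- (x * \<xi>))) (x, \<xi>))"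
    by (rule integrable_pair_mult[OF f g]) auto
  have "(\<integral>\<xi>. ft f \<xi> * g \<xi> \<partial>lborel) = (\<integral>\<xi>. (\<integral>x. f x * g \<xi> * cis (- (x * \<xi>)) \<partial>lborel) \<partial>lborel)"
    unfolding ft_def
    by (subst integral_mult_left_zero[symmetric]) (simp add: mult_ac)
  also have "\<dots> = (\<integral>x. (\<integral>\<xi>. f x * g \<xi> * cis (- (x * \<xi>)) \<partial>lborel) \<partial>lborel)"
    using lborel_pair.Fubini_integral[of "\<lambda>x \<xi>. f x * g \<xi> * cis (- (x * \<xi>))"] int by simp
  also have "\<dots> = (\<integral>x. f x * ft g x \<partial>lborel)"
    unfolding ft_def
    by (subst integral_mult_right_zero[symmetric]) (simp add: mult_ac)
  finally show ?thesis .
qed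

section \<open>Gaussian regularisation\<close>

definition gauss :: "real \<Rightarrow> real \<Rightarrow> real" where
  "gauss e \<xi> = exp (- ((e * \<xi>)\<^sup>2 / 2))"

text \<open>For e > 0 this is the normal density with mean 0 and standard deviation
  \<open>e\<close>, an approximate identity as \<open>e\<close> tends to 0; its Fourier transform is
  \<open>gauss e\<close>.\<close>

definition heat :: "real \<Rightarrow> real \<Rightarrow> real" where
  "heat e u = std_normal_density (u / e) / e"

lemma borel_measurable_gauss [measurable]: "gauss e \<in> borel_measurable borel"
  unfolding gauss_def by measurable

lemma borel_measurable_heat [measurable]: "heat e \<in> borel_measurable borel"
  unfolding heat_def by measurable

lemma has_bochner_integral_heat:
  assumes "0 < e"
  shows "has_bochner_integral lborel (heat e) 1"
proof -
  have "has_bochner_integral lborel std_normal_density 1"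
    by (simp add: has_bochner_integral_iff)
  then have "has_bochner_integral lborel (\<lambda>x. std_normal_density (0 + (1/e) * x)) (1 /\<^sub>R \<bar>1/e\<bar>)"
    using assms by (subst lborel_has_bochner_integral_real_affine_iff[symmetric]) auto
  from has_bochner_integral_mult_left[OF this, of "1/e"] assms show ?thesis
    by (simp add: heat_def[abs_def] scaleR_conv_of_real)
qed

lemma integral_abs_heat:
  assumes "0 < e"
  shows "integrable lborel (heat e)" and "(\<integral>x. \<bar>heat e x\<bar> \<partial>lborel) = 1"
proof -
  have "\<bar>heat e x\<bar> = heat e x" for x
    using assms by (simp add: heat_def)
  then show "integrable lborel (heat e)" "(\<integral>x. \<bar>heat e x\<bar> \<partial>lborel) = 1"
    using has_bochner_integral_heat[OF assms] by (simp_all add: has_bochner_integral_iff)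
qed

lemma ft_gauss:
  assumes e: "0 < e"
  shows "ft (\<lambda>\<xi>. of_real (gauss e \<xi>)) u = of_real (2 * pi * heat e u)"
    and "integrable lborel (gauss e)"
proof -
  have G: "gauss e \<xi> = sqrt (2 * pi) * std_normal_density (e * \<xi>)" for \<xi>
    by (simp add: gauss_def std_normal_density_def)
  show "integrable lborel (gauss e)"
    unfolding G[abs_def] using lborel_integrable_real_affine[of std_normal_density e 0] e
    by (intro integrable_mult_right) simp
  \<comment> \<open>The characteristic function of the standard normal law. It will be evaluated at
    t = - u / e, which accounts for the sign of the phase in \<open>ft\<close> and for the
    scaling.\<close>
  have "(\<integral>x. of_real (std_normal_density x) * cis (t * x) \<partial>lborel) = of_real (exp (- (t\<^sup>2) / 2))" for t
  proof -
    have "(\<integral>x. of_real (std_normal_density x) * cis (t * x) \<partial>lborel) = char std_normal_distribution t"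
      unfolding char_def
      by (subst integral_density) (auto simp: cis_conv_exp scaleR_conv_of_real)
    then show ?thesis
      by (simp add: char_std_normal_distribution)
  qed
  note char = this
  have "ft (\<lambda>\<xi>. of_real (gauss e \<xi>)) u
      = sqrt (2 * pi) * (\<integral>\<xi>. of_real (std_normal_density (e * \<xi>)) * cis ((- u / e) * (e * \<xi>)) \<partial>lborel)"
    unfolding ft_def G using e
    by (subst integral_mult_right_zero[symmetric]) (simp add: mult_ac)
  also have "(\<integral>\<xi>. of_real (std_normal_density (e * \<xi>)) * cis ((- u / e) * (e * \<xi>)) \<partial>lborel)
      = (\<integral>x. of_real (std_normal_density x) * cis ((- u / e) * x) \<partial>lborel) / e"
    using lborel_integral_real_affine[of e "\<lambda>x. of_real (std_normal_density x) * cis ((- u / e) * x)" 0] e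
    by (simp add: scaleR_conv_of_real)
  also have "\<dots> = complex_of_real (exp (- ((- u / e)\<^sup>2) / 2)) / complex_of_real e"
    by (simp only: char)
  also have "complex_of_real (sqrt (2 * pi)) * \<dots> = of_real (2 * pi * heat e u)"
  proof -
    have "sqrt (2 * pi) * (exp (- ((- u / e)\<^sup>2) / 2) / e) = 2 * pi * heat e u"
    proof -
      have s: "2 * pi = sqrt (2 * pi) * sqrt (2 * pi)" "sqrt (2 * pi) \<noteq> 0"
        by simp_all
      have "s * (E / e) = s * s * (1 / s * E / e)" if "s \<noteq> 0" for s E :: real
        using that by simp
      from this[OF s(2)] show ?thesis
        unfolding heat_def std_normal_density_def s(1)[symmetric] by (simp add: power_divide)
    qed
    then show ?thesis
      by (metis of_real_mult of_real_divide)
  qed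
  finally show "ft (\<lambda>\<xi>. of_real (gauss e \<xi>)) u = of_real (2 * pi * heat e u)" .
qed

abbreviation rft :: "(real \<Rightarrow> real) \<Rightarrow> real \<Rightarrow> complex" where
  "rft f \<equiv> ft (\<lambda>x. of_real (f x))"

lemma cnj_rft: "cnj (rft f \<xi>) = rft f (- \<xi>)"
  unfolding ft_def by (subst Bochner_Integration.integral_cnj[symmetric]) (simp add: cis_cnj)

text \<open>The squared transform of an integrable function need not be integrable; the Gaussian
  weight makes it so. The multiplication formula then moves the weight to the space side, where it
  becomes a convolution with the heat kernel.\<close>

lemma gauss_weighted_rft:
  assumes f: "integrable lborel f" and e: "0 < e"
  shows "(\<integral>\<xi>. (norm (rft f \<xi>))\<^sup>2 * gauss e \<xi> \<partial>lborel) = 2 * pi * (\<integral>x. f x * conv (heat e) f x \<partial>lborel)"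
    and "integrable lborel (\<lambda>\<xi>. (norm (rft f \<xi>))\<^sup>2 * gauss e \<xi>)"
proof -
  have [measurable]: "f \<in> borel_measurable borel"
    using f by auto
  have F: "integrable lborel (\<lambda>x. of_real (f x) :: complex)"
    using f by simp
  have G: "integrable lborel (\<lambda>\<xi>. of_real (gauss e \<xi>) :: complex)"
    using ft_gauss(2)[OF e] by simp
  let ?C = "\<integral>x. norm (of_real (f x) :: complex) \<partial>lborel"
  have bd: "norm (rft f \<xi>) \<le> ?C" for \<xi>
    by (rule ft_bound)
  have C: "0 \<le> ?C"
    by simp
  show "integrable lborel (\<lambda>\<xi>. (norm (rft f \<xi>))\<^sup>2 * gauss e \<xi>)"
    by (rule Bochner_Integration.integrable_bound[OF integrable_mult_right[OF ft_gauss(2)[OF e], of "?C\<^sup>2"]])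
       (auto simp: gauss_def abs_mult intro!: AE_I2 power_mono bd[simplified])
  \<comment> \<open>As \<open>f\<close> is real, \<open>rft f (- \<xi>)\<close> is the conjugate of
    \<open>rft f \<xi>\<close>, so \<open>rft f \<xi> * g \<xi>\<close> is the weighted square. The
    multiplication formula is used twice: to compute \<open>ft g\<close>, and for this
    product.\<close>
  define g where "g \<xi> = rft f (- \<xi>) * of_real (gauss e \<xi>)" for \<xi>
  have g: "integrable lborel g"
    unfolding g_def
    by (rule Bochner_Integration.integrable_bound[OF integrable_mult_right[OF G, of "of_real ?C"]])
       (auto simp: norm_mult intro!: AE_I2 mult_right_mono bd[simplified])
  have ftg: "ft g x = of_real (2 * pi * conv (heat e) f x)" for x
  proof -
    let ?h = "\<lambda>\<xi>. of_real (gauss e \<xi>) * cis (x * \<xi>)"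
    have h: "integrable lborel ?h"
      using integrable_ft[OF G, of "\<lambda>_. x" ] integrable_ft[OF G, of "\<lambda>\<xi>. \<xi>" x] by (simp add: mult.commute)
    have "ft g x = (\<integral>\<xi>. rft f \<xi> * ?h \<xi> \<partial>lborel)"
      unfolding ft_def[of g] g_def
      by (subst integral_reflect_shift[of _ 0, symmetric]) (simp add: gauss_def mult_ac)
    also have "\<dots> = (\<integral>y. of_real (f y) * ft ?h y \<partial>lborel)"
      by (rule ft_multiplication[OF F h])
    also have "\<dots> = (\<integral>y. of_real (f y) * complex_of_real (2 * pi * heat e (x - y)) \<partial>lborel)"
    proof -
      have "ft ?h y = ft (\<lambda>\<xi>. of_real (gauss e \<xi>)) (y - x)" for y
        unfolding ft_def by (intro Bochner_Integration.integral_cong) (auto simp: mult.assoc cis_mult algebra_simps)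
      moreover have "heat e (y - x) = heat e (x - y)" for y
        by (simp add: heat_def std_normal_density_def power2_commute power_divide)
      ultimately show ?thesis
        by (simp only: ft_gauss(1)[OF e])
    qed
    also have "(\<integral>y. of_real (f y) * complex_of_real (2 * pi * heat e (x - y)) \<partial>lborel)
        = of_real (\<integral>y. 2 * pi * (heat e (x - y) * f y) \<partial>lborel)"
      by (subst integral_complex_of_real[symmetric]) (simp add: mult_ac)
    also have "\<dots> = of_real (2 * pi * conv (heat e) f x)"
      by (simp add: conv_def)
    finally show ?thesis .
  qed
  have "of_real (\<integral>\<xi>. (norm (rft f \<xi>))\<^sup>2 * gauss e \<xi> \<partial>lborel) = (\<integral>\<xi>. rft f \<xi> * g \<xi> \<partial>lborel)"
    unfolding g_def cnj_rft[symmetric]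
    by (subst integral_complex_of_real[symmetric]) (simp add: complex_norm_square[symmetric] mult.assoc[symmetric])
  also have "\<dots> = (\<integral>x. of_real (f x) * ft g x \<partial>lborel)"
    by (rule ft_multiplication[OF F g])
  also have "\<dots> = of_real (\<integral>x. 2 * pi * (f x * conv (heat e) f x) \<partial>lborel)"
    unfolding ftg by (subst integral_complex_of_real[symmetric]) (simp add: mult_ac)
  also have "\<dots> = of_real (2 * pi * (\<integral>x. f x * conv (heat e) f x \<partial>lborel))"
    by simp
  finally show "(\<integral>\<xi>. (norm (rft f \<xi>))\<^sup>2 * gauss e \<xi> \<partial>lborel) = 2 * pi * (\<integral>x. f x * conv (heat e) f x \<partial>lborel)"
    by (simp only: of_real_eq_iff)
qed

lemma gauss_tendsto_1: "(\<lambda>n. gauss (1 / real (Suc n)) \<xi>) \<longlonglongrightarrow> 1"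
proof -
  have "(\<lambda>n. gauss (1 / real (Suc n)) \<xi>) \<longlonglongrightarrow> exp (- ((0 * \<xi>)\<^sup>2 / 2))"
    unfolding gauss_def by (intro tendsto_intros LIMSEQ_Suc[OF lim_1_over_n]) simp_all
  then show ?thesis
    by simp
qed

text \<open>The heat kernel has mass one, so Young's inequality bounds the weighted integrals
  uniformly, and Fatou's lemma removes the weight. Equality would in addition require that the heat
  convolutions converge to \<open>f\<close>.\<close>

lemma rft_L2:
  assumes f: "f \<in> L2" "integrable lborel f"
  shows "rft f \<in> L2" and "l2norm (rft f) \<le> sqrt (2 * pi) * l2norm f"
proof -
  note [measurable] = L2_measurable[OF f(1)]
  define s where "s n \<xi> = rft f \<xi> * of_real (sqrt (gauss (1 / real (Suc n)) \<xi>))" for n \<xi>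
  have [measurable]: "s n \<in> borel_measurable borel" for n
    unfolding s_def by measurable
  have sq: "(norm (s n \<xi>))\<^sup>2 = (norm (rft f \<xi>))\<^sup>2 * gauss (1 / real (Suc n)) \<xi>" for n \<xi>
    by (simp add: s_def norm_mult power_mult_distrib gauss_def)
  have s: "s n \<in> L2" for n
    using gauss_weighted_rft(2)[OF f(2), of "1 / real (Suc n)"] by (simp add: L2_def sq)
  have b: "l2norm (s n) \<le> sqrt (2 * pi) * l2norm f" for n
  proof -
    let ?e = "1 / real (Suc n)"
    have h: "integrable lborel (heat ?e)" "(\<integral>x. \<bar>heat ?e x\<bar> \<partial>lborel) = 1"
      using integral_abs_heat[of ?e] by simp_all
    have "(l2norm (s n))\<^sup>2 = 2 * pi * (\<integral>x. f x * conv (heat ?e) f x \<partial>lborel)"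
      using gauss_weighted_rft(1)[OF f(2), of ?e] by (simp add: l2norm_square sq)
    also have "(\<integral>x. f x * conv (heat ?e) f x \<partial>lborel) \<le> l2norm f * l2norm (conv (heat ?e) f)"
      using L2_integrable_mult(2)[OF f(1) conv_L2(1)[OF h(1) f(1)]] by simp
    also have "\<dots> \<le> l2norm f * l2norm f"
      using conv_L2(2)[OF h(1) f(1)] h(2) by (intro mult_left_mono) auto
    also have "2 * pi * (l2norm f * l2norm f) = (sqrt (2 * pi) * l2norm f)\<^sup>2"
      by (simp add: power_mult_distrib power2_eq_square)
    finally show ?thesis
      by (auto intro!: power2_le_imp_le mult_nonneg_nonneg)
  qed
  have lim: "AE \<xi> in lborel. (\<lambda>n. s n \<xi>) \<longlonglongrightarrow> rft f \<xi>"
  proof (rule AE_I2)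
    fix \<xi>
    have "(\<lambda>n. s n \<xi>) \<longlonglongrightarrow> rft f \<xi> * of_real (sqrt 1)"
      unfolding s_def by (intro tendsto_intros gauss_tendsto_1)
    then show "(\<lambda>n. s n \<xi>) \<longlonglongrightarrow> rft f \<xi>"
      by simp
  qed
  show "rft f \<in> L2" "l2norm (rft f) \<le> sqrt (2 * pi) * l2norm f"
    using L2_limit[OF s b _ lim] by auto
qed

text \<open>After the substitution y = x - s / (n + 1) the Gaussian no longer depends on n. A
  multiple of it is the dominating function, and continuity of \<open>g\<close> gives the pointwise
  limit.\<close>

lemma conv_heat_continuous:
  assumes g: "continuous_on UNIV g" and b: "\<And>x. \<bar>g x\<bar> \<le> b"
  shows "(\<lambda>n. conv (heat (1 / real (Suc n))) g x) \<longlonglongrightarrow> g x"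
    and "\<bar>conv (heat (1 / real (Suc n))) g x\<bar> \<le> b"
proof -
  have [measurable]: "g \<in> borel_measurable borel"
    using g by (rule borel_measurable_continuous_onI)
  have eq: "conv (heat (1 / real (Suc n))) g x = (\<integral>s. std_normal_density s * g (x - s / real (Suc n)) \<partial>lborel)" for n
  proof -
    have "conv (heat (1 / real (Suc n))) g x = (\<integral>y. heat (1 / real (Suc n)) y * g (x - y) \<partial>lborel)"
      unfolding conv_def by (subst integral_reflect_shift[of _ x, symmetric]) simp
    also have "\<dots> = (\<integral>s. std_normal_density s * g (x - s / real (Suc n)) \<partial>lborel)"
    proof -
      have "m \<noteq> 0 \<Longrightarrow> \<bar>1 / m\<bar> * (heat (1 / m) (0 + 1 / m * s) * g (x - (0 + 1 / m * s))) = std_normal_density s * g (x - s / m)"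
        if "0 < m" for m s
        using that by (simp add: heat_def)
      note * = this[of "real (Suc n)"]
      show ?thesis
        by (subst lborel_integral_real_affine[of "1 / real (Suc n)" _ 0], simp,
            subst integral_scaleR_right[symmetric], intro Bochner_Integration.integral_cong refl,
            unfold real_scaleR_def, rule *) simp_all
    qed
    finally show ?thesis .
  qed
  have int: "integrable lborel (\<lambda>s. b * std_normal_density s)"
    by simp
  have pb: "norm (std_normal_density s * g (x - s / real (Suc n))) \<le> b * std_normal_density s" for n s
    using mult_left_mono[OF b[of "x - s / real (Suc n)"], of "std_normal_density s"]
    by (simp add: abs_mult mult.commute)
  then have bd: "AE s in lborel. norm (std_normal_density s * g (x - s / real (Suc n))) \<le> b * std_normal_density s" for n
    by (rule AE_I2)
  have "(\<lambda>n. \<integral>s. std_normal_density s * g (x - s / real (Suc n)) \<partial>lborel) \<longlonglongrightarrow> (\<integral>s. std_normal_density s * g x \<partial>lborel)"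
  proof (rule integral_dominated_convergence[OF _ _ int _ bd])
    show "AE s in lborel. (\<lambda>n. std_normal_density s * g (x - s / real (Suc n))) \<longlonglongrightarrow> std_normal_density s * g x"
    proof (rule AE_I2)
      fix s
      have "(\<lambda>n. x - s * (1 / real (Suc n))) \<longlonglongrightarrow> x - s * 0"
        by (intro tendsto_intros LIMSEQ_Suc[OF lim_1_over_n])
      then have "(\<lambda>n. g (x - s / real (Suc n))) \<longlonglongrightarrow> g x"
        by (intro continuous_on_tendsto_compose[OF g]) auto
      then show "(\<lambda>n. std_normal_density s * g (x - s / real (Suc n))) \<longlonglongrightarrow> std_normal_density s * g x"
        by (intro tendsto_intros)
    qed
  qed auto
  then show "(\<lambda>n. conv (heat (1 / real (Suc n))) g x) \<longlonglongrightarrow> g x"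
    unfolding eq by simp
  have "norm (\<integral>s. std_normal_density s * g (x - s / real (Suc n)) \<partial>lborel) \<le> (\<integral>s. b * std_normal_density s \<partial>lborel)"
    by (rule Bochner_Integration.integral_norm_bound_integral[OF Bochner_Integration.integrable_bound[OF int] int pb])
       (use order_trans[OF pb abs_ge_self] in \<open>auto intro!: AE_I2\<close>)
  then show "\<bar>conv (heat (1 / real (Suc n))) g x\<bar> \<le> b"
    unfolding eq by simp
qed

text \<open>Both sides of \<open>gauss_weighted_rft\<close> converge as the weight tends to 1: the
  frequency side is dominated by the squared transform, integrable by \<open>rft_L2\<close>, the
  space side by a multiple of \<bar>g\<bar>.\<close>

lemma rft_Plancherel_continuous:
  assumes g: "continuous_on UNIV g" and b: "\<And>x. \<bar>g x\<bar> \<le> b" and R: "\<And>x. \<bar>x\<bar> > R \<Longrightarrow> g x = 0"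
  shows "l2norm (rft g) = sqrt (2 * pi) * l2norm g"
proof -
  have [measurable]: "g \<in> borel_measurable borel"
    using g by (rule borel_measurable_continuous_onI)
  have g2: "g \<in> L2" "integrable lborel g"
    by (rule L2_compact_support[where B = b and R = R]; use b R in simp)+
  let ?e = "\<lambda>n. 1 / real (Suc n)"
  have lim: "(\<lambda>n. \<integral>\<xi>. (norm (rft g \<xi>))\<^sup>2 * gauss (?e n) \<xi> \<partial>lborel) \<longlonglongrightarrow> (\<integral>\<xi>. (norm (rft g \<xi>))\<^sup>2 \<partial>lborel)"
  proof (rule integral_dominated_convergence[OF _ _ L2_integrable[OF rft_L2(1)[OF g2]]])
    show "AE \<xi> in lborel. (\<lambda>n. (norm (rft g \<xi>))\<^sup>2 * gauss (?e n) \<xi>) \<longlonglongrightarrow> (norm (rft g \<xi>))\<^sup>2"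
    proof (rule AE_I2)
      fix \<xi>
      show "(\<lambda>n. (norm (rft g \<xi>))\<^sup>2 * gauss (?e n) \<xi>) \<longlonglongrightarrow> (norm (rft g \<xi>))\<^sup>2"
        using tendsto_mult_left[OF gauss_tendsto_1, of "(norm (rft g \<xi>))\<^sup>2" \<xi>] by simp
    qed
  qed (auto simp: gauss_def mult_left_le)
  have "(\<lambda>n. 2 * pi * (\<integral>x. g x * conv (heat (?e n)) g x \<partial>lborel)) \<longlonglongrightarrow> 2 * pi * (\<integral>x. (norm (g x))\<^sup>2 \<partial>lborel)"
  proof (intro tendsto_mult_left integral_dominated_convergence[where w = "\<lambda>x. b * norm (g x)"])
    show "AE x in lborel. (\<lambda>n. g x * conv (heat (?e n)) g x) \<longlonglongrightarrow> (norm (g x))\<^sup>2"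
      using tendsto_mult_left[OF conv_heat_continuous(1)[OF g b]] by (auto simp: power2_eq_square)
    show "AE x in lborel. norm (g x * conv (heat (?e n)) g x) \<le> b * norm (g x)" for n
      using conv_heat_continuous(2)[OF g b] by (auto simp: abs_mult mult.commute[of b] intro!: mult_left_mono)
  qed (use g2 in auto)
  then have "(\<lambda>n. \<integral>\<xi>. (norm (rft g \<xi>))\<^sup>2 * gauss (?e n) \<xi> \<partial>lborel) \<longlonglongrightarrow> 2 * pi * (\<integral>x. (norm (g x))\<^sup>2 \<partial>lborel)"
    by (subst gauss_weighted_rft(1)[OF g2(2)]) simp_all
  from LIMSEQ_unique[OF lim this]
  have "(\<integral>\<xi>. (norm (rft g \<xi>))\<^sup>2 \<partial>lborel) = 2 * pi * (\<integral>x. (norm (g x))\<^sup>2 \<partial>lborel)" .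
  then show ?thesis
    by (simp add: l2norm_def real_sqrt_mult)
qed

section \<open>Plancherel's theorem\<close>

lemma fourier_trunc_eq: "fourier_trunc f R = rft (\<lambda>x. indicator {-R..R} x * f x)"
proof
  fix \<xi>
  show "fourier_trunc f R \<xi> = rft (\<lambda>x. indicator {-R..R} x * f x) \<xi>"
    unfolding fourier_trunc_def ft_def set_lebesgue_integral_def
    by (intro Bochner_Integration.integral_cong) (auto simp: indicator_def cis_conv_exp)
qed

lemma fourier_trunc_L2:
  assumes "f \<in> L2"
  shows "fourier_trunc f R \<in> L2"
  unfolding fourier_trunc_eq using L2_indicator[OF assms] by (rule rft_L2)

text \<open>The difference with a truncated transform lies in L2, where the extended and the real
  form of the norm agree; from here on only \<open>l2norm\<close> is used.\<close>

lemma has_fourier_iff: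
  "has_fourier f \<phi> \<longleftrightarrow> f \<in> L2 \<and> \<phi> \<in> L2 \<and>
     (\<lambda>n. l2norm (\<lambda>\<xi>. fourier_trunc f (real n) \<xi> - \<phi> \<xi>)) \<longlonglongrightarrow> 0"
proof (cases "f \<in> L2 \<and> \<phi> \<in> L2")
  case True
  then have *: "(\<integral>\<^sup>+ \<xi>. ennreal ((norm (fourier_trunc f (real n) \<xi> - \<phi> \<xi>))\<^sup>2) \<partial>lborel)
      = ennreal ((l2norm (\<lambda>\<xi>. fourier_trunc f (real n) \<xi> - \<phi> \<xi>))\<^sup>2)" for n
    by (intro nn_integral_L2 L2_diff fourier_trunc_L2) auto
  have "(\<lambda>n. (l2norm (\<lambda>\<xi>. fourier_trunc f (real n) \<xi> - \<phi> \<xi>))\<^sup>2) \<longlonglongrightarrow> 0 \<longleftrightarrow>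
      (\<lambda>n. l2norm (\<lambda>\<xi>. fourier_trunc f (real n) \<xi> - \<phi> \<xi>)) \<longlonglongrightarrow> 0" (is "?s \<longlonglongrightarrow> 0 \<longleftrightarrow> ?l \<longlonglongrightarrow> 0")
  proof
    assume "?s \<longlonglongrightarrow> 0"
    from tendsto_real_sqrt[OF this] show "?l \<longlonglongrightarrow> 0"
      by simp
  next
    assume "?l \<longlonglongrightarrow> 0"
    from tendsto_power[OF this, of 2] show "?s \<longlonglongrightarrow> 0"
      by simp
  qed
  with True show ?thesis
    unfolding has_fourier_def * by (simp add: ennreal_tendsto_0_iff)
qed (auto simp: has_fourier_def)

lemma L2_limit_unique:
  fixes f g :: "real \<Rightarrow> 'a::{banach, second_countable_topology}"
  assumes s: "\<And>n. s n \<in> L2" and f: "f \<in> L2" and g: "g \<in> L2"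
    and lim: "(\<lambda>n. l2norm (\<lambda>x. s n x - f x)) \<longlonglongrightarrow> 0" "(\<lambda>n. l2norm (\<lambda>x. s n x - g x)) \<longlonglongrightarrow> 0"
  shows "AE x in lborel. f x = g x"
proof -
  have "l2norm (\<lambda>x. f x - g x) \<le> l2norm (\<lambda>x. s n x - f x) + l2norm (\<lambda>x. s n x - g x)" for n
    using l2norm_triangle3[OF f s g, of n] by (simp add: l2norm_diff_commute[of f])
  then have "l2norm (\<lambda>x. f x - g x) \<le> 0 + 0"
    by (intro LIMSEQ_le_const[OF tendsto_add[OF lim]]) auto
  then have "l2norm (\<lambda>x. f x - g x) = 0"
    using l2norm_nonneg[of "\<lambda>x. f x - g x"] by linarith
  from l2norm_eq_0_imp[OF L2_diff(1)[OF f g] this] show ?thesis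
    by simp
qed

lemma has_fourier_unique:
  assumes "has_fourier f \<phi>" "has_fourier f \<psi>"
  shows "AE \<xi> in lborel. \<phi> \<xi> = \<psi> \<xi>"
  using assms by (auto simp: has_fourier_iff intro!: L2_limit_unique[of "\<lambda>n. fourier_trunc f (real n)"] fourier_trunc_L2)

lemma fourier_trunc_dist:
  assumes f: "f \<in> L2"
  shows "l2norm (\<lambda>\<xi>. fourier_trunc f a \<xi> - fourier_trunc f b \<xi>)
    \<le> sqrt (2 * pi) * l2norm (\<lambda>x. indicator {-a..a} x * f x - indicator {-b..b} x * f x)"
proof -
  have "(\<lambda>\<xi>. fourier_trunc f a \<xi> - fourier_trunc f b \<xi>)
      = rft (\<lambda>x. indicator {-a..a} x * f x - indicator {-b..b} x * f x)"
    unfolding fourier_trunc_eq of_real_diff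
    by (rule ext, rule ft_diff[symmetric]; use L2_indicator(2)[OF f] in \<open>simp del: of_real_mult\<close>)
  then show ?thesis
    using rft_L2(2)[of "\<lambda>x. indicator {-a..a} x * f x - indicator {-b..b} x * f x"]
      L2_diff(1)[OF L2_indicator(1)[OF f] L2_indicator(1)[OF f]] L2_indicator(2)[OF f]
    by simp
qed

text \<open>The truncations of \<open>f\<close> converge and \<open>rft_L2\<close> is a Lipschitz
  bound, so the truncated transforms form a Cauchy sequence. This existence result gives the choice
  in \<open>fourier\<close> its meaning.\<close>

lemma has_fourier_fourier:
  assumes f: "f \<in> L2"
  shows "has_fourier f (fourier f)"
proof -
  have "\<exists>\<phi>\<in>L2. (\<lambda>n. l2norm (\<lambda>\<xi>. fourier_trunc f (real n) \<xi> - \<phi> \<xi>)) \<longlonglongrightarrow> 0"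
  proof (rule L2_complete)
    show "fourier_trunc f (real n) \<in> L2" for n
      by (rule fourier_trunc_L2[OF f])
    fix e :: real assume e: "0 < e"
    let ?s = "\<lambda>n x. indicator {- real n..real n} x * f x"
    have "0 < e / (2 * sqrt (2 * pi))"
      using e by simp
    from LIMSEQ_D[OF L2_truncate[OF f] this]
    obtain N where N: "\<And>n. n \<ge> N \<Longrightarrow> l2norm (\<lambda>x. ?s n x - f x) < e / (2 * sqrt (2 * pi))"
      by auto
    have "l2norm (\<lambda>\<xi>. fourier_trunc f (real m) \<xi> - fourier_trunc f (real n) \<xi>) < e"
      if mn: "m \<ge> N" "n \<ge> N" for m n
    proof -
      have "l2norm (\<lambda>x. ?s m x - ?s n x) \<le> l2norm (\<lambda>x. ?s m x - f x) + l2norm (\<lambda>x. f x - ?s n x)"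
        by (rule l2norm_triangle3[OF L2_indicator(1)[OF f] f L2_indicator(1)[OF f]])
      also have "\<dots> < e / (2 * sqrt (2 * pi)) + e / (2 * sqrt (2 * pi))"
        using N[OF mn(1)] N[OF mn(2)] by (intro add_strict_mono) (simp_all add: l2norm_diff_commute[of f])
      finally have "l2norm (\<lambda>x. ?s m x - ?s n x) < e / sqrt (2 * pi)"
        by simp
      then have "sqrt (2 * pi) * l2norm (\<lambda>x. ?s m x - ?s n x) < e"
        by (simp add: pos_less_divide_eq mult.commute)
      with fourier_trunc_dist[OF f, of "real m" "real n"] show ?thesis
        by linarith
    qed
    then show "\<exists>N. \<forall>m\<ge>N. \<forall>n\<ge>N. l2norm (\<lambda>\<xi>. fourier_trunc f (real m) \<xi> - fourier_trunc f (real n) \<xi>) < e"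
      by blast
  qed
  with f have "\<exists>\<phi>. has_fourier f \<phi>"
    by (auto simp: has_fourier_iff)
  then show ?thesis
    unfolding fourier_def by (rule someI_ex)
qed

lemma fourier_L2: "f \<in> L2 \<Longrightarrow> fourier f \<in> L2"
  using has_fourier_fourier by (auto simp: has_fourier_iff)

lemma fourier_AE:
  assumes "has_fourier f \<phi>"
  shows "AE \<xi> in lborel. fourier f \<xi> = \<phi> \<xi>"
  using has_fourier_unique[OF has_fourier_fourier assms] assms by (simp add: has_fourier_def)

text \<open>The truncated transforms of \<open>f\<close> and \<open>g\<close> are identical, hence
  so are the two predicates from which \<open>fourier\<close> chooses. This gives equality at every
  frequency.\<close>

lemma fourier_cong_AE:
  assumes "f \<in> L2" "g \<in> L2" "AE x in lborel. f x = g x"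
  shows "fourier f = fourier g"
proof -
  note [measurable] = L2_measurable[OF assms(1)] L2_measurable[OF assms(2)]
  have "fourier_trunc f R \<xi> = fourier_trunc g R \<xi>" for R \<xi>
    unfolding fourier_trunc_eq ft_def using assms(3) by (intro integral_cong_AE) auto
  then have "has_fourier f = has_fourier g"
    using assms by (auto simp: has_fourier_def)
  then show ?thesis
    by (simp add: fourier_def)
qed

text \<open>The bridge by which explicit transforms enter: on the intersection of L1 and L2 the
  limit of truncated transforms is the ordinary Fourier integral.\<close>

lemma has_fourier_rft:
  assumes f: "f \<in> L2" "integrable lborel f"
  shows "has_fourier f (rft f)"
proof -
  let ?s = "\<lambda>n x. indicator {- real n..real n} x * f x"
  have "(\<lambda>n. l2norm (\<lambda>\<xi>. fourier_trunc f (real n) \<xi> - rft f \<xi>)) \<longlonglongrightarrow> 0"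
  proof (rule tendsto_sandwich[OF _ _ tendsto_const])
    show "(\<lambda>n. sqrt (2 * pi) * l2norm (\<lambda>x. ?s n x - f x)) \<longlonglongrightarrow> 0"
      using tendsto_mult_left[OF L2_truncate[OF f(1)], of "sqrt (2 * pi)"] by simp
    show "eventually (\<lambda>n. l2norm (\<lambda>\<xi>. fourier_trunc f (real n) \<xi> - rft f \<xi>)
        \<le> sqrt (2 * pi) * l2norm (\<lambda>x. ?s n x - f x)) sequentially"
    proof (rule always_eventually, rule allI)
      fix n
      have "(\<lambda>\<xi>. fourier_trunc f (real n) \<xi> - rft f \<xi>) = rft (\<lambda>x. ?s n x - f x)"
        unfolding fourier_trunc_eq of_real_diff
        by (rule ext, rule ft_diff[symmetric]; use L2_indicator(2)[OF f(1)] f(2) in \<open>simp del: of_real_mult\<close>)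
      then show "l2norm (\<lambda>\<xi>. fourier_trunc f (real n) \<xi> - rft f \<xi>) \<le> sqrt (2 * pi) * l2norm (\<lambda>x. ?s n x - f x)"
        using rft_L2(2)[of "\<lambda>x. ?s n x - f x"]
          L2_diff(1)[OF L2_indicator(1)[OF f(1)] f(1)] L2_indicator(2)[OF f(1)] f(2)
        by simp
    qed
  qed auto
  with f rft_L2(1)[OF f] show ?thesis
    by (simp add: has_fourier_iff)
qed

lemma has_fourier_lincomb:
  assumes "has_fourier f \<phi>" "has_fourier g \<psi>"
  shows "has_fourier (\<lambda>x. a * f x + b * g x) (\<lambda>\<xi>. of_real a * \<phi> \<xi> + of_real b * \<psi> \<xi>)"
proof -
  have f: "f \<in> L2" "\<phi> \<in> L2" and g: "g \<in> L2" "\<psi> \<in> L2"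
    and lim: "(\<lambda>n. l2norm (\<lambda>\<xi>. fourier_trunc f (real n) \<xi> - \<phi> \<xi>)) \<longlonglongrightarrow> 0"
      "(\<lambda>n. l2norm (\<lambda>\<xi>. fourier_trunc g (real n) \<xi> - \<psi> \<xi>)) \<longlonglongrightarrow> 0"
    using assms by (auto simp: has_fourier_iff)
  let ?h = "\<lambda>x. a * f x + b * g x" and ?\<chi> = "\<lambda>\<xi>. of_real a * \<phi> \<xi> + of_real b * \<psi> \<xi>"
  have "(\<lambda>n. l2norm (\<lambda>\<xi>. fourier_trunc ?h (real n) \<xi> - ?\<chi> \<xi>)) \<longlonglongrightarrow> 0"
  proof (rule tendsto_sandwich[OF _ _ tendsto_const])
    show "(\<lambda>n. \<bar>a\<bar> * l2norm (\<lambda>\<xi>. fourier_trunc f (real n) \<xi> - \<phi> \<xi>)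
        + \<bar>b\<bar> * l2norm (\<lambda>\<xi>. fourier_trunc g (real n) \<xi> - \<psi> \<xi>)) \<longlonglongrightarrow> 0"
      using tendsto_add[OF tendsto_mult_left[OF lim(1), of "\<bar>a\<bar>"] tendsto_mult_left[OF lim(2), of "\<bar>b\<bar>"]] by simp
    show "eventually (\<lambda>n. l2norm (\<lambda>\<xi>. fourier_trunc ?h (real n) \<xi> - ?\<chi> \<xi>)
        \<le> \<bar>a\<bar> * l2norm (\<lambda>\<xi>. fourier_trunc f (real n) \<xi> - \<phi> \<xi>)
          + \<bar>b\<bar> * l2norm (\<lambda>\<xi>. fourier_trunc g (real n) \<xi> - \<psi> \<xi>)) sequentially"
    proof (rule always_eventually, rule allI)
      fix n
      let ?F = "\<lambda>\<xi>. fourier_trunc f (real n) \<xi> - \<phi> \<xi>" and ?G = "\<lambda>\<xi>. fourier_trunc g (real n) \<xi> - \<psi> \<xi>"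
      have FG: "?F \<in> L2" "?G \<in> L2"
        using f g by (auto intro!: L2_diff fourier_trunc_L2)
      have lin: "fourier_trunc ?h (real n) \<xi> = of_real a * fourier_trunc f (real n) \<xi> + of_real b * fourier_trunc g (real n) \<xi>" for \<xi>
      proof -
        let ?i = "\<lambda>f x. complex_of_real (indicator {- real n..real n} x * f x)"
        have int: "integrable lborel (?i f)" "integrable lborel (?i g)"
          using L2_indicator(2)[OF f(1)] L2_indicator(2)[OF g(1)] by (auto simp del: of_real_mult)
        have "?i ?h = (\<lambda>x. of_real a * ?i f x + of_real b * ?i g x)"
          by (auto simp: algebra_simps)
        then show ?thesis
          unfolding fourier_trunc_eq using int
          by (simp add: ft_add ft_scale del: of_real_mult)
      qed
      have "(\<lambda>\<xi>. fourier_trunc ?h (real n) \<xi> - ?\<chi> \<xi>) = (\<lambda>\<xi>. of_real a * ?F \<xi> + of_real b * ?G \<xi>)"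
        unfolding lin by (auto simp: algebra_simps)
      then show "l2norm (\<lambda>\<xi>. fourier_trunc ?h (real n) \<xi> - ?\<chi> \<xi>) \<le> \<bar>a\<bar> * l2norm ?F + \<bar>b\<bar> * l2norm ?G"
        using L2_add(2)[OF L2_scale(1)[OF FG(1), of "of_real a"] L2_scale(1)[OF FG(2), of "of_real b"]]
        by (simp add: L2_scale(2)[OF FG(1)] L2_scale(2)[OF FG(2)])
    qed
  qed auto
  moreover have "?h \<in> L2" "?\<chi> \<in> L2"
    using f g by (auto intro!: L2_add L2_scale)
  ultimately show ?thesis
    by (simp add: has_fourier_iff)
qed

lemma fourier_lincomb_AE:
  assumes "f \<in> L2" "g \<in> L2"
  shows "AE \<xi> in lborel. fourier (\<lambda>x. a * f x + b * g x) \<xi> = of_real a * fourier f \<xi> + of_real b * fourier g \<xi>"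
  by (rule fourier_AE[OF has_fourier_lincomb[OF has_fourier_fourier[OF assms(1)] has_fourier_fourier[OF assms(2)]]])

lemma fourier_diff_AE:
  assumes "f \<in> L2" "g \<in> L2"
  shows "AE \<xi> in lborel. fourier (\<lambda>x. f x - g x) \<xi> = fourier f \<xi> - fourier g \<xi>"
  using fourier_lincomb_AE[OF assms, of 1 "-1"] by simp

lemma fourier_norm_le:
  assumes f: "f \<in> L2"
  shows "l2norm (fourier f) \<le> sqrt (2 * pi) * l2norm f"
proof -
  let ?s = "\<lambda>n x. indicator {- real n..real n} x * f x"
  have lim: "(\<lambda>n. l2norm (\<lambda>\<xi>. fourier_trunc f (real n) \<xi> - fourier f \<xi>)) \<longlonglongrightarrow> 0"
    using has_fourier_fourier[OF f] by (simp add: has_fourier_iff)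
  have "l2norm (fourier f) \<le> l2norm (\<lambda>\<xi>. fourier_trunc f (real n) \<xi> - fourier f \<xi>) + sqrt (2 * pi) * l2norm f" for n
  proof -
    have "l2norm (fourier_trunc f (real n)) \<le> sqrt (2 * pi) * l2norm (?s n)"
      unfolding fourier_trunc_eq by (rule rft_L2(2)[OF L2_indicator[OF f]])
    also have "l2norm (?s n) \<le> 1 * l2norm f"
      by (rule L2_bounded_mult(2)[OF f]) (auto simp: indicator_def)
    finally show ?thesis
      using l2norm_reverse_triangle[OF fourier_trunc_L2[OF f, of "real n"] fourier_L2[OF f]] by simp
  qed
  then have "l2norm (fourier f) \<le> 0 + sqrt (2 * pi) * l2norm f"
    by (intro LIMSEQ_le_const[OF tendsto_add[OF lim tendsto_const]]) auto
  then show ?thesis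
    by simp
qed

lemma fourier_dist_le:
  assumes f: "f \<in> L2" and g: "g \<in> L2"
  shows "l2norm (\<lambda>\<xi>. fourier f \<xi> - fourier g \<xi>) \<le> sqrt (2 * pi) * l2norm (\<lambda>x. f x - g x)"
proof -
  have fg: "(\<lambda>x. f x - g x) \<in> L2"
    by (rule L2_diff(1)[OF f g])
  have "l2norm (fourier (\<lambda>x. f x - g x)) = l2norm (\<lambda>\<xi>. fourier f \<xi> - fourier g \<xi>)"
    by (rule L2_cong_AE(2)[OF L2_measurable[OF fourier_L2[OF fg]] L2_diff(1)[OF fourier_L2[OF f] fourier_L2[OF g]] fourier_diff_AE[OF f g]])
  with fourier_norm_le[OF fg] show ?thesis
    by simp
qed

text \<open>The remaining inequality holds with equality for continuous functions of compact
  support. These are dense, and both sides depend continuously on \<open>f\<close>.\<close>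

theorem Plancherel:
  assumes f: "f \<in> L2"
  shows "l2norm (fourier f) = sqrt (2 * pi) * l2norm f"
proof (rule antisym[OF fourier_norm_le[OF f]], rule field_le_epsilon)
  fix e :: real assume e: "0 < e"
  \<comment> \<open>The approximation error enters twice, once between the functions and once
    between their transforms, and each contribution is to stay below e / 2.\<close>
  have "0 < e / (2 * sqrt (2 * pi))"
    using e by simp
  from L2_dense_continuous[OF f this] obtain g b R where g: "continuous_on UNIV g"
    and b: "\<And>x. \<bar>g x\<bar> \<le> b" and R: "\<And>x. \<bar>x\<bar> > R \<Longrightarrow> g x = 0"
    and gf: "l2norm (\<lambda>x. g x - f x) < e / (2 * sqrt (2 * pi))"
    by metis
  have g2: "g \<in> L2" "integrable lborel g"
    by (rule L2_compact_support[where B = b and R = R]; use b R borel_measurable_continuous_onI[OF g] in simp)+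
  have gP: "l2norm (fourier g) = sqrt (2 * pi) * l2norm g"
    using L2_cong_AE(2)[OF L2_measurable[OF fourier_L2[OF g2(1)]] rft_L2(1)[OF g2] fourier_AE[OF has_fourier_rft[OF g2]]]
      rft_Plancherel_continuous[OF g b R] by simp
  have d: "sqrt (2 * pi) * l2norm (\<lambda>x. g x - f x) < e / 2"
    using gf by (simp add: pos_less_divide_eq mult_ac)
  have "sqrt (2 * pi) * l2norm f \<le> sqrt (2 * pi) * (l2norm g + l2norm (\<lambda>x. g x - f x))"
    using l2norm_reverse_triangle[OF g2(1) f] by (intro mult_left_mono) auto
  also have "\<dots> = l2norm (fourier g) + sqrt (2 * pi) * l2norm (\<lambda>x. g x - f x)"
    by (simp add: gP distrib_left)
  also have "l2norm (fourier g) \<le> l2norm (fourier f) + sqrt (2 * pi) * l2norm (\<lambda>x. g x - f x)"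
    using l2norm_reverse_triangle[OF fourier_L2[OF g2(1)] fourier_L2[OF f]] fourier_dist_le[OF g2(1) f] by linarith
  finally show "sqrt (2 * pi) * l2norm f \<le> l2norm (fourier f) + e"
    using d by linarith
qed

lemma fourier_dist:
  assumes f: "f \<in> L2" and g: "g \<in> L2"
  shows "l2norm (\<lambda>\<xi>. fourier f \<xi> - fourier g \<xi>) = sqrt (2 * pi) * l2norm (\<lambda>x. f x - g x)"
proof -
  have fg: "(\<lambda>x. f x - g x) \<in> L2"
    by (rule L2_diff(1)[OF f g])
  have "l2norm (fourier (\<lambda>x. f x - g x)) = l2norm (\<lambda>\<xi>. fourier f \<xi> - fourier g \<xi>)"
    by (rule L2_cong_AE(2)[OF L2_measurable[OF fourier_L2[OF fg]] L2_diff(1)[OF fourier_L2[OF f] fourier_L2[OF g]] fourier_diff_AE[OF f g]])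
  with Plancherel[OF fg] show ?thesis
    by simp
qed

lemma fourier_inject_AE:
  assumes f: "f \<in> L2" and g: "g \<in> L2" and eq: "AE \<xi> in lborel. fourier f \<xi> = fourier g \<xi>"
  shows "AE x in lborel. f x = g x"
proof -
  have "AE \<xi> in lborel. fourier f \<xi> - fourier g \<xi> = 0"
    using eq by eventually_elim simp
  from L2_cong_AE(2)[OF _ l2norm_zero(2) this] fourier_L2[OF f] fourier_L2[OF g]
  have "l2norm (\<lambda>\<xi>. fourier f \<xi> - fourier g \<xi>) = 0"
    by (simp add: L2_measurable)
  then have "l2norm (\<lambda>x. f x - g x) = 0"
    by (simp add: fourier_dist[OF f g])
  from l2norm_eq_0_imp[OF L2_diff(1)[OF f g] this] show ?thesis
    by simp
qed

text \<open>A witness \<open>G\<close> makes the choice in \<open>fourier_multiplier\<close>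
  meaningful, and injectivity of the transform identifies the chosen function with \<open>G\<close>
  up to a null set. Multipliers can thus be computed by exhibiting a convolution.\<close>

lemma fourier_multiplier_AE:
  assumes G: "G \<in> L2" "AE \<xi> in lborel. fourier G \<xi> = m \<xi> * fourier F \<xi>"
  shows "fourier_multiplier m F \<in> L2" and "AE x in lborel. fourier_multiplier m F x = G x"
proof -
  have *: "fourier_multiplier m F \<in> L2 \<and> (AE \<xi> in lborel. fourier (fourier_multiplier m F) \<xi> = m \<xi> * fourier F \<xi>)"
    unfolding fourier_multiplier_def by (rule someI[of _ G]) (use G in blast)
  then show 1: "fourier_multiplier m F \<in> L2"
    by blast
  from * have "AE \<xi> in lborel. fourier (fourier_multiplier m F) \<xi> = m \<xi> * fourier F \<xi>"
    by blast
  with G(2) have "AE \<xi> in lborel. fourier (fourier_multiplier m F) \<xi> = fourier G \<xi>"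
    by eventually_elim simp
  from fourier_inject_AE[OF 1 G(1) this] show "AE x in lborel. fourier_multiplier m F x = G x" .
qed

section \<open>Fourier transforms of convolutions\<close>

lemma ft_conv:
  assumes k: "integrable lborel k" and f: "integrable lborel f"
  shows "integrable lborel (conv k f)" and "rft (conv k f) \<xi> = rft k \<xi> * rft f \<xi>"
proof -
  have [measurable]: "k \<in> borel_measurable borel" "f \<in> borel_measurable borel"
    using k f by auto
  have shift: "integrable lborel (\<lambda>z. k (z - y))" "(\<integral>z. \<bar>k (z - y)\<bar> \<partial>lborel) = (\<integral>z. \<bar>k z\<bar> \<partial>lborel)" for y
    using lborel_integrable_real_affine[OF k, of 1 "- y"] lborel_integral_real_affine[of 1 "\<lambda>z. \<bar>k z\<bar>" "- y"]
    by simp_all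
  have int: "integrable (lborel \<Otimes>\<^sub>M lborel) (\<lambda>(y, z). k (z - y) * f y)"
  proof (rule lborel_pair.Fubini_integrable)
    show "integrable lborel (\<lambda>y. \<integral>z. norm (case (y, z) of (y, z) \<Rightarrow> k (z - y) * f y) \<partial>lborel)"
      using f by (simp add: abs_mult shift)
    show "AE y in lborel. integrable lborel (\<lambda>z. case (y, z) of (y, z) \<Rightarrow> k (z - y) * f y)"
      using shift by simp
  qed simp
  from lborel_pair.integrable_snd[OF this] show "integrable lborel (conv k f)"
    by (simp add: conv_def[abs_def])
  let ?H = "\<lambda>y z. of_real (k (z - y) * f y) * cis (- (z * \<xi>))"
  have H: "integrable (lborel \<Otimes>\<^sub>M lborel) (\<lambda>(y, z). ?H y z)"
    by (rule Bochner_Integration.integrable_bound[OF int]) (auto simp: norm_mult)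
  have "rft (conv k f) \<xi> = (\<integral>z. (\<integral>y. ?H y z \<partial>lborel) \<partial>lborel)"
    unfolding ft_def conv_def
    by (simp only: integral_mult_left_zero integral_complex_of_real)
  also have "\<dots> = (\<integral>y. (\<integral>z. ?H y z \<partial>lborel) \<partial>lborel)"
    by (rule lborel_pair.Fubini_integral[OF H])
  also have "\<dots> = (\<integral>y. rft k \<xi> * (of_real (f y) * cis (- (y * \<xi>))) \<partial>lborel)"
  proof (intro Bochner_Integration.integral_cong refl)
    fix y
    have "(\<integral>z. ?H y z \<partial>lborel) = (\<integral>z. ?H y (y + z) \<partial>lborel)"
      using lborel_integral_real_affine[of 1 "?H y" y] by simp
    also have "\<dots> = (\<integral>z. of_real (k z) * cis (- (z * \<xi>)) * (of_real (f y) * cis (- (y * \<xi>))) \<partial>lborel)"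
    proof (intro Bochner_Integration.integral_cong refl)
      fix z
      have "cis (- ((y + z) * \<xi>)) = cis (- (z * \<xi>)) * cis (- (y * \<xi>))"
        by (simp add: cis_mult algebra_simps)
      then show "?H y (y + z) = of_real (k z) * cis (- (z * \<xi>)) * (of_real (f y) * cis (- (y * \<xi>)))"
        by simp
    qed
    also have "\<dots> = rft k \<xi> * (of_real (f y) * cis (- (y * \<xi>)))"
      unfolding ft_def by (rule integral_mult_left_zero)
    finally show "(\<integral>z. ?H y z \<partial>lborel) = rft k \<xi> * (of_real (f y) * cis (- (y * \<xi>)))" .
  qed
  also have "\<dots> = rft k \<xi> * rft f \<xi>"
    unfolding ft_def[of "\<lambda>x. of_real (f x)"] by (rule integral_mult_right_zero)
  finally show "rft (conv k f) \<xi> = rft k \<xi> * rft f \<xi>" .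
qed

text \<open>For integrable functions this is \<open>ft_conv\<close>. In general \<open>f\<close> is
  truncated; Young's inequality on one side and the boundedness of \<open>rft k\<close> on the other
  make both sides continuous in the L2 norm.\<close>

lemma fourier_conv_AE:
  assumes k: "integrable lborel k" "k \<in> L2" and f: "f \<in> L2"
  shows "AE \<xi> in lborel. fourier (conv k f) \<xi> = rft k \<xi> * fourier f \<xi>"
proof -
  have [measurable]: "k \<in> borel_measurable borel"
    using k by auto
  let ?K = "\<integral>x. \<bar>k x\<bar> \<partial>lborel"
  have K: "norm (rft k \<xi>) \<le> ?K" for \<xi>
    using ft_bound[of "\<lambda>x. of_real (k x)" \<xi>] by simp
  have cl: "conv k h \<in> L2" if "h \<in> L2" for h
    by (rule conv_L2(1)[OF k(1) that])
  have ml: "(\<lambda>\<xi>. rft k \<xi> * fourier h \<xi>) \<in> L2" if "h \<in> L2" for h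
    by (rule L2_bounded_mult(1)[OF fourier_L2[OF that] _ K]) simp
  define s where "s n x = indicator {- real n..real n} x * f x" for n x
  have s: "s n \<in> L2" "integrable lborel (s n)" for n
    using L2_indicator[OF f] by (auto simp: s_def[abs_def])
  have lim: "(\<lambda>n. l2norm (\<lambda>x. s n x - f x)) \<longlonglongrightarrow> 0"
    unfolding s_def by (rule L2_truncate[OF f])
  have eq: "AE \<xi> in lborel. fourier (conv k (s n)) \<xi> = rft k \<xi> * fourier (s n) \<xi>" for n
    using fourier_AE[OF has_fourier_rft[OF cl[OF s(1)] ft_conv(1)[OF k(1) s(2)]], of n]
      fourier_AE[OF has_fourier_rft[OF s], of n]
    by eventually_elim (simp add: ft_conv(2)[OF k(1) s(2)])
  \<comment> \<open>Replacing \<open>f\<close> by \<open>s n\<close> costs at most K sqrt (2 pi)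
    times the truncation error on either side, with K the mass of \<bar>k\<bar>; hence the factor
    2.\<close>
  have le: "l2norm (\<lambda>\<xi>. fourier (conv k f) \<xi> - rft k \<xi> * fourier f \<xi>) \<le> 2 * (?K * sqrt (2 * pi)) * l2norm (\<lambda>x. s n x - f x)" for n
  proof -
    have "l2norm (\<lambda>\<xi>. fourier (conv k f) \<xi> - rft k \<xi> * fourier f \<xi>)
        \<le> l2norm (\<lambda>\<xi>. fourier (conv k f) \<xi> - fourier (conv k (s n)) \<xi>)
          + l2norm (\<lambda>\<xi>. fourier (conv k (s n)) \<xi> - rft k \<xi> * fourier f \<xi>)"
      by (intro l2norm_triangle3 ml f fourier_L2 cl s)
    also have "l2norm (\<lambda>\<xi>. fourier (conv k f) \<xi> - fourier (conv k (s n)) \<xi>)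
        = sqrt (2 * pi) * l2norm (conv k (\<lambda>x. f x - s n x))"
    proof -
      have "conv k (\<lambda>x. f x - s n x) = (\<lambda>z. conv k f z - conv k (s n) z)"
        by (intro ext conv_diff k f s)
      then show ?thesis
        by (simp add: fourier_dist cl f s)
    qed
    also have "l2norm (conv k (\<lambda>x. f x - s n x)) \<le> ?K * l2norm (\<lambda>x. s n x - f x)"
      using conv_L2(2)[OF k(1) L2_diff(1)[OF f s(1)]] by (simp add: l2norm_diff_commute[of f])
    also have "l2norm (\<lambda>\<xi>. fourier (conv k (s n)) \<xi> - rft k \<xi> * fourier f \<xi>)
        = l2norm (\<lambda>\<xi>. rft k \<xi> * (fourier (s n) \<xi> - fourier f \<xi>))"
    proof (rule L2_cong_AE(2))
      show "(\<lambda>\<xi>. rft k \<xi> * (fourier (s n) \<xi> - fourier f \<xi>)) \<in> L2"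
        using L2_diff(1)[OF ml[OF s(1)] ml[OF f]] by (simp add: right_diff_distrib)
      show "AE \<xi> in lborel. fourier (conv k (s n)) \<xi> - rft k \<xi> * fourier f \<xi> = rft k \<xi> * (fourier (s n) \<xi> - fourier f \<xi>)"
        using eq[of n] by eventually_elim (simp add: right_diff_distrib)
    qed (intro L2_measurable L2_diff fourier_L2 cl s ml f)
    also have "\<dots> \<le> ?K * l2norm (\<lambda>\<xi>. fourier (s n) \<xi> - fourier f \<xi>)"
      by (rule L2_bounded_mult(2)[OF L2_diff(1)[OF fourier_L2[OF s(1)] fourier_L2[OF f]] _ K]) simp
    also have "l2norm (\<lambda>\<xi>. fourier (s n) \<xi> - fourier f \<xi>) = sqrt (2 * pi) * l2norm (\<lambda>x. s n x - f x)"
      by (rule fourier_dist[OF s(1) f])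
    finally show ?thesis
      by (simp add: mult_ac)
  qed
  have "l2norm (\<lambda>\<xi>. fourier (conv k f) \<xi> - rft k \<xi> * fourier f \<xi>) \<le> 2 * (?K * sqrt (2 * pi)) * 0"
    by (rule LIMSEQ_le_const[OF tendsto_mult_left[OF lim]]) (use le in blast)
  then have "l2norm (\<lambda>\<xi>. fourier (conv k f) \<xi> - rft k \<xi> * fourier f \<xi>) = 0"
    using l2norm_nonneg[of "\<lambda>\<xi>. fourier (conv k f) \<xi> - rft k \<xi> * fourier f \<xi>"] by linarith
  from l2norm_eq_0_imp[OF _ this] show ?thesis
    using L2_diff(1)[OF fourier_L2[OF cl[OF f]] ml[OF f]] by simp
qed

section \<open>The convolution kernels of the two operators\<close>

text \<open>For a > 0 the kernel of (1 - \<partial>^2 / a^2)^(-1). The value a = 1 is the operator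
  Q; large \<open>a\<close> serve to recover a second derivative from bounded operators.\<close>

definition resolvent_kernel :: "real \<Rightarrow> real \<Rightarrow> real" where
  "resolvent_kernel a x = a / 2 * exp (- (a * \<bar>x\<bar>))"

text \<open>The derivative of \<open>resolvent_kernel 1\<close> away from the origin, that is, the
  kernel of N.\<close>

definition gradient_kernel :: "real \<Rightarrow> real" where
  "gradient_kernel x = - (sgn x / 2) * exp (- \<bar>x\<bar>)"

text \<open>Up to a null set both kernels are combinations of this function and its reflection, so a
  single Fourier integral determines both symbols.\<close>

definition half_exp :: "real \<Rightarrow> real \<Rightarrow> real" where
  "half_exp a x = indicator {0..} x * exp (- (a * x))"

lemma borel_measurable_kernels [measurable]:
  "resolvent_kernel a \<in> borel_measurable borel"
  "gradient_kernel \<in> borel_measurable borel"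
  "half_exp a \<in> borel_measurable borel"
  unfolding resolvent_kernel_def gradient_kernel_def half_exp_def by measurable

lemma has_bochner_integral_half_exp:
  assumes a: "0 < a"
  shows "has_bochner_integral lborel (half_exp a) (1 / a)"
proof -
  have "(\<integral>\<^sup>+x. ennreal (exp (- (a * x))) * indicator {0..} x \<partial>lborel) = ennreal (0 - (- exp (- (a * 0)) / a))"
  proof (rule nn_integral_FTC_atLeast)
    show "((\<lambda>x. - exp (- (a * x)) / a) has_real_derivative exp (- (a * x))) (at x)" for x
      using a by (auto intro!: derivative_eq_intros)
    show "((\<lambda>x. - exp (- (a * x)) / a) \<longlongrightarrow> 0) at_top"
      using a by real_asymp
  qed auto
  also have "(\<integral>\<^sup>+x. ennreal (exp (- (a * x))) * indicator {0..} x \<partial>lborel) = (\<integral>\<^sup>+x. ennreal (half_exp a x) \<partial>lborel)"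
    by (intro nn_integral_cong) (auto simp: half_exp_def indicator_def)
  finally have "(\<integral>\<^sup>+x. ennreal (half_exp a x) \<partial>lborel) = ennreal (1 / a)"
    by simp
  then show ?thesis
    using a by (intro has_bochner_integral_nn_integral) (auto simp: half_exp_def)
qed

text \<open>The integrand has an explicit primitive on [0, n], and the limit of large n is dominated
  by \<open>half_exp a\<close> itself.\<close>

lemma rft_half_exp:
  assumes a: "0 < a"
  shows "rft (half_exp a) \<xi> = 1 / (of_real a + \<i> * of_real \<xi>)"
proof -
  define c where "c = of_real a + \<i> * of_real \<xi>"
  have c: "c \<noteq> 0"
    using a by (auto simp: complex_eq_iff c_def)
  let ?f = "\<lambda>x. exp (x *\<^sub>R - c)"
  have f: "?f x = of_real (exp (- (a * x))) * cis (- (x * \<xi>))" for x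
  proof -
    have "x *\<^sub>R - c = of_real (- (a * x)) + \<i> * of_real (- (x * \<xi>))"
      by (simp add: c_def scaleR_conv_of_real algebra_simps)
    then show ?thesis
      by (simp only: exp_add exp_of_real cis_conv_exp)
  qed
  have I: "(\<integral>x. indicator {0..real n} x *\<^sub>R ?f x \<partial>lborel) = (1 - ?f (real n)) / c" for n
  proof -
    have "(\<integral>x. indicator {0..real n} x *\<^sub>R ?f x \<partial>lborel) = ?f (real n) / (- c) - ?f 0 / (- c)"
    proof (rule integral_FTC_atLeastAtMost)
      show "continuous_on {0..real n} ?f"
        by (intro continuous_intros)
      show "((\<lambda>x. ?f x / (- c)) has_vector_derivative ?f x) (at x within {0..real n})" for x
      proof -
        have "((\<lambda>x. ?f x * (1 / (- c))) has_vector_derivative ?f x * (- c) * (1 / (- c))) (at x within {0..real n})"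
          by (intro has_vector_derivative_mult_left exp_scaleR_has_vector_derivative_right)
        then show ?thesis
          using c by simp
      qed
    qed simp
    then show ?thesis
      by (simp add: diff_divide_distrib)
  qed
  have fn: "(\<lambda>n. ?f (real n)) \<longlonglongrightarrow> 0"
  proof (rule tendsto_norm_zero_cancel)
    have "(\<lambda>n. exp (- (a * real n))) \<longlonglongrightarrow> 0"
      using a by real_asymp
    then show "(\<lambda>n. norm (?f (real n))) \<longlonglongrightarrow> 0"
      unfolding f by (simp add: norm_mult)
  qed
  have "(\<lambda>n. (1 - ?f (real n)) / c) \<longlonglongrightarrow> (1 - 0) / c"
    by (intro tendsto_intros fn c)
  moreover have "(\<lambda>n. \<integral>x. indicator {0..real n} x *\<^sub>R ?f x \<partial>lborel) \<longlonglongrightarrow> (\<integral>x. of_real (half_exp a x) * cis (- (x * \<xi>)) \<partial>lborel)"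
  proof (rule integral_dominated_convergence[where w = "half_exp a"])
    show "integrable lborel (half_exp a)"
      using has_bochner_integral_half_exp[OF a] by (simp add: has_bochner_integral_iff)
    show "AE x in lborel. norm (indicator {0..real n} x *\<^sub>R ?f x) \<le> half_exp a x" for n
      unfolding f by (auto simp: half_exp_def indicator_def norm_mult)
    show "AE x in lborel. (\<lambda>n. indicator {0..real n} x *\<^sub>R ?f x) \<longlonglongrightarrow> of_real (half_exp a x) * cis (- (x * \<xi>))"
    proof (intro AE_I2 tendsto_eventually)
      fix x :: real
      obtain N where "x \<le> real N"
        using real_arch_simple by blast
      then show "eventually (\<lambda>n. indicator {0..real n} x *\<^sub>R ?f x = of_real (half_exp a x) * cis (- (x * \<xi>))) sequentially"
        unfolding f by (intro eventually_sequentiallyI[of N]) (auto simp: half_exp_def indicator_def)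
    qed
  qed (simp_all add: f)
  ultimately show ?thesis
    unfolding I ft_def c_def[symmetric] using LIMSEQ_unique by fastforce
qed

lemma rft_reflect: "rft (\<lambda>x. f (- x)) \<xi> = rft f (- \<xi>)"
  unfolding ft_def by (subst integral_reflect_shift[of _ 0, symmetric]) simp

lemma integrable_half_exp:
  assumes "0 < a"
  shows "integrable lborel (half_exp a)" "integrable lborel (\<lambda>x. half_exp a (- x))"
    "(\<integral>x. half_exp a x \<partial>lborel) = 1 / a" "(\<integral>x. half_exp a (- x) \<partial>lborel) = 1 / a"
  using has_bochner_integral_half_exp[OF assms] integrable_reflect_shift[of "half_exp a" 0]
    integral_reflect_shift[of "half_exp a" 0]
  by (simp_all add: has_bochner_integral_iff)

text \<open>The origin is left out because both one-sided exponentials contribute there.\<close>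

lemma resolvent_kernel_AE:
  "AE x in lborel. resolvent_kernel a x = a / 2 * (half_exp a x + half_exp a (- x))"
  using AE_lborel_singleton[of 0] by eventually_elim (auto simp: resolvent_kernel_def half_exp_def indicator_def)

lemma gradient_kernel_AE:
  "AE x in lborel. gradient_kernel x = - 1 / 2 * (half_exp 1 x - half_exp 1 (- x))"
  using AE_lborel_singleton[of 0] by eventually_elim (auto simp: gradient_kernel_def half_exp_def indicator_def sgn_if)

lemma abs_gradient_kernel_AE: "AE x in lborel. \<bar>gradient_kernel x\<bar> = resolvent_kernel 1 x"
  using AE_lborel_singleton[of 0] by eventually_elim (auto simp: gradient_kernel_def resolvent_kernel_def sgn_if abs_mult)

lemma resolvent_kernel_pos: "0 < a \<Longrightarrow> 0 < resolvent_kernel a x"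
  by (simp add: resolvent_kernel_def)

lemma resolvent_kernel_integrable:
  assumes "0 < a"
  shows "integrable lborel (resolvent_kernel a)" and "(\<integral>x. \<bar>resolvent_kernel a x\<bar> \<partial>lborel) = 1"
proof -
  have int: "integrable lborel (\<lambda>x. a / 2 * (half_exp a x + half_exp a (- x)))"
    using integrable_half_exp[OF assms] by simp
  then show "integrable lborel (resolvent_kernel a)"
    using resolvent_kernel_AE by (subst integrable_cong_AE) auto
  have "(\<integral>x. \<bar>resolvent_kernel a x\<bar> \<partial>lborel) = (\<integral>x. a / 2 * (half_exp a x + half_exp a (- x)) \<partial>lborel)"
    using resolvent_kernel_pos[OF assms] resolvent_kernel_AE by (intro integral_cong_AE) (auto simp: less_imp_le)
  also have "\<dots> = 1"
    using integrable_half_exp[OF assms] assms by simp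
  finally show "(\<integral>x. \<bar>resolvent_kernel a x\<bar> \<partial>lborel) = 1" .
qed

text \<open>The kernel is at most a / 2, so its square is at most a / 2 times the kernel, which has
  mass one.\<close>

lemma resolvent_kernel_L2:
  assumes "0 < a"
  shows "resolvent_kernel a \<in> L2" and "l2norm (resolvent_kernel 1) \<le> 1"
proof -
  have le: "(norm (resolvent_kernel a x))\<^sup>2 \<le> a / 2 * \<bar>resolvent_kernel a x\<bar>" if "0 < a" for a x
    using that unfolding resolvent_kernel_def power2_eq_square
    by (auto simp: abs_mult intro!: mult_right_mono)
  have int: "integrable lborel (\<lambda>x. (norm (resolvent_kernel a x))\<^sup>2)" if "0 < a" for a
  proof (rule Bochner_Integration.integrable_bound)
    show "integrable lborel (\<lambda>x. a / 2 * \<bar>resolvent_kernel a x\<bar>)"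
      using resolvent_kernel_integrable(1)[OF that] by simp
    show "AE x in lborel. norm ((norm (resolvent_kernel a x))\<^sup>2) \<le> norm (a / 2 * \<bar>resolvent_kernel a x\<bar>)"
      using le[OF that] that by (auto intro!: AE_I2)
  qed simp
  then show "resolvent_kernel a \<in> L2"
    using assms by (simp add: L2_def)
  have "(l2norm (resolvent_kernel 1))\<^sup>2 \<le> (\<integral>x. 1 / 2 * \<bar>resolvent_kernel 1 x\<bar> \<partial>lborel)"
    unfolding l2norm_square
    using int[of 1] le[of 1] resolvent_kernel_integrable(1)[of 1] by (intro integral_mono) auto
  also have "\<dots> = 1 / 2"
    using resolvent_kernel_integrable(2)[of 1] by (simp del: real_norm_def)
  finally have "(l2norm (resolvent_kernel 1))\<^sup>2 \<le> 1\<^sup>2"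
    by simp
  then show "l2norm (resolvent_kernel 1) \<le> 1"
    by (rule power2_le_imp_le) simp
qed

lemma gradient_kernel_integrable:
  "integrable lborel gradient_kernel" "(\<integral>x. \<bar>gradient_kernel x\<bar> \<partial>lborel) = 1"
  "gradient_kernel \<in> L2" "l2norm gradient_kernel \<le> 1"
proof -
  have ae: "AE x in lborel. \<bar>gradient_kernel x\<bar> = \<bar>resolvent_kernel 1 x\<bar>"
    using abs_gradient_kernel_AE by eventually_elim (simp add: resolvent_kernel_pos less_imp_le)
  show "integrable lborel gradient_kernel"
    by (rule Bochner_Integration.integrable_bound[OF resolvent_kernel_integrable(1)[of 1]])
       (use ae in \<open>auto elim: eventually_mono\<close>)
  have "(\<integral>x. \<bar>gradient_kernel x\<bar> \<partial>lborel) = (\<integral>x. \<bar>resolvent_kernel 1 x\<bar> \<partial>lborel)"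
    using ae by (intro integral_cong_AE) auto
  then show "(\<integral>x. \<bar>gradient_kernel x\<bar> \<partial>lborel) = 1"
    by (simp add: resolvent_kernel_integrable(2))
  have le: "AE x in lborel. norm (gradient_kernel x) \<le> 1 * norm (resolvent_kernel 1 x)"
    using ae by (auto elim: eventually_mono)
  from L2_mono[OF _ _ resolvent_kernel_L2(1) this] resolvent_kernel_L2(2)[of 1]
  show "gradient_kernel \<in> L2" "l2norm gradient_kernel \<le> 1"
    by auto
qed

lemma rft_resolvent_kernel:
  assumes a: "0 < a"
  shows "rft (resolvent_kernel a) \<xi> = of_real (a\<^sup>2) / (of_real (a\<^sup>2) + (of_real \<xi>)\<^sup>2)"
proof -
  have c: "of_real a + \<i> * of_real \<xi> \<noteq> 0" "of_real a - \<i> * of_real \<xi> \<noteq> (0 :: complex)"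
    using a by (auto simp: complex_eq_iff)
  have "rft (resolvent_kernel a) \<xi> = rft (\<lambda>x. a / 2 * (half_exp a x + half_exp a (- x))) \<xi>"
    unfolding ft_def
  proof (rule integral_cong_AE)
    show "AE x in lborel. of_real (resolvent_kernel a x) * cis (- (x * \<xi>))
        = of_real (a / 2 * (half_exp a x + half_exp a (- x))) * cis (- (x * \<xi>))"
      using resolvent_kernel_AE[of a] by eventually_elim (simp only:)
  qed measurable
  also have "\<dots> = of_real a / 2 * (rft (half_exp a) \<xi> + rft (\<lambda>x. half_exp a (- x)) \<xi>)"
    using integrable_half_exp[OF a] by (simp add: ft_scale[of "of_real a / 2", simplified] ft_add)
  also have "\<dots> = of_real a / 2 * (1 / (of_real a + \<i> * of_real \<xi>) + 1 / (of_real a - \<i> * of_real \<xi>))"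
    unfolding rft_reflect rft_half_exp[OF a] by simp
  also have "\<dots> = of_real (a\<^sup>2) / ((of_real a + \<i> * of_real \<xi>) * (of_real a - \<i> * of_real \<xi>))"
    using c by (simp add: field_simps power2_eq_square)
  also have "(of_real a + \<i> * of_real \<xi>) * (of_real a - \<i> * of_real \<xi>) = of_real (a\<^sup>2) + (of_real \<xi>)\<^sup>2"
    by (simp add: algebra_simps power2_eq_square)
  finally show ?thesis .
qed

lemma rft_gradient_kernel: "rft gradient_kernel \<xi> = \<i> * of_real \<xi> / (1 + (of_real \<xi>)\<^sup>2)"
proof -
  have c: "1 + \<i> * of_real \<xi> \<noteq> 0" "1 - \<i> * of_real \<xi> \<noteq> (0 :: complex)"
    by (auto simp: complex_eq_iff)
  have "rft gradient_kernel \<xi> = rft (\<lambda>x. - 1 / 2 * (half_exp 1 x - half_exp 1 (- x))) \<xi>"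
    unfolding ft_def
  proof (rule integral_cong_AE)
    show "AE x in lborel. of_real (gradient_kernel x) * cis (- (x * \<xi>))
        = of_real (- 1 / 2 * (half_exp 1 x - half_exp 1 (- x))) * cis (- (x * \<xi>))"
      using gradient_kernel_AE by eventually_elim (simp only:)
  qed measurable
  also have "\<dots> = - 1 / 2 * (rft (half_exp 1) \<xi> - rft (\<lambda>x. half_exp 1 (- x)) \<xi>)"
    using integrable_half_exp[of 1] ft_scale[of "- 1 / 2" "\<lambda>x. of_real (half_exp 1 x) - of_real (half_exp 1 (- x))"]
    by (simp add: ft_diff)
  also have "\<dots> = - 1 / 2 * (1 / (1 + \<i> * of_real \<xi>) - 1 / (1 - \<i> * of_real \<xi>))"
    unfolding rft_reflect by (simp add: rft_half_exp)
  also have "\<dots> = \<i> * of_real \<xi> / ((1 + \<i> * of_real \<xi>) * (1 - \<i> * of_real \<xi>))"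
    using c by (simp add: field_simps)
  also have "(1 + \<i> * of_real \<xi>) * (1 - \<i> * of_real \<xi>) = 1 + (of_real \<xi>)\<^sup>2"
    by (simp add: algebra_simps power2_eq_square)
  finally show ?thesis .
qed

abbreviation Qk :: "(real \<Rightarrow> real) \<Rightarrow> real \<Rightarrow> real" where
  "Qk \<equiv> conv (resolvent_kernel 1)"

abbreviation Nk :: "(real \<Rightarrow> real) \<Rightarrow> real \<Rightarrow> real" where
  "Nk \<equiv> conv gradient_kernel"

text \<open>Mass one of the kernels makes both operators contractions of L2; L2 norm at most one
  bounds their values by the same \<open>l2norm f\<close>. That all constants are 1 keeps the later
  power series estimate simple.\<close>

lemma
  assumes f: "f \<in> L2"
  shows Qk_L2: "Qk f \<in> L2" and Qk_norm: "l2norm (Qk f) \<le> l2norm f"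
    and Nk_L2: "Nk f \<in> L2" and Nk_norm: "l2norm (Nk f) \<le> l2norm f"
    and Qk_bound: "\<bar>Qk f z\<bar> \<le> l2norm f" and Nk_bound: "\<bar>Nk f z\<bar> \<le> l2norm f"
proof -
  show "Qk f \<in> L2" "l2norm (Qk f) \<le> l2norm f"
    using conv_L2[OF resolvent_kernel_integrable(1) f, of 1] resolvent_kernel_integrable(2)[of 1] by simp_all
  show "Nk f \<in> L2" "l2norm (Nk f) \<le> l2norm f"
    using conv_L2[OF gradient_kernel_integrable(1) f] gradient_kernel_integrable(2) by simp_all
  show "\<bar>Qk f z\<bar> \<le> l2norm f"
    using conv_bound[OF resolvent_kernel_L2(1) f, of 1 z] mult_right_mono[OF resolvent_kernel_L2(2) l2norm_nonneg, of 1 f] by simp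
  show "\<bar>Nk f z\<bar> \<le> l2norm f"
    using conv_bound[OF gradient_kernel_integrable(3) f, of z] mult_right_mono[OF gradient_kernel_integrable(4) l2norm_nonneg, of f] by simp
qed

lemma fourier_resolvent_AE:
  assumes "f \<in> L2" "0 < a"
  shows "AE \<xi> in lborel. fourier (conv (resolvent_kernel a) f) \<xi> = of_real (a\<^sup>2) / (of_real (a\<^sup>2) + (of_real \<xi>)\<^sup>2) * fourier f \<xi>"
  using fourier_conv_AE[OF resolvent_kernel_integrable(1) resolvent_kernel_L2(1) assms(1), OF assms(2,2)]
  by (simp only: rft_resolvent_kernel[OF assms(2)])

lemma fourier_Qk_AE:
  assumes "f \<in> L2"
  shows "AE \<xi> in lborel. fourier (Qk f) \<xi> = 1 / (1 + (of_real \<xi>)\<^sup>2) * fourier f \<xi>"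
  using fourier_resolvent_AE[OF assms, of 1] by simp

lemma fourier_Nk_AE:
  assumes "f \<in> L2"
  shows "AE \<xi> in lborel. fourier (Nk f) \<xi> = \<i> * of_real \<xi> / (1 + (of_real \<xi>)\<^sup>2) * fourier f \<xi>"
  using fourier_conv_AE[OF gradient_kernel_integrable(1,3) assms] by (simp only: rft_gradient_kernel)

lemma Q_op_AE:
  assumes "f \<in> L2"
  shows "Q_op f \<in> L2" and "AE x in lborel. Q_op f x = Qk f x"
  unfolding Q_op_def using fourier_multiplier_AE[OF Qk_L2[OF assms] fourier_Qk_AE[OF assms]] by auto

lemma N_op_AE:
  assumes "f \<in> L2"
  shows "N_op f \<in> L2" and "AE x in lborel. N_op f x = Nk f x"
  unfolding N_op_def using fourier_multiplier_AE[OF Nk_L2[OF assms] fourier_Nk_AE[OF assms]] by auto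

section \<open>The Sobolev space \<open>H\<^sup>2\<close> as the range of the resolvent\<close>

lemma one_plus_square_neq_0: "1 + (of_real \<xi>)\<^sup>2 \<noteq> (0 :: complex)"
proof -
  have "1 + (of_real \<xi>)\<^sup>2 = (of_real (1 + \<xi>\<^sup>2) :: complex)"
    by simp
  moreover have "1 + \<xi>\<^sup>2 \<noteq> 0"
    using sum_power2_eq_zero_iff[of 1 \<xi>] by auto
  ultimately show ?thesis
    by (simp only: of_real_eq_0_iff not_False_eq_True)
qed

text \<open>Turns every H2 statement on \<open>g\<close> into an L2 statement on \<open>w\<close>.
  An arbitrary representative \<open>g\<close> is allowed, since the given initial datum is a
  convolution only up to a null set.\<close>

lemma Qk_H2:
  assumes w: "w \<in> L2" and g: "g \<in> L2" and eq: "AE x in lborel. g x = Qk w x"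
  shows "g \<in> H2" and "H2_norm g = sqrt (2 * pi) * l2norm w"
proof -
  have fg: "fourier g = fourier (Qk w)"
    by (rule fourier_cong_AE[OF g Qk_L2[OF w] eq])
  have ae: "AE \<xi> in lborel. of_real (1 + \<xi>\<^sup>2) * fourier g \<xi> = fourier w \<xi>"
    using fourier_Qk_AE[OF w] unfolding fg by eventually_elim (simp add: one_plus_square_neq_0)
  have [measurable]: "fourier g \<in> borel_measurable borel"
    by (rule L2_measurable[OF fourier_L2[OF g]])
  have H: "(\<lambda>\<xi>. of_real (1 + \<xi>\<^sup>2) * fourier g \<xi>) \<in> L2"
    and n: "l2norm (\<lambda>\<xi>. of_real (1 + \<xi>\<^sup>2) * fourier g \<xi>) = l2norm (fourier w)"
    using L2_cong_AE[OF _ fourier_L2[OF w] ae] by simp_all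
  show "g \<in> H2"
    using g H by (simp add: H2_def)
  have "H2_norm g = l2norm (\<lambda>\<xi>. of_real (1 + \<xi>\<^sup>2) * fourier g \<xi>)"
    unfolding H2_norm_def l2norm_def norm_mult norm_of_real by (simp add: abs_of_nonneg)
  then show "H2_norm g = sqrt (2 * pi) * l2norm w"
    by (simp only: n Plancherel[OF w])
qed

text \<open>
  The Yosida approximations \<open>n\<^sup>2 (f - (1 - \<partial>\<^sup>2/n\<^sup>2)\<^sup>-\<^sup>1 f)\<close> have symbols \<open>n\<^sup>2 \<xi>\<^sup>2 / (n\<^sup>2 + \<xi>\<^sup>2)\<close>, which
  increase to \<open>\<xi>\<^sup>2\<close>. Their \<open>L\<^sup>2\<close>-limit is real valued by construction, so no inverse Fourier
  transform is needed.
\<close>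

lemma H2_imp_Qk:
  assumes "f \<in> H2"
  shows "\<exists>w\<in>L2. AE x in lborel. f x = Qk w x"
proof -
  from assms have f: "f \<in> L2" and H: "(\<lambda>\<xi>. of_real (1 + \<xi>\<^sup>2) * fourier f \<xi>) \<in> L2"
    by (auto simp: H2_def)
  have [measurable]: "fourier f \<in> borel_measurable borel"
    by (rule L2_measurable[OF fourier_L2[OF f]])
  define a where "a n = real (Suc n)" for n
  have a: "0 < a n" for n
    by (simp add: a_def)
  define m where "m n \<xi> = (a n)\<^sup>2 * (1 - (a n)\<^sup>2 / ((a n)\<^sup>2 + \<xi>\<^sup>2))" for n \<xi>
  define s where "s n x = (a n)\<^sup>2 * (f x - conv (resolvent_kernel (a n)) f x)" for n x
  have cl: "conv (resolvent_kernel (a n)) f \<in> L2" for n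
    by (rule conv_L2(1)[OF resolvent_kernel_integrable(1)[OF a] f])
  have s: "s n \<in> L2" for n
    unfolding s_def by (intro L2_scale L2_diff f cl)
  \<comment> \<open>The defining form of \<open>m\<close> is what the transform of
    \<open>s n\<close> produces; this form shows that the symbols stay between 0 and \<xi>^2 and
    converge to \<xi>^2.\<close>
  have m_eq: "m n \<xi> = \<xi>\<^sup>2 * ((a n)\<^sup>2 / ((a n)\<^sup>2 + \<xi>\<^sup>2))" and m_le: "0 \<le> m n \<xi>" "m n \<xi> \<le> \<xi>\<^sup>2" for n \<xi>
  proof -
    have p: "0 < (a n)\<^sup>2 + \<xi>\<^sup>2"
      using a[of n] by (simp add: add_pos_nonneg)
    show *: "m n \<xi> = \<xi>\<^sup>2 * ((a n)\<^sup>2 / ((a n)\<^sup>2 + \<xi>\<^sup>2))"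
    proof -
      have "A * (1 - A / (A + x)) = x * (A / (A + x))" if "0 < A + x" for A x :: real
        using that by (simp add: field_simps)
      from this[OF p] show ?thesis
        by (simp only: m_def)
    qed
    show "0 \<le> m n \<xi>" "m n \<xi> \<le> \<xi>\<^sup>2"
      unfolding * using p mult_left_mono[of "(a n)\<^sup>2 / ((a n)\<^sup>2 + \<xi>\<^sup>2)" 1 "\<xi>\<^sup>2"] by auto
  qed
  have m_lim: "(\<lambda>n. m n \<xi>) \<longlonglongrightarrow> \<xi>\<^sup>2" for \<xi>
    unfolding m_eq a_def by real_asymp
  have fs: "AE \<xi> in lborel. fourier (s n) \<xi> = of_real (m n \<xi>) * fourier f \<xi>" for n
  proof -
    have "s n = (\<lambda>x. (a n)\<^sup>2 * f x + (- ((a n)\<^sup>2)) * conv (resolvent_kernel (a n)) f x)"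
      by (auto simp: s_def algebra_simps)
    then have "AE \<xi> in lborel. fourier (s n) \<xi> = of_real ((a n)\<^sup>2) * fourier f \<xi> + of_real (- ((a n)\<^sup>2)) * fourier (conv (resolvent_kernel (a n)) f) \<xi>"
      using fourier_lincomb_AE[OF f cl, of "(a n)\<^sup>2" "- ((a n)\<^sup>2)" n] by (simp only:)
    then show ?thesis
      using fourier_resolvent_AE[OF f a, of n]
    proof eventually_elim
      case (elim \<xi>)
      then show ?case
        by (simp add: m_def algebra_simps)
    qed
  qed
  define \<psi> where "\<psi> \<xi> = of_real (\<xi>\<^sup>2) * fourier f \<xi>" for \<xi>
  have [measurable]: "\<psi> \<in> borel_measurable borel" "(\<lambda>\<xi>. of_real (m n \<xi>) * fourier f \<xi>) \<in> borel_measurable borel" for n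
    unfolding \<psi>_def m_def by measurable
  have \<psi>_le: "norm (\<psi> \<xi>) \<le> norm (of_real (1 + \<xi>\<^sup>2) * fourier f \<xi>)" for \<xi>
    unfolding \<psi>_def norm_mult norm_of_real by (intro mult_right_mono) auto
  have \<psi>: "\<psi> \<in> L2"
    by (rule L2_mono(1)[OF _ _ H, of _ 1]) (use \<psi>_le in auto)
  have "(\<lambda>n. l2norm (\<lambda>\<xi>. of_real (m n \<xi>) * fourier f \<xi> - \<psi> \<xi>)) \<longlonglongrightarrow> 0"
  proof (rule L2_dominated[OF _ _ \<psi>])
    show "AE \<xi> in lborel. (\<lambda>n. of_real (m n \<xi>) * fourier f \<xi>) \<longlonglongrightarrow> \<psi> \<xi>"
      unfolding \<psi>_def by (intro AE_I2 tendsto_mult tendsto_of_real m_lim tendsto_const)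
    show "AE \<xi> in lborel. norm (of_real (m n \<xi>) * fourier f \<xi> - \<psi> \<xi>) \<le> norm (\<psi> \<xi>)" for n
    proof (rule AE_I2)
      fix \<xi>
      have "of_real (m n \<xi>) * fourier f \<xi> - \<psi> \<xi> = of_real (m n \<xi> - \<xi>\<^sup>2) * fourier f \<xi>"
        by (simp add: \<psi>_def algebra_simps)
      moreover have "\<bar>m n \<xi> - \<xi>\<^sup>2\<bar> \<le> \<bar>\<xi>\<^sup>2\<bar>"
        using m_le[of n \<xi>] by auto
      ultimately show "norm (of_real (m n \<xi>) * fourier f \<xi> - \<psi> \<xi>) \<le> norm (\<psi> \<xi>)"
        unfolding \<psi>_def by (simp only: norm_mult norm_of_real) (intro mult_right_mono, auto)
    qed
  qed auto
  moreover have "l2norm (\<lambda>\<xi>. of_real (m n \<xi>) * fourier f \<xi> - \<psi> \<xi>) = l2norm (\<lambda>\<xi>. fourier (s n) \<xi> - \<psi> \<xi>)" for n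
    by (rule L2_cong_AE(2)[OF _ L2_diff(1)[OF fourier_L2[OF s] \<psi>]]) (use fs[of n] in \<open>auto elim: eventually_mono\<close>)
  ultimately have lim: "(\<lambda>n. l2norm (\<lambda>\<xi>. fourier (s n) \<xi> - \<psi> \<xi>)) \<longlonglongrightarrow> 0"
    by simp
  have "\<exists>h\<in>L2. (\<lambda>n. l2norm (\<lambda>x. s n x - h x)) \<longlonglongrightarrow> 0"
  proof (rule L2_complete[OF s])
    fix e :: real assume e: "0 < e"
    obtain N where N: "\<And>n. n \<ge> N \<Longrightarrow> l2norm (\<lambda>\<xi>. fourier (s n) \<xi> - \<psi> \<xi>) < e / 2"
      using LIMSEQ_D[OF lim, of "e / 2"] e by auto
    have "l2norm (\<lambda>x. s i x - s j x) < e" if ij: "i \<ge> N" "j \<ge> N" for i j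
    proof -
      have "1 * l2norm (\<lambda>x. s i x - s j x) \<le> sqrt (2 * pi) * l2norm (\<lambda>x. s i x - s j x)"
        using pi_gt3 by (intro mult_right_mono) auto
      also have "\<dots> = l2norm (\<lambda>\<xi>. fourier (s i) \<xi> - fourier (s j) \<xi>)"
        by (simp add: fourier_dist s)
      also have "\<dots> \<le> l2norm (\<lambda>\<xi>. fourier (s i) \<xi> - \<psi> \<xi>) + l2norm (\<lambda>\<xi>. \<psi> \<xi> - fourier (s j) \<xi>)"
        by (intro l2norm_triangle3 fourier_L2 s \<psi>)
      also have "\<dots> < e / 2 + e / 2"
        using N[OF ij(1)] N[OF ij(2)] by (intro add_strict_mono) (simp_all add: l2norm_diff_commute[of \<psi>])
      finally show ?thesis
        by simp
    qed
    then show "\<exists>N. \<forall>i\<ge>N. \<forall>j\<ge>N. l2norm (\<lambda>x. s i x - s j x) < e"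
      by blast
  qed
  then obtain h where h: "h \<in> L2" and hlim: "(\<lambda>n. l2norm (\<lambda>x. s n x - h x)) \<longlonglongrightarrow> 0"
    by blast
  have "(\<lambda>n. l2norm (\<lambda>\<xi>. fourier (s n) \<xi> - fourier h \<xi>)) \<longlonglongrightarrow> 0"
    using tendsto_mult_left[OF hlim, of "sqrt (2 * pi)"] by (simp add: fourier_dist s h)
  from L2_limit_unique[OF fourier_L2[OF s] \<psi> fourier_L2[OF h] lim this]
  have fh: "AE \<xi> in lborel. \<psi> \<xi> = fourier h \<xi>" .
  \<comment> \<open>The transform of \<open>h\<close> is \<xi>^2 times that of \<open>f\<close>, so
    \<open>w\<close> has the transform \<open>(1 + \<xi>\<^sup>2) * fourier f \<xi>\<close>. The
    factors 1 only match the shape of \<open>fourier_lincomb_AE\<close>.\<close>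
  define w where "w x = 1 * f x + 1 * h x" for x
  have w: "w \<in> L2"
    unfolding w_def using f h by (auto intro: L2_add)
  have fw: "AE \<xi> in lborel. fourier w \<xi> = of_real 1 * fourier f \<xi> + of_real 1 * fourier h \<xi>"
    unfolding w_def by (rule fourier_lincomb_AE[OF f h])
  have "AE \<xi> in lborel. fourier f \<xi> = fourier (Qk w) \<xi>"
    using fw fh fourier_Qk_AE[OF w]
  proof eventually_elim
    case (elim \<xi>)
    then have "fourier w \<xi> = (1 + (of_real \<xi>)\<^sup>2) * fourier f \<xi>"
      by (simp add: \<psi>_def algebra_simps flip: elim(2))
    with elim(3) show ?case
      by (simp add: one_plus_square_neq_0)
  qed
  from fourier_inject_AE[OF f Qk_L2[OF w] this] w show ?thesis
    by blast
qed

section \<open>Integration by parts against the kernels\<close>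

text \<open>Here \<open>f\<close> is a derivative that is not known to be continuous. The gauge
  integral evaluates it on compact intervals, integrability identifies this with the Lebesgue
  integral, and dominated convergence exhausts \<open>S\<close>. Both half-lines are covered at
  once.\<close>

lemma integral_FTC_exhaustion:
  fixes F f :: "real \<Rightarrow> real"
  assumes F: "\<And>x. (F has_real_derivative f x) (at x)"
    and int: "integrable lborel (\<lambda>x. indicator S x * f x)"
    and ab: "\<And>n. a n \<le> b n" "\<And>n. {a n..b n} \<subseteq> S"
    and ex: "\<And>x. x \<in> S \<Longrightarrow> eventually (\<lambda>n. x \<in> {a n..b n}) sequentially"
    and lim: "(\<lambda>n. F (b n) - F (a n)) \<longlonglongrightarrow> L"
  shows "(\<integral>x. indicator S x * f x \<partial>lborel) = L"
proof -
  have eq: "indicator {a n..b n} x * (indicator S x * f x) = indicator {a n..b n} x * f x" for n x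
    using ab(2)[of n] by (auto simp: indicator_def)
  have "(\<integral>x. indicator {a n..b n} x * (indicator S x * f x) \<partial>lborel) = F (b n) - F (a n)" for n
  proof -
    have si: "set_integrable lborel {a n..b n} f"
      unfolding set_integrable_def
      using integrable_mult_indicator[OF _ int, of "{a n..b n}"] by (simp add: eq)
    have "(f has_integral F (b n) - F (a n)) {a n..b n}"
      using F by (intro fundamental_theorem_of_calculus ab)
        (auto simp: has_real_derivative_iff_has_vector_derivative[symmetric] intro: DERIV_subset)
    then have "integral {a n..b n} f = F (b n) - F (a n)"
      by (rule integral_unique)
    with set_borel_integral_eq_integral(2)[OF si] show ?thesis
      by (simp add: set_lebesgue_integral_def eq)
  qed
  moreover have "(\<lambda>n. \<integral>x. indicator {a n..b n} x * (indicator S x * f x) \<partial>lborel) \<longlonglongrightarrow> (\<integral>x. indicator S x * f x \<partial>lborel)"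
  proof (rule integral_dominated_convergence[where w = "\<lambda>x. norm (indicator S x * f x)"])
    show "AE x in lborel. (\<lambda>n. indicator {a n..b n} x * (indicator S x * f x)) \<longlonglongrightarrow> indicator S x * f x"
    proof (intro AE_I2 tendsto_eventually)
      fix x
      show "eventually (\<lambda>n. indicator {a n..b n} x * (indicator S x * f x) = indicator S x * f x) sequentially"
      proof (cases "x \<in> S")
        case True
        from ex[OF True] show ?thesis
          by eventually_elim simp
      qed simp
    qed
    show "AE x in lborel. norm (indicator {a n..b n} x * (indicator S x * f x)) \<le> norm (indicator S x * f x)" for n
      by (auto simp: indicator_def)
  qed (use int in auto)
  ultimately have "(\<lambda>n. F (b n) - F (a n)) \<longlonglongrightarrow> (\<integral>x. indicator S x * f x \<partial>lborel)"
    by simp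
  from LIMSEQ_unique[OF this lim] show ?thesis .
qed

text \<open>On either side of \<open>z\<close> the kernel is a pure exponential, so its product with
  p + p' on the left, and with p' - p on the right, is an exact derivative. The sum and the
  difference of the two half-line identities are the two claims; the term - p z reflects the jump of
  the gradient kernel.\<close>

lemma kernel_by_parts:
  fixes p p' :: "real \<Rightarrow> real"
  assumes der: "\<And>x. (p has_real_derivative p' x) (at x)"
    and B: "\<And>x. \<bar>p x\<bar> \<le> B"
    and int': "\<And>z. integrable lborel (\<lambda>x. resolvent_kernel 1 (z - x) * p' x)"
  shows "Qk p' z = Nk p z" and "Nk p' z = Qk p z - p z"
proof -
  let ?E = "\<lambda>x. resolvent_kernel 1 (z - x)"
  have "continuous_on UNIV p"
    using der by (meson DERIV_isCont continuous_at_imp_continuous_on)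
  then have [measurable]: "p \<in> borel_measurable borel"
    by (rule borel_measurable_continuous_onI)
  have B0: "0 \<le> B"
    using B[of 0] by linarith
  have intE: "integrable lborel ?E"
    by (intro integrable_reflect_shift resolvent_kernel_integrable) simp
  have int: "integrable lborel (\<lambda>x. ?E x * p x)"
  proof (rule Bochner_Integration.integrable_bound[OF integrable_mult_left[OF intE, of B]])
    show "AE x in lborel. norm (?E x * p x) \<le> norm (?E x * B)"
      using B B0 by (auto simp: abs_mult intro!: AE_I2 mult_left_mono)
  qed simp
  have iS: "integrable lborel (\<lambda>x. indicator S x * (?E x * p x))" "integrable lborel (\<lambda>x. indicator S x * (?E x * p' x))"
    if "S \<in> sets borel" for S :: "real set"
    using integrable_mult_indicator[of S lborel, OF _ int] integrable_mult_indicator[of S lborel, OF _ int'[of z]] that by simp_all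
  \<comment> \<open>The boundary terms at infinity disappear since \<open>p\<close> is
    bounded.\<close>
  have vanish: "(\<lambda>n. 1 / 2 * exp (- real n) * p (f n)) \<longlonglongrightarrow> 0" for f :: "nat \<Rightarrow> real"
  proof (rule Lim_null_comparison)
    show "eventually (\<lambda>n. norm (1 / 2 * exp (- real n) * p (f n)) \<le> 1 / 2 * exp (- real n) * B) sequentially"
      using B by (intro always_eventually allI) (simp add: abs_mult)
    show "(\<lambda>n. 1 / 2 * exp (- real n) * B) \<longlonglongrightarrow> 0"
      by real_asymp
  qed
  have left: "(\<integral>x. indicator {..z} x * (1 / 2 * exp (x - z) * (p x + p' x)) \<partial>lborel) = 1 / 2 * p z"
  proof (rule integral_FTC_exhaustion[where F = "\<lambda>x. 1 / 2 * exp (x - z) * p x" and a = "\<lambda>n. z - real n" and b = "\<lambda>_. z"])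
    show "((\<lambda>x. 1 / 2 * exp (x - z) * p x) has_real_derivative 1 / 2 * exp (x - z) * (p x + p' x)) (at x)" for x
      by (rule derivative_eq_intros der refl | simp add: algebra_simps)+
    have "(\<lambda>x. indicator {..z} x * (1 / 2 * exp (x - z) * (p x + p' x)))
        = (\<lambda>x. indicator {..z} x * (?E x * p x) + indicator {..z} x * (?E x * p' x))"
      by (intro ext) (auto simp: indicator_def resolvent_kernel_def algebra_simps)
    then show "integrable lborel (\<lambda>x. indicator {..z} x * (1 / 2 * exp (x - z) * (p x + p' x)))"
      using iS[of "{..z}"] by simp
    show "(\<lambda>n. 1 / 2 * exp (z - z) * p z - 1 / 2 * exp (z - real n - z) * p (z - real n)) \<longlonglongrightarrow> 1 / 2 * p z"
      using tendsto_diff[OF tendsto_const vanish, of "1 / 2 * p z" "\<lambda>n. z - real n"] by simp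
    show "eventually (\<lambda>n. x \<in> {z - real n..z}) sequentially" if "x \<in> {..z}" for x
    proof -
      obtain N where "z - x \<le> real N"
        using real_arch_simple by blast
      with that show ?thesis
        by (intro eventually_sequentiallyI[of N]) auto
    qed
  qed auto
  have right: "(\<integral>x. indicator {z..} x * (1 / 2 * exp (z - x) * (p' x - p x)) \<partial>lborel) = - (1 / 2 * p z)"
  proof (rule integral_FTC_exhaustion[where F = "\<lambda>x. 1 / 2 * exp (z - x) * p x" and a = "\<lambda>_. z" and b = "\<lambda>n. z + real n"])
    show "((\<lambda>x. 1 / 2 * exp (z - x) * p x) has_real_derivative 1 / 2 * exp (z - x) * (p' x - p x)) (at x)" for x
      by (rule derivative_eq_intros der refl | simp add: algebra_simps)+
    have "(\<lambda>x. indicator {z..} x * (1 / 2 * exp (z - x) * (p' x - p x)))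
        = (\<lambda>x. indicator {z..} x * (?E x * p' x) - indicator {z..} x * (?E x * p x))"
      by (intro ext) (auto simp: indicator_def resolvent_kernel_def algebra_simps diff_divide_distrib)
    then show "integrable lborel (\<lambda>x. indicator {z..} x * (1 / 2 * exp (z - x) * (p' x - p x)))"
      using iS[of "{z..}"] by simp
    show "(\<lambda>n. 1 / 2 * exp (z - (z + real n)) * p (z + real n) - 1 / 2 * exp (z - z) * p z) \<longlonglongrightarrow> - (1 / 2 * p z)"
      using tendsto_diff[OF vanish tendsto_const, of "\<lambda>n. z + real n" "1 / 2 * p z"] by simp
    show "eventually (\<lambda>n. x \<in> {z..z + real n}) sequentially" if "x \<in> {z..}" for x
    proof -
      obtain N where "x - z \<le> real N"
        using real_arch_simple by blast
      with that show ?thesis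
        by (intro eventually_sequentiallyI[of N]) auto
    qed
  qed auto
  \<comment> \<open>The letter A belongs to \<open>p'\<close> and B to \<open>p\<close>; index 1
    stands for the half-line left of \<open>z\<close> and 2 for the one to the right.\<close>
  define A1 A2 B1 B2 where "A1 = (\<integral>x. indicator {..z} x * (?E x * p' x) \<partial>lborel)"
    and "A2 = (\<integral>x. indicator {z..} x * (?E x * p' x) \<partial>lborel)"
    and "B1 = (\<integral>x. indicator {..z} x * (?E x * p x) \<partial>lborel)"
    and "B2 = (\<integral>x. indicator {z..} x * (?E x * p x) \<partial>lborel)"
  have 1: "B1 + A1 = 1 / 2 * p z"
  proof -
    have "B1 + A1 = (\<integral>x. indicator {..z} x * (?E x * p x) + indicator {..z} x * (?E x * p' x) \<partial>lborel)"
      unfolding A1_def B1_def using iS[of "{..z}"] by simp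
    also have "\<dots> = (\<integral>x. indicator {..z} x * (1 / 2 * exp (x - z) * (p x + p' x)) \<partial>lborel)"
      by (intro Bochner_Integration.integral_cong refl) (auto simp: indicator_def resolvent_kernel_def algebra_simps)
    finally show ?thesis
      by (simp only: left)
  qed
  have 2: "A2 - B2 = - (1 / 2 * p z)"
  proof -
    have "A2 - B2 = (\<integral>x. indicator {z..} x * (?E x * p' x) - indicator {z..} x * (?E x * p x) \<partial>lborel)"
      unfolding A2_def B2_def using iS[of "{z..}"] by simp
    also have "\<dots> = (\<integral>x. indicator {z..} x * (1 / 2 * exp (z - x) * (p' x - p x)) \<partial>lborel)"
      by (intro Bochner_Integration.integral_cong refl) (auto simp: indicator_def resolvent_kernel_def algebra_simps)
    finally show ?thesis
      by (simp only: right)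
  qed
  have split: "Qk q z = (\<integral>x. indicator {..z} x * (?E x * q x) \<partial>lborel) + (\<integral>x. indicator {z..} x * (?E x * q x) \<partial>lborel)"
    "Nk q z = (\<integral>x. indicator {z..} x * (?E x * q x) \<partial>lborel) - (\<integral>x. indicator {..z} x * (?E x * q x) \<partial>lborel)"
    if q [measurable]: "q \<in> borel_measurable borel" and q': "\<And>S. S \<in> sets borel \<Longrightarrow> integrable lborel (\<lambda>x. indicator S x * (?E x * q x))"
    for q
  proof -
    note i = q'[of "{..z}", simplified] q'[of "{z..}", simplified]
    have "Qk q z = (\<integral>x. indicator {..z} x * (?E x * q x) + indicator {z..} x * (?E x * q x) \<partial>lborel)"
      unfolding conv_def
    proof (rule integral_cong_AE)
      show "AE x in lborel. ?E x * q x = indicator {..z} x * (?E x * q x) + indicator {z..} x * (?E x * q x)"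
        using AE_lborel_singleton[of z] by eventually_elim (auto simp: indicator_def)
    qed measurable
    with i show "Qk q z = (\<integral>x. indicator {..z} x * (?E x * q x) \<partial>lborel) + (\<integral>x. indicator {z..} x * (?E x * q x) \<partial>lborel)"
      by simp
    have "Nk q z = (\<integral>x. indicator {z..} x * (?E x * q x) - indicator {..z} x * (?E x * q x) \<partial>lborel)"
      unfolding conv_def
    proof (rule integral_cong_AE)
      show "AE x in lborel. gradient_kernel (z - x) * q x = indicator {z..} x * (?E x * q x) - indicator {..z} x * (?E x * q x)"
        using AE_lborel_singleton[of z]
        by eventually_elim (auto simp: indicator_def gradient_kernel_def resolvent_kernel_def sgn_if)
    qed measurable
    with i show "Nk q z = (\<integral>x. indicator {z..} x * (?E x * q x) \<partial>lborel) - (\<integral>x. indicator {..z} x * (?E x * q x) \<partial>lborel)"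
      by simp
  qed
  \<comment> \<open>Measurability of \<open>p'\<close> is read off from the integrable product by
    dividing by the kernel, which never vanishes.\<close>
  have p': "p' \<in> borel_measurable borel"
  proof -
    have "(\<lambda>x. ?E x * p' x) \<in> borel_measurable borel"
      using int'[of z] by auto
    then have "(\<lambda>x. (?E x * p' x) / ?E x) \<in> borel_measurable borel"
      by measurable
    moreover have "?E x \<noteq> 0" for x
      by (simp add: resolvent_kernel_def)
    ultimately show ?thesis
      by simp
  qed
  have "Qk p' z = A1 + A2" "Nk p' z = A2 - A1" "Qk p z = B1 + B2" "Nk p z = B2 - B1"
    unfolding A1_def A2_def B1_def B2_def by (intro split p' iS; simp)+
  with 1 2 show "Qk p' z = Nk p z" "Nk p' z = Qk p z - p z"
    by linarith+
qed

section \<open>Differentiability of convolutions with the resolvent kernel\<close>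

lemma abs_exp_diff_one_le: "\<bar>exp t - 1\<bar> \<le> \<bar>t\<bar> * exp \<bar>t\<bar>" for t :: real
proof (cases "0 \<le> t")
  case True
  have "1 - t \<le> exp (- t)"
    using exp_ge_add_one_self[of "- t"] by simp
  then have "(1 - t) * exp t \<le> exp (- t) * exp t"
    by (intro mult_right_mono) auto
  with True show ?thesis
    by (simp add: exp_minus field_simps)
next
  case False
  then have "1 - exp t \<le> \<bar>t\<bar> * 1"
    using exp_ge_add_one_self[of t] by linarith
  also have "\<dots> \<le> \<bar>t\<bar> * exp \<bar>t\<bar>"
    by (intro mult_left_mono) auto
  finally show ?thesis
    using False by simp
qed

text \<open>The increment is compared with the kernel at \<open>u\<close> itself, not with a
  constant. Difference quotients multiplied by an L2 function \<open>w\<close> are then dominated by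
  a multiple of the kernel times \<bar>w\<bar>, which is integrable.\<close>

lemma resolvent_kernel_Lipschitz:
  assumes "\<bar>h\<bar> \<le> M"
  shows "\<bar>resolvent_kernel 1 (u + h) - resolvent_kernel 1 u\<bar> \<le> exp M * \<bar>h\<bar> * resolvent_kernel 1 u"
proof -
  let ?t = "\<bar>u\<bar> - \<bar>u + h\<bar>"
  have t: "\<bar>?t\<bar> \<le> \<bar>h\<bar>"
    by linarith
  have "resolvent_kernel 1 (u + h) - resolvent_kernel 1 u = (exp ?t - 1) * resolvent_kernel 1 u"
    by (simp add: resolvent_kernel_def exp_diff exp_minus field_simps)
  then have "\<bar>resolvent_kernel 1 (u + h) - resolvent_kernel 1 u\<bar> = \<bar>exp ?t - 1\<bar> * resolvent_kernel 1 u"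
    by (simp only: abs_mult abs_of_pos[OF resolvent_kernel_pos[OF zero_less_one]])
  also have "\<bar>exp ?t - 1\<bar> \<le> \<bar>?t\<bar> * exp \<bar>?t\<bar>"
    by (rule abs_exp_diff_one_le)
  also have "\<dots> \<le> \<bar>h\<bar> * exp M"
    using t assms by (intro mult_mono) auto
  finally show ?thesis
    using resolvent_kernel_pos[of 1 u] by (simp add: mult_ac)
qed

lemma DERIV_resolvent_kernel:
  assumes "u \<noteq> 0"
  shows "(resolvent_kernel 1 has_real_derivative gradient_kernel u) (at u)"
proof (cases "0 < u")
  case True
  have "((\<lambda>x. 1 / 2 * exp (- x)) has_real_derivative gradient_kernel u) (at u)"
    using True by (auto intro!: derivative_eq_intros simp: gradient_kernel_def)
  then show ?thesis
    by (rule has_field_derivative_transform_within_open[where S = "{0<..}"])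
       (use True in \<open>auto simp: resolvent_kernel_def\<close>)
next
  case False
  with assms have "u < 0"
    by simp
  then have "((\<lambda>x. 1 / 2 * exp x) has_real_derivative gradient_kernel u) (at u)"
    by (auto intro!: derivative_eq_intros simp: gradient_kernel_def)
  then show ?thesis
    by (rule has_field_derivative_transform_within_open[where S = "{..<0}"])
       (use \<open>u < 0\<close> in \<open>auto simp: resolvent_kernel_def\<close>)
qed

text \<open>Differentiation under the integral. The kink of the kernel sits at y = z, a null set, so
  the derivative exists at every point although \<open>w\<close> is merely square
  integrable.\<close>

lemma DERIV_Qk:
  assumes w: "w \<in> L2"
  shows "(Qk w has_real_derivative Nk w z) (at z)"
proof -
  note [measurable] = L2_measurable[OF w]
  have intE: "integrable lborel (\<lambda>y. resolvent_kernel 1 (x - y) * w y)" for x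
    by (rule integrable_conv[OF resolvent_kernel_L2(1) w]) simp
  have "((\<lambda>h. (Qk w (z + h) - Qk w z) / h) \<longlongrightarrow> Nk w z) (at 0)"
    unfolding tendsto_at_iff_sequentially
  proof (intro allI impI)
    fix X :: "nat \<Rightarrow> real"
    assume X: "\<forall>i. X i \<in> UNIV - {0}" "X \<longlonglongrightarrow> 0"
    then have X0: "X i \<noteq> 0" for i
      by auto
    \<comment> \<open>A bound \<open>M\<close> for the whole sequence makes the constant
      \<open>exp M\<close> in the relative Lipschitz estimate independent of the index.\<close>
    from X(2) have "Bseq X"
      by (intro convergent_imp_Bseq) (auto simp: convergent_def)
    then obtain M where M: "\<And>i. \<bar>X i\<bar> \<le> M"
      by (auto simp: Bseq_def)
    let ?q = "\<lambda>i y. (resolvent_kernel 1 (z - y + X i) - resolvent_kernel 1 (z - y)) / X i * w y"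
    have "(\<lambda>i. \<integral>y. ?q i y \<partial>lborel) \<longlonglongrightarrow> (\<integral>y. gradient_kernel (z - y) * w y \<partial>lborel)"
    proof (rule integral_dominated_convergence[where w = "\<lambda>y. exp M * norm (resolvent_kernel 1 (z - y) * w y)"])
      show "integrable lborel (\<lambda>y. exp M * norm (resolvent_kernel 1 (z - y) * w y))"
        using intE[of z] by (intro integrable_mult_right integrable_norm)
      show "AE y in lborel. norm (?q i y) \<le> exp M * norm (resolvent_kernel 1 (z - y) * w y)" for i
      proof (rule AE_I2)
        fix y
        have "\<bar>resolvent_kernel 1 (z - y + X i) - resolvent_kernel 1 (z - y)\<bar> / \<bar>X i\<bar> \<le> exp M * resolvent_kernel 1 (z - y)"
          using resolvent_kernel_Lipschitz[OF M, of "z - y" i] X0[of i] by (simp add: divide_le_eq mult_ac)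
        then have "\<bar>resolvent_kernel 1 (z - y + X i) - resolvent_kernel 1 (z - y)\<bar> / \<bar>X i\<bar> * \<bar>w y\<bar> \<le> exp M * resolvent_kernel 1 (z - y) * \<bar>w y\<bar>"
          by (intro mult_right_mono) auto
        then show "norm (?q i y) \<le> exp M * norm (resolvent_kernel 1 (z - y) * w y)"
          using resolvent_kernel_pos[of 1 "z - y"] by (simp add: abs_mult mult_ac)
      qed
      show "AE y in lborel. (\<lambda>i. ?q i y) \<longlonglongrightarrow> gradient_kernel (z - y) * w y"
        using AE_lborel_singleton[of z]
      proof eventually_elim
        case (elim y)
        then have "((\<lambda>h. (resolvent_kernel 1 (z - y + h) - resolvent_kernel 1 (z - y)) / h) \<longlongrightarrow> gradient_kernel (z - y)) (at 0)"
          using DERIV_resolvent_kernel[of "z - y"] by (simp add: DERIV_def)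
        then have "(\<lambda>i. (resolvent_kernel 1 (z - y + X i) - resolvent_kernel 1 (z - y)) / X i) \<longlonglongrightarrow> gradient_kernel (z - y)"
          using X unfolding tendsto_at_iff_sequentially by (simp add: comp_def)
        then show ?case
          by (intro tendsto_mult_right)
      qed
    qed measurable
    moreover have "(\<integral>y. ?q i y \<partial>lborel) = (Qk w (z + X i) - Qk w z) / X i" for i
    proof -
      have "(Qk w (z + X i) - Qk w z) / X i
          = (\<integral>y. (resolvent_kernel 1 (z + X i - y) * w y - resolvent_kernel 1 (z - y) * w y) / X i \<partial>lborel)"
        unfolding conv_def using intE by simp
      also have "\<dots> = (\<integral>y. ?q i y \<partial>lborel)"
      proof (intro Bochner_Integration.integral_cong refl)
        fix y
        have eq: "z + X i - y = z - y + X i"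
          by simp
        show "(resolvent_kernel 1 (z + X i - y) * w y - resolvent_kernel 1 (z - y) * w y) / X i = ?q i y"
          unfolding eq by (simp add: left_diff_distrib diff_divide_distrib)
      qed
      finally show ?thesis
        by (rule sym)
    qed
    ultimately show "((\<lambda>h. (Qk w (z + h) - Qk w z) / h) \<circ> X) \<longlonglongrightarrow> Nk w z"
      by (simp only: comp_def conv_def[of gradient_kernel])
  qed
  then show ?thesis
    by (simp add: DERIV_def)
qed

section \<open>Identities for the two convolution operators\<close>

lemma L2_mult_bounded:
  fixes f g :: "real \<Rightarrow> real"
  assumes f: "f \<in> L2" and [measurable]: "g \<in> borel_measurable borel" and B: "\<And>x. \<bar>g x\<bar> \<le> B"
  shows "(\<lambda>x. f x * g x) \<in> L2" and "l2norm (\<lambda>x. f x * g x) \<le> l2norm f * B"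
  using L2_bounded_mult[OF f, of g B] B by (simp_all add: mult.commute)

text \<open>Integration by parts with p = \<open>Qk w\<close>, whose derivative is
  \<open>Nk w\<close>.\<close>

lemma Qk_Nk_commute:
  assumes w: "w \<in> L2"
  shows "Qk (Nk w) = Nk (Qk w)"
  by (rule ext, rule kernel_by_parts(1)[OF DERIV_Qk[OF w] Qk_bound[OF w]],
      rule integrable_conv[OF resolvent_kernel_L2(1) Nk_L2[OF w]], simp)

text \<open>Integration by parts with p = \<open>(Qk w)\<^sup>2\<close>, which is bounded by the
  pointwise bound for \<open>Qk\<close>.\<close>

lemma Nk_square:
  assumes w: "w \<in> L2"
  shows "Nk (\<lambda>x. (Qk w x)\<^sup>2) = Qk (\<lambda>x. 2 * (Nk w x * Qk w x))"
proof
  fix z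
  have L2: "(\<lambda>x. 2 * (Nk w x * Qk w x)) \<in> L2"
    by (intro L2_scale L2_mult_bounded[OF Nk_L2[OF w] _ Qk_bound[OF w]] L2_measurable[OF Qk_L2[OF w]])
  have "Qk (\<lambda>x. 2 * (Nk w x * Qk w x)) z = Nk (\<lambda>x. (Qk w x)\<^sup>2) z"
  proof (rule kernel_by_parts(1))
    show "((\<lambda>x. (Qk w x)\<^sup>2) has_real_derivative 2 * (Nk w x * Qk w x)) (at x)" for x
      using DERIV_power[OF DERIV_Qk[OF w, of x], of 2] by (simp add: mult_ac)
    show "\<bar>(Qk w x)\<^sup>2\<bar> \<le> (l2norm w)\<^sup>2" for x
      using power_mono[OF Qk_bound[OF w, of x], of 2] by simp
    show "integrable lborel (\<lambda>x. resolvent_kernel 1 (z - x) * (2 * (Nk w x * Qk w x)))" for z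
      by (rule integrable_conv[OF resolvent_kernel_L2(1) L2]) simp
  qed
  then show "Nk (\<lambda>x. (Qk w x)\<^sup>2) z = Qk (\<lambda>x. 2 * (Nk w x * Qk w x)) z" ..
qed

text \<open>Fubini's theorem for an even kernel. Since the kernel is positive, the integral of norms
  is again of the form \<open>Qk\<close> of \<bar>f\<bar>, which gives the required
  integrability.\<close>

lemma Qk_symmetric:
  assumes f: "f \<in> L2" and h: "h \<in> L2"
  shows "(\<integral>x. Qk f x * h x \<partial>lborel) = (\<integral>x. f x * Qk h x \<partial>lborel)"
proof -
  note [measurable] = L2_measurable[OF f] L2_measurable[OF h]
  let ?H = "\<lambda>x y. resolvent_kernel 1 (x - y) * f y * h x"
  have sym: "resolvent_kernel 1 (x - y) = resolvent_kernel 1 (y - x)" for x y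
    by (simp add: resolvent_kernel_def abs_minus_commute)
  have af: "(\<lambda>x. \<bar>f x\<bar>) \<in> L2" "(\<lambda>x. \<bar>h x\<bar>) \<in> L2"
    using L2_norm(1)[OF f] L2_norm(1)[OF h] by simp_all
  have "integrable (lborel \<Otimes>\<^sub>M lborel) (\<lambda>(x, y). ?H x y)"
  proof (rule lborel_pair.Fubini_integrable)
    have "(\<lambda>x. \<integral>y. norm (case (x, y) of (x, y) \<Rightarrow> ?H x y) \<partial>lborel) = (\<lambda>x. Qk (\<lambda>y. \<bar>f y\<bar>) x * \<bar>h x\<bar>)"
    proof
      fix x
      have "(\<integral>y. norm (case (x, y) of (x, y) \<Rightarrow> ?H x y) \<partial>lborel) = (\<integral>y. resolvent_kernel 1 (x - y) * \<bar>f y\<bar> * \<bar>h x\<bar> \<partial>lborel)"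
        using resolvent_kernel_pos[of 1] by (intro Bochner_Integration.integral_cong refl) (simp add: abs_mult less_imp_le)
      then show "(\<integral>y. norm (case (x, y) of (x, y) \<Rightarrow> ?H x y) \<partial>lborel) = Qk (\<lambda>y. \<bar>f y\<bar>) x * \<bar>h x\<bar>"
        by (simp add: conv_def)
    qed
    then show "integrable lborel (\<lambda>x. \<integral>y. norm (case (x, y) of (x, y) \<Rightarrow> ?H x y) \<partial>lborel)"
      using L2_integrable_mult(1)[OF Qk_L2[OF af(1)] af(2)] by (simp only:)
    show "AE x in lborel. integrable lborel (\<lambda>y. case (x, y) of (x, y) \<Rightarrow> ?H x y)"
      using integrable_conv[OF resolvent_kernel_L2(1) f, of 1] by (intro AE_I2) simp
  qed measurable
  from lborel_pair.Fubini_integral[OF this]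
  have "(\<integral>y. (\<integral>x. ?H x y \<partial>lborel) \<partial>lborel) = (\<integral>x. (\<integral>y. ?H x y \<partial>lborel) \<partial>lborel)" .
  moreover have "(\<integral>x. ?H x y \<partial>lborel) = f y * Qk h y" for y
    unfolding conv_def sym[of _ y]
    by (subst integral_mult_right_zero[symmetric]) (simp add: mult_ac)
  moreover have "(\<integral>y. ?H x y \<partial>lborel) = Qk f x * h x" for x
    by (simp add: conv_def)
  ultimately show ?thesis
    by (simp only:)
qed

section \<open>Test functions\<close>

text \<open>The polynomial \<open>p\<close> and the exponent \<open>k\<close> are free so that the
  family is closed under differentiation; p = 1 and k = 0 give the usual bump. The parameter
  \<open>c\<close> is there because the bumps tend to the indicator of the open interval as c tends
  to 0.\<close>

definition bump_family :: "real \<Rightarrow> real \<Rightarrow> real \<Rightarrow> real poly \<Rightarrow> nat \<Rightarrow> real \<Rightarrow> real" where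
  "bump_family c a b p k x = (if a < x \<and> x < b
     then poly p x / ((x - a) * (b - x)) ^ k * exp (- (c / ((x - a) * (b - x)))) else 0)"

text \<open>The inequality t \<le> exp t for t = c / (u m), raised to the power m: the exponential
  beats every power of u near 0.\<close>

lemma exp_neg_inverse_le:
  fixes u c :: real
  assumes u: "0 < u" and c: "0 < c" and m: "0 < m"
  shows "exp (- (c / u)) \<le> (real m / c) ^ m * u ^ m"
proof -
  let ?t = "c / u / real m"
  have t: "0 < ?t"
    using u c m by simp
  have "?t ^ m \<le> exp ?t ^ m"
    using exp_ge_add_one_self[of ?t] t by (intro power_mono) linarith+
  also have "exp ?t ^ m = exp (c / u)"
    using m by (simp flip: exp_of_nat_mult)
  finally have "exp (- (c / u)) \<le> inverse (?t ^ m)"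
    using t by (simp add: exp_minus le_imp_inverse_le)
  also have "\<dots> = (real m / c) ^ m * u ^ m"
    by (simp add: power_divide power_mult_distrib field_simps)
  finally show ?thesis .
qed

text \<open>Second-order vanishing at both ends of the interval is what forces a zero derivative at
  the two points where the cases of the definition meet.\<close>

lemma bump_family_quadratic:
  assumes ab: "a < b" and c: "0 < c"
  obtains K where "\<And>x. \<bar>bump_family c a b p k x\<bar> \<le> K * (x - a)\<^sup>2" "\<And>x. \<bar>bump_family c a b p k x\<bar> \<le> K * (x - b)\<^sup>2"
proof -
  have "bounded (poly p ` {a..b})"
    by (intro compact_imp_bounded compact_continuous_image continuous_intros) simp
  then obtain P where P: "\<And>x. x \<in> {a..b} \<Longrightarrow> \<bar>poly p x\<bar> \<le> P"
    unfolding bounded_iff by (metis imageI real_norm_def)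
  have P0: "0 \<le> P"
    using P[of a] ab by auto
  \<comment> \<open>Of the k + 2 powers of u gained from the exponential, k cancel the denominator
    and two remain.\<close>
  let ?C = "(real (k + 2) / c) ^ (k + 2)"
  have C: "0 \<le> ?C"
    using c by simp
  define K where "K = P * ?C * (b - a)\<^sup>2"
  have PC: "0 \<le> P * ?C"
    by (rule mult_nonneg_nonneg[OF P0 C])
  have K0: "0 \<le> K"
    unfolding K_def by (intro mult_nonneg_nonneg P0 C) simp
  have main: "\<bar>bump_family c a b p k x\<bar> \<le> P * ?C * ((x - a) * (b - x))\<^sup>2" if x: "a < x" "x < b" for x
  proof -
    define u where "u = (x - a) * (b - x)"
    have u: "0 < u"
      using x by (simp add: u_def)
    have "\<bar>bump_family c a b p k x\<bar> = \<bar>poly p x\<bar> * (exp (- (c / u)) / u ^ k)"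
      using x u by (simp add: bump_family_def u_def[symmetric] abs_mult)
    also have "\<dots> \<le> P * (?C * u ^ (k + 2) / u ^ k)"
      using P[of x] x P0 u exp_neg_inverse_le[OF u c, of "k + 2"] by (intro mult_mono divide_right_mono) auto
    also have "?C * u ^ (k + 2) / u ^ k = ?C * u\<^sup>2"
      using u by (simp add: power_add power2_eq_square)
    finally show ?thesis
      by (simp add: u_def mult.assoc)
  qed
  show thesis
  proof (rule that[of K])
    fix x
    show "\<bar>bump_family c a b p k x\<bar> \<le> K * (x - a)\<^sup>2"
    proof (cases "a < x \<and> x < b")
      case True
      have "(b - x)\<^sup>2 \<le> (b - a)\<^sup>2"
        using True by (intro power_mono) auto
      then have "P * ?C * ((x - a)\<^sup>2 * (b - x)\<^sup>2) \<le> P * ?C * ((x - a)\<^sup>2 * (b - a)\<^sup>2)"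
        by (intro mult_left_mono PC) auto
      with main[of x] True show ?thesis
        by (simp add: K_def power_mult_distrib mult_ac)
    qed (use K0 in \<open>auto simp: bump_family_def\<close>)
    show "\<bar>bump_family c a b p k x\<bar> \<le> K * (x - b)\<^sup>2"
    proof (cases "a < x \<and> x < b")
      case True
      have "(x - a)\<^sup>2 \<le> (b - a)\<^sup>2"
        using True by (intro power_mono) auto
      then have "P * ?C * ((b - x)\<^sup>2 * (x - a)\<^sup>2) \<le> P * ?C * ((b - x)\<^sup>2 * (b - a)\<^sup>2)"
        by (intro mult_left_mono PC) auto
      with main[of x] True show ?thesis
        by (simp add: K_def power_mult_distrib mult_ac power2_commute[of x b])
    qed (use K0 in \<open>auto simp: bump_family_def\<close>)
  qed
qed

lemma DERIV_zero_quadratic: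
  fixes f :: "real \<Rightarrow> real"
  assumes "\<And>x. \<bar>f x\<bar> \<le> K * (x - z)\<^sup>2"
  shows "(f has_real_derivative 0) (at z)"
proof -
  have f0: "f z = 0"
    using assms[of z] by simp
  have "((\<lambda>h. (f (z + h) - f z) / h) \<longlongrightarrow> 0) (at 0)"
  proof (rule Lim_null_comparison)
    show "eventually (\<lambda>h. norm ((f (z + h) - f z) / h) \<le> K * \<bar>h\<bar>) (at 0)"
      unfolding eventually_at_filter
    proof (rule always_eventually, intro allI impI)
      fix h :: real assume "h \<noteq> 0"
      have "\<bar>f (z + h)\<bar> \<le> K * \<bar>h\<bar> * \<bar>h\<bar>"
        using assms[of "z + h"] by (simp add: power2_eq_square abs_mult_self_eq mult.assoc)
      with \<open>h \<noteq> 0\<close> show "norm ((f (z + h) - f z) / h) \<le> K * \<bar>h\<bar>"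
        by (simp add: f0 divide_le_eq)
    qed
    show "((\<lambda>h. K * \<bar>h\<bar>) \<longlongrightarrow> 0) (at 0)"
      by (auto intro!: tendsto_eq_intros)
  qed
  then show ?thesis
    by (simp add: DERIV_def)
qed

lemma DERIV_bump_family:
  assumes ab: "a < b" and c: "0 < c"
  shows "\<exists>q l. \<forall>x. (bump_family c a b p k has_real_derivative bump_family c a b q l x) (at x)"
proof -
  define U where "U = [:- a, 1:] * [:b, - 1:]"
  have U: "poly U x = (x - a) * (b - x)" for x
    by (simp add: U_def algebra_simps)
  \<comment> \<open>The numerator that the product and chain rules leave over the common denominator
    u^(k + 2), where u = (x - a) (b - x).\<close>
  define q where "q = pderiv p * U * U - smult (real k) (p * pderiv U * U) + smult c (p * pderiv U)"
  obtain K where K: "\<And>x. \<bar>bump_family c a b p k x\<bar> \<le> K * (x - a)\<^sup>2" "\<And>x. \<bar>bump_family c a b p k x\<bar> \<le> K * (x - b)\<^sup>2"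
    using bump_family_quadratic[OF ab c] by metis
  have "(bump_family c a b p k has_real_derivative bump_family c a b q (k + 2) x) (at x)" for x
  proof -
    consider "a < x \<and> x < b" | "x = a" | "x = b" | "x < a" | "b < x"
      by linarith
    then show ?thesis
    proof cases
      case 1
      then have u: "0 < poly U x"
        by (simp add: U)
      have "((\<lambda>x. poly p x / poly U x ^ k * exp (- (c / poly U x))) has_real_derivative
          (poly (pderiv p) x * poly U x ^ k - poly p x * (real k * (poly U x ^ (k - Suc 0) * poly (pderiv U) x))) / (poly U x ^ k * poly U x ^ k)
            * exp (- (c / poly U x))
          + poly p x / poly U x ^ k * (exp (- (c / poly U x)) * (c * poly (pderiv U) x / (poly U x * poly U x)))) (at x)"
        using u by (auto intro!: derivative_eq_intros simp: field_simps power2_eq_square)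
      also have "(poly (pderiv p) x * poly U x ^ k - poly p x * (real k * (poly U x ^ (k - Suc 0) * poly (pderiv U) x))) / (poly U x ^ k * poly U x ^ k)
            * exp (- (c / poly U x))
          + poly p x / poly U x ^ k * (exp (- (c / poly U x)) * (c * poly (pderiv U) x / (poly U x * poly U x)))
          = poly q x / poly U x ^ (k + 2) * exp (- (c / poly U x))"
        using u by (cases k) (auto simp: q_def field_simps power2_eq_square power_add)
      finally have D: "((\<lambda>x. poly p x / poly U x ^ k * exp (- (c / poly U x))) has_real_derivative
          poly q x / poly U x ^ (k + 2) * exp (- (c / poly U x))) (at x)" .
      have "(bump_family c a b p k has_real_derivative poly q x / poly U x ^ (k + 2) * exp (- (c / poly U x))) (at x)"
        by (rule has_field_derivative_transform_within_open[OF D, where S = "{a<..<b}"])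
           (use 1 in \<open>auto simp: bump_family_def U\<close>)
      with 1 show ?thesis
        by (simp add: bump_family_def U)
    next
      case 2
      then have "bump_family c a b q (k + 2) x = 0"
        by (simp add: bump_family_def)
      with 2 DERIV_zero_quadratic[OF K(1)] show ?thesis
        by simp
    next
      case 3
      then have "bump_family c a b q (k + 2) x = 0"
        by (simp add: bump_family_def)
      with 3 DERIV_zero_quadratic[OF K(2)] show ?thesis
        by simp
    next
      case 4
      have "(bump_family c a b p k has_real_derivative 0) (at x)"
        by (rule has_field_derivative_transform_within_open[of "\<lambda>_. 0", where S = "{..<a}"])
           (use 4 in \<open>auto simp: bump_family_def\<close>)
      with 4 show ?thesis
        by (simp add: bump_family_def)
    next
      case 5
      have "(bump_family c a b p k has_real_derivative 0) (at x)"
        by (rule has_field_derivative_transform_within_open[of "\<lambda>_. 0", where S = "{b<..}"])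
           (use 5 in \<open>auto simp: bump_family_def\<close>)
      with 5 show ?thesis
        by (simp add: bump_family_def)
    qed
  qed
  then show ?thesis
    by blast
qed

text \<open>All iterated derivatives stay in the family, so smoothness reduces to one
  differentiability statement for arbitrary \<open>p\<close> and \<open>k\<close>.\<close>

lemma test_function_bump:
  assumes "a < b" "0 < c"
  shows "test_function (bump_family c a b 1 0)"
proof -
  have iter: "\<exists>p k. (deriv ^^ n) (bump_family c a b 1 0) = bump_family c a b p k" for n
  proof (induction n)
    case 0
    show ?case
      by auto
  next
    case (Suc n)
    then obtain p k where pk: "(deriv ^^ n) (bump_family c a b 1 0) = bump_family c a b p k"
      by blast
    obtain q l where "\<And>x. (bump_family c a b p k has_real_derivative bump_family c a b q l x) (at x)"
      using DERIV_bump_family[OF assms] by blast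
    then have "deriv (bump_family c a b p k) = bump_family c a b q l"
      by (intro ext DERIV_imp_deriv)
    with pk show ?case
      by auto
  qed
  show ?thesis
    unfolding test_function_def
  proof (intro conjI allI)
    fix n x
    obtain p k where pk: "(deriv ^^ n) (bump_family c a b 1 0) = bump_family c a b p k"
      using iter by blast
    show "(deriv ^^ n) (bump_family c a b 1 0) differentiable at x"
      unfolding pk using DERIV_bump_family[OF assms, of p k] real_differentiable_def by blast
    show "\<exists>R. \<forall>x. \<bar>x\<bar> > R \<longrightarrow> bump_family c a b 1 0 x = 0"
      by (intro exI[of _ "\<bar>a\<bar> + \<bar>b\<bar>"]) (auto simp: bump_family_def)
  qed
qed

section \<open>Test functions determine a square integrable function\<close>

lemma integral_zero_intervals_AE:
  fixes d :: "real \<Rightarrow> real"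
  assumes int: "\<And>a b. integrable lborel (\<lambda>x. indicator {a..b} x * d x)"
    and zero: "\<And>a b. a < b \<Longrightarrow> (\<integral>x. indicator {a..b} x * d x \<partial>lborel) = 0"
  shows "AE x in lborel. d x = 0"
proof -
  have si: "set_integrable lborel {a..b} d" for a b
    using int by (simp add: set_integrable_def)
  have "d integrable_on cbox a b" for a b
    using set_borel_integral_eq_integral(1)[OF si] by simp
  \<comment> \<open>Lebesgue's differentiation theorem: off a negligible set the averages over
    intervals starting at x converge to the value at x. Here all averages are 0.\<close>
  then obtain N where N: "negligible N"
    and avg: "\<And>x e. x \<notin> N \<Longrightarrow> 0 < e \<Longrightarrow>
      \<exists>r>0. \<forall>h. 0 < h \<and> h < r \<longrightarrow> norm (integral (cbox x (x + h *\<^sub>R One)) d /\<^sub>R h ^ DIM(real) - d x) < e"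
    using integrable_ccontinuous_explicit[of d] by metis
  have "d x = 0" if xN: "x \<notin> N" for x
  proof (rule ccontr)
    assume "d x \<noteq> 0"
    then obtain r where r: "0 < r" "\<And>h. 0 < h \<Longrightarrow> h < r \<Longrightarrow> norm (integral (cbox x (x + h *\<^sub>R One)) d /\<^sub>R h ^ DIM(real) - d x) < \<bar>d x\<bar>"
      using avg[OF xN, of "\<bar>d x\<bar>"] by auto
    have "integral {x..x + r/2} d = 0"
      using set_borel_integral_eq_integral(2)[OF si, of x "x + r/2"] zero[of x "x + r/2"] r(1)
      by (simp add: set_lebesgue_integral_def)
    with r(2)[of "r/2"] r(1) show False
      by simp
  qed
  moreover have "AE x in lborel. x \<notin> N"
    using AE_not_in[of N lebesgue] N by (simp add: negligible_iff_null_sets AE_completion_iff)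
  ultimately show ?thesis
    by (auto elim: eventually_mono)
qed

text \<open>Bumps with c = 1 / (n + 1) lie between 0 and 1 and tend to the indicator of the interval
  off its endpoints. So \<open>d\<close> has zero integral over every interval.\<close>

lemma test_function_separating:
  assumes d: "d \<in> L2" and zero: "\<And>\<phi>. test_function \<phi> \<Longrightarrow> (\<integral>x. d x * \<phi> x \<partial>lborel) = 0"
  shows "AE x in lborel. d x = (0 :: real)"
proof (rule integral_zero_intervals_AE)
  note [measurable] = L2_measurable[OF d]
  show int: "integrable lborel (\<lambda>x. indicator {a..b} x * d x)" for a b
    by (rule L2_indicator(2)[OF d])
  fix a b :: real assume ab: "a < b"
  let ?\<phi> = "\<lambda>n. bump_family (1 / real (Suc n)) a b 1 0"
  have tf: "test_function (?\<phi> n)" for n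
    by (rule test_function_bump[OF ab]) simp
  then have [measurable]: "?\<phi> n \<in> borel_measurable borel" for n
  proof -
    have "continuous_on UNIV (?\<phi> n)"
      using tf[of n, unfolded test_function_def, THEN conjunct1, rule_format, of 0]
      by (auto simp: continuous_on_eq_continuous_at differentiable_imp_continuous_within)
    then show ?thesis
      by (rule borel_measurable_continuous_onI)
  qed
  have "(\<lambda>n. \<integral>x. d x * ?\<phi> n x \<partial>lborel) \<longlonglongrightarrow> (\<integral>x. indicator {a..b} x * d x \<partial>lborel)"
  proof (rule integral_dominated_convergence[where w = "\<lambda>x. norm (indicator {a..b} x * d x)"])
    show "AE x in lborel. norm (d x * ?\<phi> n x) \<le> norm (indicator {a..b} x * d x)" for n
      by (intro AE_I2) (auto simp: bump_family_def abs_mult indicator_def intro!: mult_left_le)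
    show "AE x in lborel. (\<lambda>n. d x * ?\<phi> n x) \<longlonglongrightarrow> indicator {a..b} x * d x"
      using AE_lborel_singleton[of a] AE_lborel_singleton[of b]
    proof eventually_elim
      case (elim x)
      show ?case
      proof (cases "a < x \<and> x < b")
        case True
        have "(\<lambda>n. d x * exp (- (1 / real (Suc n) * (1 / ((x - a) * (b - x)))))) \<longlonglongrightarrow> d x * exp (- (0 * (1 / ((x - a) * (b - x)))))"
          by (intro tendsto_intros LIMSEQ_Suc[OF lim_1_over_n])
        with True show ?thesis
          by (simp add: bump_family_def indicator_def)
      next
        case False
        with elim have "x \<notin> {a..b}"
          by auto
        with False show ?thesis
          by (auto simp: bump_family_def)
      qed
    qed
    show "(\<lambda>x. d x * ?\<phi> n x) \<in> borel_measurable lborel" for n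
      by measurable
  qed (use int in auto)
  then show "(\<integral>x. indicator {a..b} x * d x \<partial>lborel) = 0"
    using zero[OF tf] by (simp add: LIMSEQ_const_iff)
qed

lemma test_function_DERIV:
  assumes "test_function \<phi>"
  shows "(\<phi> has_real_derivative deriv \<phi> x) (at x)"
  using assms[unfolded test_function_def, THEN conjunct1, rule_format, of 0 x]
  by (simp add: DERIV_deriv_iff_real_differentiable)

lemma test_function_deriv:
  assumes tf: "test_function \<phi>"
  shows "test_function (deriv \<phi>)"
proof -
  from tf obtain R where R: "\<And>x. \<bar>x\<bar> > R \<Longrightarrow> \<phi> x = 0"
    by (auto simp: test_function_def)
  have "deriv \<phi> x = 0" if "\<bar>x\<bar> > R" for x
  proof -
    have "(\<phi> has_real_derivative 0) (at x)"
      by (rule has_field_derivative_transform_within_open[of "\<lambda>_. 0", where S = "{x. \<bar>x\<bar> > R}"])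
         (use that R in \<open>auto intro!: open_Collect_less continuous_intros\<close>)
    then show ?thesis
      by (rule DERIV_imp_deriv)
  qed
  moreover have "(deriv ^^ n) (deriv \<phi>) differentiable at x" for n x
    using tf[unfolded test_function_def, THEN conjunct1, rule_format, of "Suc n" x] by (simp add: funpow_swap1)
  ultimately show ?thesis
    unfolding test_function_def by blast
qed

lemma test_function_bounded_L2:
  assumes tf: "test_function \<phi>"
  obtains B where "\<phi> \<in> L2" "\<And>x. \<bar>\<phi> x\<bar> \<le> B"
proof -
  from tf obtain R where R: "\<And>x. \<bar>x\<bar> > R \<Longrightarrow> \<phi> x = 0"
    by (auto simp: test_function_def)
  have c: "continuous_on UNIV \<phi>"
    using test_function_DERIV[OF tf] by (meson DERIV_isCont continuous_at_imp_continuous_on)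
  have "bounded (\<phi> ` {-R..R})"
    by (intro compact_imp_bounded compact_continuous_image continuous_on_subset[OF c]) auto
  then obtain B where B: "\<And>x. x \<in> {-R..R} \<Longrightarrow> \<bar>\<phi> x\<bar> \<le> B"
    unfolding bounded_iff by (metis imageI real_norm_def)
  have B': "\<bar>\<phi> x\<bar> \<le> max B 0" for x
  proof (cases "\<bar>x\<bar> > R")
    case False
    then have "x \<in> {-R..R}"
      by (simp add: abs_le_iff not_less)
    from B[OF this] show ?thesis
      by simp
  qed (simp add: R)
  show thesis
  proof (rule that)
    show "\<phi> \<in> L2"
      by (rule L2_compact_support(1)[where B = "max B 0" and R = R])
         (use B' R borel_measurable_continuous_onI[OF c] in simp_all)
  qed (rule B')
qed

text \<open>Since \<open>Qk \<phi>'' = Qk \<phi> - \<phi>\<close>, symmetry of \<open>Qk\<close> gives \<open>\<integral> Qk w \<phi>'' = \<integral> (Qk w - w) \<phi>\<close>.\<close>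

lemma weak_deriv2_AE:
  assumes w: "w \<in> L2" and g: "g \<in> L2" and eq: "AE x in lborel. g x = Qk w x"
  shows "weak_deriv2 g \<in> L2" and "AE x in lborel. weak_deriv2 g x = Qk w x - w x"
proof -
  note [measurable] = L2_measurable[OF w] L2_measurable[OF g]
  let ?P = "\<lambda>h. h \<in> L2 \<and> (\<forall>\<phi>. test_function \<phi> \<longrightarrow>
        (\<integral>x. g x * deriv (deriv \<phi>) x \<partial>lborel) = (\<integral>x. h x * \<phi> x \<partial>lborel))"
  have h: "(\<lambda>x. Qk w x - w x) \<in> L2"
    by (rule L2_diff(1)[OF Qk_L2[OF w] w])
  have P: "?P (\<lambda>x. Qk w x - w x)"
  proof (intro conjI allI impI h)
    fix \<phi> assume tf: "test_function \<phi>"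
    obtain B where \<phi>: "\<phi> \<in> L2" and B: "\<And>x. \<bar>\<phi> x\<bar> \<le> B"
      using test_function_bounded_L2[OF tf] by metis
    obtain B' where \<phi>': "deriv \<phi> \<in> L2" and B': "\<And>x. \<bar>deriv \<phi> x\<bar> \<le> B'"
      using test_function_bounded_L2[OF test_function_deriv[OF tf]] by metis
    obtain B'' where \<phi>'': "deriv (deriv \<phi>) \<in> L2" and B'': "\<And>x. \<bar>deriv (deriv \<phi>) x\<bar> \<le> B''"
      using test_function_bounded_L2[OF test_function_deriv[OF test_function_deriv[OF tf]]] by metis
    note [measurable] = L2_measurable[OF \<phi>] L2_measurable[OF \<phi>'']
    \<comment> \<open>Both formulas of \<open>kernel_by_parts\<close> in turn, the first for the
      derivative of \<phi>, the second for \<phi> itself.\<close>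
    have Q: "Qk (deriv (deriv \<phi>)) z = Qk \<phi> z - \<phi> z" for z
    proof -
      have "Qk (deriv (deriv \<phi>)) z = Nk (deriv \<phi>) z"
        by (rule kernel_by_parts(1)[OF test_function_DERIV[OF test_function_deriv[OF tf]] B'],
            rule integrable_conv[OF resolvent_kernel_L2(1) \<phi>'']) simp
      also have "\<dots> = Qk \<phi> z - \<phi> z"
        by (rule kernel_by_parts(2)[OF test_function_DERIV[OF tf] B],
            rule integrable_conv[OF resolvent_kernel_L2(1) \<phi>']) simp
      finally show ?thesis .
    qed
    have "(\<integral>x. g x * deriv (deriv \<phi>) x \<partial>lborel) = (\<integral>x. Qk w x * deriv (deriv \<phi>) x \<partial>lborel)"
    proof (rule integral_cong_AE)
      show "AE x in lborel. g x * deriv (deriv \<phi>) x = Qk w x * deriv (deriv \<phi>) x"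
        using eq by eventually_elim simp
    qed measurable
    also have "\<dots> = (\<integral>x. w x * Qk (deriv (deriv \<phi>)) x \<partial>lborel)"
      by (rule Qk_symmetric[OF w \<phi>''])
    also have "\<dots> = (\<integral>x. w x * Qk \<phi> x \<partial>lborel) - (\<integral>x. w x * \<phi> x \<partial>lborel)"
      unfolding Q using L2_integrable_mult(1)[OF w Qk_L2[OF \<phi>]] L2_integrable_mult(1)[OF w \<phi>]
      by (simp add: right_diff_distrib)
    also have "\<dots> = (\<integral>x. Qk w x * \<phi> x \<partial>lborel) - (\<integral>x. w x * \<phi> x \<partial>lborel)"
      by (simp only: Qk_symmetric[OF w \<phi>])
    also have "\<dots> = (\<integral>x. (Qk w x - w x) * \<phi> x \<partial>lborel)"
      using L2_integrable_mult(1)[OF Qk_L2[OF w] \<phi>] L2_integrable_mult(1)[OF w \<phi>]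
      by (simp add: left_diff_distrib)
    finally show "(\<integral>x. g x * deriv (deriv \<phi>) x \<partial>lborel) = (\<integral>x. (Qk w x - w x) * \<phi> x \<partial>lborel)" .
  qed
  have P': "?P (weak_deriv2 g)"
    unfolding weak_deriv2_def by (rule someI[of ?P, OF P])
  then show L: "weak_deriv2 g \<in> L2"
    by blast
  \<comment> \<open>Uniqueness: the chosen derivative and the explicit one have the same integrals
    against all test functions.\<close>
  have "AE x in lborel. weak_deriv2 g x - (Qk w x - w x) = 0"
  proof (rule test_function_separating[OF L2_diff(1)[OF L h]])
    fix \<phi> assume tf: "test_function \<phi>"
    obtain B where \<phi>: "\<phi> \<in> L2"
      using test_function_bounded_L2[OF tf] by metis
    have "(\<integral>x. (weak_deriv2 g x - (Qk w x - w x)) * \<phi> x \<partial>lborel)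
        = (\<integral>x. weak_deriv2 g x * \<phi> x - (Qk w x - w x) * \<phi> x \<partial>lborel)"
      by (intro Bochner_Integration.integral_cong refl left_diff_distrib)
    also have "\<dots> = (\<integral>x. weak_deriv2 g x * \<phi> x \<partial>lborel) - (\<integral>x. (Qk w x - w x) * \<phi> x \<partial>lborel)"
      by (rule Bochner_Integration.integral_diff[OF L2_integrable_mult(1)[OF L \<phi>] L2_integrable_mult(1)[OF h \<phi>]])
    also have "\<dots> = 0"
      using P[THEN conjunct2, rule_format, OF tf] P'[THEN conjunct2, rule_format, OF tf] by linarith
    finally show "(\<integral>x. (weak_deriv2 g x - (Qk w x - w x)) * \<phi> x \<partial>lborel) = 0" .
  qed
  then show "AE x in lborel. weak_deriv2 g x = Qk w x - w x"
    by simp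
qed

section \<open>Power series solution of the reduced equation\<close>

text \<open>Comparison of the coefficients of t^n in the reduced equation: the quadratic term
  becomes a Cauchy product, and the time derivative causes the division by n + 1. The recursion is
  imposed at every point, not just almost everywhere.\<close>

fun coeff_seq :: "(real \<Rightarrow> real) \<Rightarrow> nat \<Rightarrow> real \<Rightarrow> real" where
  "coeff_seq w0 0 = w0"
| "coeff_seq w0 (Suc n) = (\<lambda>z. 1 / real (Suc n) *
     (- 2 * Nk (coeff_seq w0 n) z
      + (- 2) * (\<Sum>k\<le>n. coeff_seq w0 k z * Nk (Qk (coeff_seq w0 (n - k))) z)))"

declare coeff_seq.simps(2) [simp del]

text \<open>The Cauchy product has n + 1 summands of equal bound, and the division by n + 1
  compensates their number. The growth therefore stays geometric.\<close>

lemma coeff_seq_bound: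
  fixes w0 :: "real \<Rightarrow> real"
  assumes w0: "w0 \<in> L2"
  defines "A \<equiv> l2norm w0"
  defines "M \<equiv> 2 * (1 + A)"
  shows "coeff_seq w0 n \<in> L2 \<and> l2norm (coeff_seq w0 n) \<le> A * M ^ n"
proof (induction n rule: less_induct)
  case (less n)
  have A: "0 \<le> A"
    by (simp add: A_def)
  have M: "0 \<le> M"
    using A by (simp add: M_def)
  show ?case
  proof (cases n)
    case 0
    with w0 show ?thesis
      by (simp add: A_def)
  next
    case (Suc m)
    let ?c = "coeff_seq w0"
    have c: "?c k \<in> L2" "l2norm (?c k) \<le> A * M ^ k" if "k \<le> m" for k
      using less.IH[of k] that Suc by auto
    have summand: "(\<lambda>z. ?c k z * Nk (Qk (?c (m - k))) z) \<in> L2"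
      "l2norm (\<lambda>z. ?c k z * Nk (Qk (?c (m - k))) z) \<le> A\<^sup>2 * M ^ m" if k: "k \<le> m" for k
    proof -
      have mk: "?c (m - k) \<in> L2" "l2norm (?c (m - k)) \<le> A * M ^ (m - k)"
        using c[of "m - k"] by simp_all
      have b: "\<bar>Nk (Qk (?c (m - k))) z\<bar> \<le> A * M ^ (m - k)" for z
        using Nk_bound[OF Qk_L2[OF mk(1)], of z] Qk_norm[OF mk(1)] mk(2) by linarith
      have meas: "Nk (Qk (?c (m - k))) \<in> borel_measurable borel"
        by (intro L2_measurable Nk_L2 Qk_L2 mk)
      from L2_mult_bounded(1)[OF c(1)[OF k] meas b] show "(\<lambda>z. ?c k z * Nk (Qk (?c (m - k))) z) \<in> L2" .
      have "l2norm (\<lambda>z. ?c k z * Nk (Qk (?c (m - k))) z) \<le> l2norm (?c k) * (A * M ^ (m - k))"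
        by (rule L2_mult_bounded(2)[OF c(1)[OF k] meas b])
      also have "\<dots> \<le> A * M ^ k * (A * M ^ (m - k))"
        using A M by (intro mult_right_mono c(2) k) simp
      also have "\<dots> = A\<^sup>2 * M ^ m"
        using k by (simp add: power2_eq_square flip: power_add)
      finally show "l2norm (\<lambda>z. ?c k z * Nk (Qk (?c (m - k))) z) \<le> A\<^sup>2 * M ^ m" .
    qed
    let ?S = "\<lambda>z. \<Sum>k\<le>m. ?c k z * Nk (Qk (?c (m - k))) z"
    have S: "?S \<in> L2" "l2norm ?S \<le> real (Suc m) * (A\<^sup>2 * M ^ m)"
    proof -
      have *: "?S \<in> L2 \<and> l2norm ?S \<le> (\<Sum>k\<le>m. l2norm (\<lambda>z. ?c k z * Nk (Qk (?c (m - k))) z))"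
        by (rule L2_sum) (auto intro: summand)
      have "(\<Sum>k\<le>m. l2norm (\<lambda>z. ?c k z * Nk (Qk (?c (m - k))) z)) \<le> (\<Sum>k\<le>m. A\<^sup>2 * M ^ m)"
        by (intro sum_mono summand) simp
      with * show "?S \<in> L2" "l2norm ?S \<le> real (Suc m) * (A\<^sup>2 * M ^ m)"
        by simp_all
    qed
    let ?R = "\<lambda>z. - 2 * Nk (?c m) z + (- 2) * ?S z"
    have N: "Nk (?c m) \<in> L2" "l2norm (Nk (?c m)) \<le> A * M ^ m"
      using Nk_L2[OF c(1)] Nk_norm[OF c(1)] c(2)[of m] by (auto intro: order_trans)
    have R: "?R \<in> L2"
      by (intro L2_add(1) L2_scale(1) N S)
    have "l2norm ?R \<le> l2norm (\<lambda>z. - 2 * Nk (?c m) z) + l2norm (\<lambda>z. (- 2) * ?S z)"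
      by (intro L2_add(2) L2_scale(1) N S)
    also have "\<dots> = 2 * l2norm (Nk (?c m)) + 2 * l2norm ?S"
      by (simp only: L2_scale(2)[OF N(1)] L2_scale(2)[OF S(1)]) simp
    also have "\<dots> \<le> 2 * (A * M ^ m) + 2 * (real (Suc m) * (A\<^sup>2 * M ^ m))"
      using N(2) S(2) by (intro add_mono mult_left_mono) auto
    \<comment> \<open>The linear term is enlarged by the factor \<open>Suc m\<close> so that it can
      be joined with the quadratic one; then 2 A + 2 A^2 = A M closes the induction.\<close>
    also have "\<dots> \<le> 2 * (real (Suc m) * (A * M ^ m)) + 2 * (real (Suc m) * (A\<^sup>2 * M ^ m))"
      using A M mult_right_mono[of 1 "real (Suc m)" "A * M ^ m"] by simp
    also have "\<dots> = real (Suc m) * (A * M ^ Suc m)"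
      by (simp add: M_def power2_eq_square algebra_simps)
    finally have le: "l2norm ?R \<le> real (Suc m) * (A * M ^ Suc m)" .
    have cn: "?c n = (\<lambda>z. 1 / real (Suc m) * ?R z)"
      by (simp only: Suc coeff_seq.simps(2))
    have "l2norm (?c n) = 1 / real (Suc m) * l2norm ?R"
      unfolding cn L2_scale(2)[OF R] by simp
    also have "\<dots> \<le> A * M ^ n"
      using le by (simp add: Suc divide_le_eq mult_ac)
    finally show ?thesis
      using L2_scale(1)[OF R, of "1 / real (Suc m)"] by (simp only: cn)
  qed
qed

text \<open>Termwise integration at a fixed point. Because \<open>k\<close> is in L2, the integrals
  of the terms are at most \<open>l2norm k * l2norm (f n)\<close>, so the series converges at every
  \<open>z\<close> although that of \<open>f\<close> converges only almost everywhere.\<close>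

lemma conv_series:
  assumes k: "k \<in> L2" and f: "\<And>n. f n \<in> L2" and sum: "summable (\<lambda>n. l2norm (f n))"
  shows "(\<lambda>n. conv k (f n) z) sums conv k (\<lambda>x. \<Sum>n. f n x) z"
    and "summable (\<lambda>n. norm (conv k (f n) z))"
proof -
  note [measurable] = L2_measurable[OF k] L2_measurable[OF f] L2_measurable[OF L2_series(2)[OF f sum]]
  have kz: "(\<lambda>y. k (z - y)) \<in> L2" "l2norm (\<lambda>y. k (z - y)) = l2norm k"
    using L2_reflect_shift[OF k] by auto
  have sk: "summable (\<lambda>n. l2norm k * l2norm (f n))"
    by (intro summable_mult sum)
  show "summable (\<lambda>n. norm (conv k (f n) z))"
    using conv_bound[OF k f] by (intro summable_comparison_test'[OF sk]) auto
  have ae: "AE y in lborel. summable (\<lambda>n. norm (k (z - y) * f n y))"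
    using L2_series(1)[OF f sum] by eventually_elim (simp add: abs_mult summable_mult)
  have "(\<lambda>n. \<integral>y. k (z - y) * f n y \<partial>lborel) sums (\<integral>y. (\<Sum>n. k (z - y) * f n y) \<partial>lborel)"
  proof (rule sums_integral)
    show "integrable lborel (\<lambda>y. k (z - y) * f n y)" for n
      by (rule integrable_conv[OF k f])
    show "summable (\<lambda>n. \<integral>y. norm (k (z - y) * f n y) \<partial>lborel)"
    proof (rule summable_comparison_test'[OF sk])
      show "norm (\<integral>y. norm (k (z - y) * f n y) \<partial>lborel) \<le> l2norm k * l2norm (f n)" for n
        using L2_Cauchy_Schwarz(2)[OF kz(1) f, of n] by (simp add: kz(2) abs_mult)
    qed
  qed (rule ae)
  also have "(\<integral>y. (\<Sum>n. k (z - y) * f n y) \<partial>lborel) = conv k (\<lambda>x. \<Sum>n. f n x) z"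
    unfolding conv_def
  proof (rule integral_cong_AE)
    show "AE y in lborel. (\<Sum>n. k (z - y) * f n y) = k (z - y) * (\<Sum>n. f n y)"
      using L2_series(1)[OF f sum] by eventually_elim (simp add: suminf_mult summable_norm_cancel)
  qed measurable
  finally show "(\<lambda>n. conv k (f n) z) sums conv k (\<lambda>x. \<Sum>n. f n x) z"
    by (simp add: conv_def)
qed

lemma Nk_Qk_series:
  assumes f: "\<And>n. f n \<in> L2" and sum: "summable (\<lambda>n. l2norm (f n))"
  shows "(\<lambda>n. Nk (Qk (f n)) z) sums Nk (Qk (\<lambda>x. \<Sum>n. f n x)) z"
    and "summable (\<lambda>n. norm (Nk (Qk (f n)) z))"
proof -
  have sQ: "summable (\<lambda>n. l2norm (Qk (f n)))"
    using Qk_norm[OF f] by (intro summable_comparison_test'[OF sum]) auto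
  have "Qk (\<lambda>x. \<Sum>n. f n x) = (\<lambda>x. \<Sum>n. Qk (f n) x)"
    using conv_series(1)[OF resolvent_kernel_L2(1) f sum, of 1] by (intro ext) (simp add: sums_iff)
  then show "(\<lambda>n. Nk (Qk (f n)) z) sums Nk (Qk (\<lambda>x. \<Sum>n. f n x)) z"
    using conv_series(1)[OF gradient_kernel_integrable(3) Qk_L2[OF f] sQ, of z] by simp
  show "summable (\<lambda>n. norm (Nk (Qk (f n)) z))"
    by (rule conv_series(2)[OF gradient_kernel_integrable(3) Qk_L2[OF f] sQ])
qed

text \<open>Differentiability in L2 is stated as a linear rate with uniform \<open>K\<close>, from
  which continuity and differentiability of the H2 curve follow directly. The equation is checked at
  those points where the power series converges absolutely, hence almost everywhere.\<close>

lemma reduced_equation_solution: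
  assumes w0: "w0 \<in> L2"
  shows "\<exists>T>0. \<exists>W W' :: real \<Rightarrow> real \<Rightarrow> real. \<exists>K. W 0 = w0 \<and>
    (\<forall>t\<in>{0..T}. W t \<in> L2 \<and> W' t \<in> L2 \<and>
      (\<forall>s\<in>{0..T}. s \<noteq> t \<longrightarrow> l2norm (\<lambda>z. (W s z - W t z) / (s - t) - W' t z) \<le> K * \<bar>s - t\<bar>) \<and>
      (AE z in lborel. W' t z = - 2 * Nk (W t) z - 2 * (W t z * Nk (Qk (W t)) z)))"
proof -
  let ?c = "coeff_seq w0"
  define A M where "A = l2norm w0" and "M = 2 * (1 + A)"
  \<comment> \<open>The factor 8 leaves room for two derivatives: n is at most 2^n, used twice, and
    4^n / 8^n is still geometric.\<close>
  define T where "T = 1 / (8 * M)"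
  have A: "0 \<le> A"
    by (simp add: A_def)
  have M: "2 \<le> M"
    using A by (simp add: M_def)
  have T: "0 < T" "8 * T * M = 1"
    using M by (simp_all add: T_def)
  have c: "?c n \<in> L2" and cb: "l2norm (?c n) \<le> A * M ^ n" for n
    using coeff_seq_bound[OF w0, of n] by (simp_all add: A_def M_def)
  have TM: "T ^ n * M ^ n = (1 / 8) ^ n" for n
  proof -
    have "T * M = 1 / 8"
      using T(2) by linarith
    then show ?thesis
      by (simp only: power_mult_distrib[symmetric])
  qed
  have two: "real n \<le> 2 ^ n" for n
    using of_nat_less_two_power[of n, where 'a = real] by linarith
  have geo: "summable (\<lambda>n. C * (1 / 2) ^ n)" for C :: real
    by (intro summable_mult summable_geometric) simp
  \<comment> \<open>For n = m + 2 the second-order term is at most 4^n (1/8)^m M^2 A = 16 M^2 A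
    (1/2)^m, which is 64 M^2 A (1/2)^n. The same constant serves for the first derivative.\<close>
  define K where "K = 64 * M\<^sup>2 * A"
  have K1: "\<bar>real n * (real (n - Suc 0) * T ^ (n - 2))\<bar> * l2norm (?c n) \<le> K * (1 / 2) ^ n" for n
  proof (cases "n < 2")
    case True
    then have "n = 0 \<or> n = 1"
      by auto
    then show ?thesis
      using A M by (auto simp: K_def)
  next
    case False
    then obtain m where m: "n = m + 2"
      by (metis add.commute le_Suc_ex not_less)
    have "\<bar>real n * (real (n - Suc 0) * T ^ (n - 2))\<bar> = real n * (real (n - Suc 0) * T ^ m)"
      using T(1) m by (simp add: abs_mult)
    also have "\<dots> \<le> 2 ^ n * (2 ^ n * T ^ m)"
      using T(1) order_trans[OF two[of "n - Suc 0"] power_increasing[of "n - Suc 0" n "2 :: real"]]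
      by (intro mult_mono two) auto
    finally have "\<bar>real n * (real (n - Suc 0) * T ^ (n - 2))\<bar> * l2norm (?c n) \<le> 2 ^ n * (2 ^ n * T ^ m) * (A * M ^ n)"
      using T(1) by (intro mult_mono cb) auto
    also have "\<dots> = 4 ^ n * (T ^ m * M ^ m) * (A * M\<^sup>2)"
    proof -
      have "4 ^ n = 2 ^ n * (2 ^ n :: real)"
        by (simp flip: power_mult_distrib)
      moreover have "M ^ n = M ^ m * M\<^sup>2"
        by (simp add: m power_add power2_eq_square)
      ultimately show ?thesis
        by (simp only: mult_ac)
    qed
    also have "\<dots> = 16 * (1 / 2) ^ m * (A * M\<^sup>2)"
      unfolding TM m by (simp add: power_add flip: power_mult_distrib)
    also have "\<dots> = K * (1 / 2) ^ n"
      by (simp add: m K_def power_add)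
    finally show ?thesis .
  qed
  have K2: "\<bar>real n * T ^ (n - Suc 0)\<bar> * l2norm (?c n) \<le> K * (1 / 2) ^ n" for n
  proof (cases n)
    case (Suc m)
    have "\<bar>real n * T ^ (n - Suc 0)\<bar> * l2norm (?c n) \<le> 2 ^ n * T ^ m * (A * M ^ n)"
      using two[of n] T(1) A M cb[of n] Suc by (intro mult_mono) (auto simp: abs_mult intro!: mult_mono)
    also have "\<dots> = 2 ^ n * (T ^ m * M ^ m) * (A * M)"
      by (simp add: Suc mult_ac)
    also have "\<dots> = 2 * (1 / 4) ^ m * (A * M)"
      unfolding TM Suc by (simp flip: power_mult_distrib)
    also have "\<dots> \<le> 2 * (1 / 2) ^ m * (A * (16 * M\<^sup>2))"
    proof (intro mult_mono)
      have "M * 1 \<le> M * (16 * M)"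
        using M by (intro mult_left_mono) auto
      then show "M \<le> 16 * M\<^sup>2"
        by (simp add: power2_eq_square mult_ac)
      show "(1 / 4) ^ m \<le> ((1 / 2) ^ m :: real)"
        by (intro power_mono) auto
    qed (use A M in auto)
    also have "\<dots> = K * (1 / 2) ^ n"
      by (simp add: Suc K_def)
    finally show ?thesis .
  qed (use A M in \<open>simp add: K_def\<close>)
  have K0: "\<bar>t ^ n\<bar> * l2norm (?c n) \<le> A * (1 / 2) ^ n" if t: "t \<in> {0..T}" for t n
  proof -
    have "\<bar>t ^ n\<bar> * l2norm (?c n) \<le> T ^ n * (A * M ^ n)"
      using t cb[of n] A M by (intro mult_mono) (auto intro: power_mono)
    also have "\<dots> = A * (1 / 8) ^ n"
      using TM[of n] by (simp add: mult_ac)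
    also have "\<dots> \<le> A * (1 / 2) ^ n"
      using A by (intro mult_left_mono power_mono) auto
    finally show ?thesis .
  qed
  \<comment> \<open>One statement for every scalar weight \<alpha> with a geometric bound. It is
    used for t^n, for its derivative, and for the remainder of the difference quotient.\<close>
  have ser: "AE z in lborel. summable (\<lambda>n. norm (\<alpha> n * ?c n z))" "(\<lambda>z. \<Sum>n. \<alpha> n * ?c n z) \<in> L2"
    "l2norm (\<lambda>z. \<Sum>n. \<alpha> n * ?c n z) \<le> C * 2" "summable (\<lambda>n. l2norm (\<lambda>z. \<alpha> n * ?c n z))"
    if \<alpha>: "\<And>n. \<bar>\<alpha> n\<bar> * l2norm (?c n) \<le> C * (1 / 2) ^ n" for \<alpha> C
  proof -
    have L: "(\<lambda>z. \<alpha> n * ?c n z) \<in> L2" for n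
      by (rule L2_scale(1)[OF c])
    have le: "l2norm (\<lambda>z. \<alpha> n * ?c n z) \<le> C * (1 / 2) ^ n" for n
      using \<alpha>[of n] by (simp add: L2_scale(2)[OF c])
    show sm: "summable (\<lambda>n. l2norm (\<lambda>z. \<alpha> n * ?c n z))"
      by (rule summable_comparison_test'[OF geo[of C]]) (use le in simp)
    note * = L2_series[OF L sm]
    show "AE z in lborel. summable (\<lambda>n. norm (\<alpha> n * ?c n z))" "(\<lambda>z. \<Sum>n. \<alpha> n * ?c n z) \<in> L2"
      using * by auto
    have "(\<Sum>n. l2norm (\<lambda>z. \<alpha> n * ?c n z)) \<le> (\<Sum>n. C * (1 / 2) ^ n)"
      by (intro suminf_le le sm geo)
    also have "\<dots> = C * 2"
      by (subst suminf_mult) (simp_all add: suminf_geometric)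
    finally show "l2norm (\<lambda>z. \<Sum>n. \<alpha> n * ?c n z) \<le> C * 2"
      using *(3) by linarith
  qed
  define W where "W t z = (\<Sum>n. t ^ n * ?c n z)" for t z
  \<comment> \<open>The termwise derivative. At n = 0 the truncated exponent is harmless because the
    factor \<open>real n\<close> vanishes.\<close>
  define W' where "W' t z = (\<Sum>n. (real n * t ^ (n - Suc 0)) * ?c n z)" for t z
  have d1: "\<bar>real n * t ^ (n - Suc 0)\<bar> * l2norm (?c n) \<le> K * (1 / 2) ^ n" if t: "t \<in> {0..T}" for t n
  proof -
    have "\<bar>real n * t ^ (n - Suc 0)\<bar> * l2norm (?c n) \<le> \<bar>real n * T ^ (n - Suc 0)\<bar> * l2norm (?c n)"
      using t by (intro mult_right_mono) (auto simp: abs_mult intro!: mult_left_mono power_mono)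
    with K2[of n] show ?thesis
      by linarith
  qed
  have W0: "W 0 = w0"
  proof
    fix z
    \<comment> \<open>Only the term n = 0 survives, as 0 ^ 0 = 1.\<close>
    have "(\<lambda>n. 0 ^ n * ?c n z) sums (\<Sum>n\<in>{0}. 0 ^ n * ?c n z)"
      by (rule sums_finite) auto
    then show "W 0 z = w0 z"
      by (simp add: W_def sums_iff)
  qed
  have main: "W t \<in> L2 \<and> W' t \<in> L2 \<and>
      (\<forall>s\<in>{0..T}. s \<noteq> t \<longrightarrow> l2norm (\<lambda>z. (W s z - W t z) / (s - t) - W' t z) \<le> 2 * K * \<bar>s - t\<bar>) \<and>
      (AE z in lborel. W' t z = - 2 * Nk (W t) z - 2 * (W t z * Nk (Qk (W t)) z))" if t: "t \<in> {0..T}" for t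
  proof (intro conjI ballI impI)
    show W: "W t \<in> L2" "W' t \<in> L2"
      unfolding W_def W'_def using ser(2)[OF K0[OF t]] ser(2)[OF d1[OF t]] by auto
    fix s assume s: "s \<in> {0..T}" and st: "s \<noteq> t"
    \<comment> \<open>The error of the difference quotient of t^n, at most n (n - 1) T^(n - 2)
      \<bar>s - t\<bar> by Taylor's estimate. Summing these errors gives the linear rate.\<close>
    let ?a = "\<lambda>n. (s ^ n - t ^ n) / (s - t) - real n * t ^ (n - Suc 0)"
    have a: "\<bar>?a n\<bar> * l2norm (?c n) \<le> (K * \<bar>s - t\<bar>) * (1 / 2) ^ n" for n
    proof -
      have "\<bar>?a n\<bar> \<le> real n * real (n - Suc 0) * T ^ (n - 2) * \<bar>s - t\<bar>"
        using lemma_termdiff3[of "s - t" t T n] s t st by simp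
      then have "\<bar>?a n\<bar> * l2norm (?c n) \<le> \<bar>real n * (real (n - Suc 0) * T ^ (n - 2))\<bar> * l2norm (?c n) * \<bar>s - t\<bar>"
        using T(1) mult_right_mono[of "\<bar>?a n\<bar>" "real n * real (n - Suc 0) * T ^ (n - 2) * \<bar>s - t\<bar>" "l2norm (?c n)"]
        by (simp add: mult_ac abs_mult)
      also have "\<dots> \<le> K * (1 / 2) ^ n * \<bar>s - t\<bar>"
        by (intro mult_right_mono K1) simp
      finally show ?thesis
        by (simp add: mult_ac)
    qed
    have ae: "AE z in lborel. (W s z - W t z) / (s - t) - W' t z = (\<Sum>n. ?a n * ?c n z)"
      using ser(1)[OF K0[OF s]] ser(1)[OF K0[OF t]] ser(1)[OF d1[OF t]]
    proof eventually_elim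
      case (elim z)
      note sm = elim[THEN summable_norm_cancel]
      have "(W s z - W t z) / (s - t) - W' t z
          = (\<Sum>n. (s ^ n * ?c n z - t ^ n * ?c n z) / (s - t) - real n * t ^ (n - Suc 0) * ?c n z)"
        unfolding W_def W'_def
        by (simp only: suminf_diff[OF sm(1,2)] suminf_divide[OF summable_diff[OF sm(1,2)], symmetric]
            suminf_diff[OF summable_divide[OF summable_diff[OF sm(1,2)]] sm(3)])
      also have "\<dots> = (\<Sum>n. ?a n * ?c n z)"
        by (intro suminf_cong) (simp add: left_diff_distrib diff_divide_distrib)
      finally show ?case .
    qed
    have "W s \<in> L2"
      unfolding W_def using ser(2)[OF K0[OF s]] by auto
    with W have [measurable]: "W s \<in> borel_measurable borel" "W t \<in> borel_measurable borel" "W' t \<in> borel_measurable borel"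
      by (auto simp: L2_measurable)
    have "l2norm (\<lambda>z. (W s z - W t z) / (s - t) - W' t z) = l2norm (\<lambda>z. \<Sum>n. ?a n * ?c n z)"
      by (rule L2_cong_AE(2)[OF _ ser(2)[OF a] ae]) measurable
    also have "\<dots> \<le> 2 * K * \<bar>s - t\<bar>"
      using ser(3)[OF a] by (simp add: mult_ac)
    finally show "l2norm (\<lambda>z. (W s z - W t z) / (s - t) - W' t z) \<le> 2 * K * \<bar>s - t\<bar>" .
  next
    let ?f = "\<lambda>n z. t ^ n * ?c n z"
    have f: "?f n \<in> L2" for n
      by (rule L2_scale(1)[OF c])
    note smf = ser(4)[OF K0[OF t]]
    have Wt: "W t = (\<lambda>z. \<Sum>n. ?f n z)"
      by (simp add: W_def fun_eq_iff)
    show "AE z in lborel. W' t z = - 2 * Nk (W t) z - 2 * (W t z * Nk (Qk (W t)) z)"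
      using ser(1)[OF K0[OF t]]
    proof eventually_elim
      case (elim z)
      have N: "(\<lambda>n. t ^ n * Nk (?c n) z) sums Nk (W t) z"
        using conv_series(1)[OF gradient_kernel_integrable(3) f smf, of z] by (simp add: Wt conv_scale)
      have QF: "Nk (Qk (?f n)) z = t ^ n * Nk (Qk (?c n)) z" for n
      proof -
        have "Qk (?f n) = (\<lambda>x. t ^ n * Qk (?c n) x)"
          by (intro ext conv_scale)
        then show ?thesis
          by (simp add: conv_scale)
      qed
      have NQ: "(\<lambda>n. t ^ n * Nk (Qk (?c n)) z) sums Nk (Qk (W t)) z"
        "summable (\<lambda>n. norm (t ^ n * Nk (Qk (?c n)) z))"
        using Nk_Qk_series[OF f smf, of z] by (simp_all only: QF Wt)
      \<comment> \<open>The Cauchy product needs absolute convergence of both factors: of the first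
        at the chosen \<open>z\<close>, of the second at every point.\<close>
      have "(\<lambda>n. \<Sum>k\<le>n. ?f k z * (t ^ (n - k) * Nk (Qk (?c (n - k))) z)) sums
          ((\<Sum>n. ?f n z) * (\<Sum>n. t ^ n * Nk (Qk (?c n)) z))"
        by (rule Cauchy_product_sums[OF elim NQ(2)])
      then have P: "(\<lambda>n. \<Sum>k\<le>n. ?f k z * (t ^ (n - k) * Nk (Qk (?c (n - k))) z)) sums (W t z * Nk (Qk (W t)) z)"
        using NQ(1) by (simp add: W_def sums_iff)
      \<comment> \<open>The recursion multiplied by (n + 1) t^n, with t^n split as t^k t^(n - k)
        inside the sum.\<close>
      have step: "(real (Suc n) * t ^ n) * ?c (Suc n) z
          = - 2 * (t ^ n * Nk (?c n) z) - 2 * (\<Sum>k\<le>n. ?f k z * (t ^ (n - k) * Nk (Qk (?c (n - k))) z))" for n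
      proof -
        have "t ^ n * (\<Sum>k\<le>n. ?c k z * Nk (Qk (?c (n - k))) z) = (\<Sum>k\<le>n. ?f k z * (t ^ (n - k) * Nk (Qk (?c (n - k))) z))"
          unfolding sum_distrib_left
        proof (intro sum.cong refl)
          fix k assume "k \<in> {..n}"
          then have "t ^ n = t ^ k * t ^ (n - k)"
            by (simp flip: power_add)
          then show "t ^ n * (?c k z * Nk (Qk (?c (n - k))) z) = ?f k z * (t ^ (n - k) * Nk (Qk (?c (n - k))) z)"
            by (simp add: mult_ac)
        qed
        moreover have "(real (Suc n) * t ^ n) * ?c (Suc n) z
            = t ^ n * (- 2 * Nk (?c n) z + (- 2) * (\<Sum>k\<le>n. ?c k z * Nk (Qk (?c (n - k))) z))"
          by (simp add: coeff_seq.simps(2) del: of_nat_Suc)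
        ultimately show ?thesis
          by (simp add: algebra_simps)
      qed
      have "(\<lambda>n. (real (Suc n) * t ^ (Suc n - Suc 0)) * ?c (Suc n) z) sums
          (- 2 * Nk (W t) z - 2 * (W t z * Nk (Qk (W t)) z))"
        using sums_diff[OF sums_mult[OF N, of "- 2"] sums_mult[OF P, of 2]] by (simp only: step diff_Suc_Suc diff_zero)
      \<comment> \<open>The index shift is free of charge because the term n = 0 of the
        differentiated series is 0.\<close>
      then have "(\<lambda>n. (real n * t ^ (n - Suc 0)) * ?c n z) sums
          (- 2 * Nk (W t) z - 2 * (W t z * Nk (Qk (W t)) z))"
        by (subst (asm) sums_Suc_iff) simp
      then show "W' t z = - 2 * Nk (W t) z - 2 * (W t z * Nk (Qk (W t)) z)"
        by (simp add: W'_def sums_iff)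
    qed
  qed
  show ?thesis
    using T(1) W0 main by blast
qed

section \<open>The equation\<close>

text \<open>\<open>Qk w'\<close> plays the part of the time derivative. Every operator in the
  equation is fixed only up to null sets, so each subterm is replaced by an explicit convolution,
  after which the claim is an identity valid at every point.\<close>

lemma reduced_equation_imp_equation:
  assumes w: "w \<in> L2" and G: "G \<in> L2" "AE x in lborel. G x = Qk w x"
    and w': "w' \<in> L2" "AE z in lborel. w' z = - 2 * Nk w z - 2 * (w z * Nk (Qk w) z)"
  shows "AE z in lborel. Qk w' z + 2 * N_op G z =
          - N_op (\<lambda>x. (G x)\<^sup>2) z
          + 2 * Q_op (\<lambda>x. weak_deriv2 G x * N_op G x - G x * N_op (weak_deriv2 G) x) z"
proof -
  let ?n = "Nk w" and ?q = "Qk w" and ?v = "Nk (Qk w)"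
  have q: "?q \<in> L2" and n: "?n \<in> L2" and v: "?v \<in> L2"
    using Qk_L2[OF w] Nk_L2[OF w] Nk_L2[OF Qk_L2[OF w]] by auto
  have vb: "\<bar>?v x\<bar> \<le> l2norm ?q" and nb: "\<bar>?n x\<bar> \<le> l2norm w" and qb: "\<bar>?q x\<bar> \<le> l2norm w" for x
    using Nk_bound[OF q] Nk_bound[OF w] Qk_bound[OF w] by auto
  note meas [measurable] = L2_measurable[OF w] L2_measurable[OF w'(1)] L2_measurable[OF G(1)]
    L2_measurable[OF q] L2_measurable[OF n] L2_measurable[OF v]
  have E1 [measurable]: "resolvent_kernel 1 \<in> L2"
    by (rule resolvent_kernel_L2(1)) simp
  \<comment> \<open>Each product has one square integrable factor and one bounded factor.\<close>
  have prods: "(\<lambda>x. w x * ?v x) \<in> L2" "(\<lambda>x. ?n x * ?q x) \<in> L2" "(\<lambda>x. ?q x * ?v x) \<in> L2" "(\<lambda>x. ?q x * ?n x) \<in> L2"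
    "(\<lambda>x. ?q x * ?q x) \<in> L2"
    by (rule L2_mult_bounded(1)[OF w meas(6) vb] L2_mult_bounded(1)[OF n meas(4) qb]
        L2_mult_bounded(1)[OF q meas(6) vb] L2_mult_bounded(1)[OF q meas(5) nb] L2_mult_bounded(1)[OF q meas(4) qb])+
  have NG: "N_op G \<in> L2" "AE x in lborel. N_op G x = ?v x"
  proof -
    have "Nk G = ?v"
      by (rule conv_cong_AE[OF _ _ _ G(2)]) measurable
    then show "N_op G \<in> L2" "AE x in lborel. N_op G x = ?v x"
      using N_op_AE[OF G(1)] by simp_all
  qed
  have GG: "AE x in lborel. N_op (\<lambda>x. (G x)\<^sup>2) x = Qk (\<lambda>x. 2 * (?n x * ?q x)) x"
  proof -
    have ae: "AE x in lborel. (G x)\<^sup>2 = ?q x * ?q x"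
      using G(2) by eventually_elim (simp add: power2_eq_square)
    have L: "(\<lambda>x. (G x)\<^sup>2) \<in> L2"
      by (rule L2_cong_AE(1)[OF _ prods(5) ae]) measurable
    have "Nk (\<lambda>x. (G x)\<^sup>2) = Nk (\<lambda>x. (?q x)\<^sup>2)"
      by (rule conv_cong_AE) (use ae in \<open>auto simp: power2_eq_square\<close>)
    with N_op_AE(2)[OF L] show ?thesis
      by (simp add: Nk_square[OF w])
  qed
  have wd: "weak_deriv2 G \<in> L2" "AE x in lborel. weak_deriv2 G x = ?q x - w x"
    by (rule weak_deriv2_AE[OF w G])+
  note [measurable] = L2_measurable[OF wd(1)] L2_measurable[OF NG(1)]
  have Nwd: "N_op (weak_deriv2 G) \<in> L2" "AE x in lborel. N_op (weak_deriv2 G) x = ?v x - ?n x"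
  proof -
    have "Nk (weak_deriv2 G) = Nk (\<lambda>x. ?q x - w x)"
      by (rule conv_cong_AE[OF _ _ _ wd(2)]) measurable
    also have "\<dots> = (\<lambda>x. ?v x - ?n x)"
      by (intro ext conv_diff gradient_kernel_integrable(3) q w)
    finally show "N_op (weak_deriv2 G) \<in> L2" "AE x in lborel. N_op (weak_deriv2 G) x = ?v x - ?n x"
      using N_op_AE[OF wd(1)] by simp_all
  qed
  note [measurable] = L2_measurable[OF Nwd(1)]
  let ?F = "\<lambda>x. weak_deriv2 G x * N_op G x - G x * N_op (weak_deriv2 G) x"
  \<comment> \<open>The outcome of (q - w) v - q (v - n), in which q v drops out.\<close>
  let ?H = "\<lambda>x. ?q x * ?n x - w x * ?v x"
  have F0: "?H \<in> L2"
    by (intro L2_diff prods)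
  have F: "AE x in lborel. ?F x = ?H x"
    using NG(2) wd(2) Nwd(2) G(2)
  proof eventually_elim
    case (elim x)
    then show ?case
      by (simp only: elim) (simp add: algebra_simps)
  qed
  have QF: "AE x in lborel. Q_op ?F x = Qk ?H x"
  proof -
    have L: "?F \<in> L2"
      by (rule L2_cong_AE(1)[OF _ F0 F]) measurable
    have "Qk ?F = Qk ?H"
      by (rule conv_cong_AE[OF _ _ _ F]) measurable
    with Q_op_AE(2)[OF L] show ?thesis
      by simp
  qed
  let ?W = "\<lambda>z. (- 2) * ?n z - 2 * (w z * ?v z)"
  have W: "?W \<in> L2"
    by (intro L2_diff L2_scale n prods)
  have Qw': "Qk w' = Qk ?W"
    by (rule conv_cong_AE) (use w'(2) in auto)
  \<comment> \<open>Commuting the operators brings the linear term 2 N g under \<open>Qk\<close> as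
    well, so that only the arguments of \<open>Qk\<close> remain to be compared.\<close>
  have vQ: "?v = Qk ?n"
    by (simp add: Qk_Nk_commute[OF w])
  have key: "Qk ?W z + 2 * ?v z = - Qk (\<lambda>x. 2 * (?n x * ?q x)) z + 2 * Qk ?H z" for z
  proof -
    have a: "(\<lambda>x. 2 * ?n x) \<in> L2" "(\<lambda>x. 2 * (?n x * ?q x)) \<in> L2" "(\<lambda>x. 2 * ?H x) \<in> L2"
      by (intro L2_scale n prods F0)+
    have "Qk ?W z + 2 * ?v z = Qk (\<lambda>x. ?W x + 2 * ?n x) z"
      by (simp only: conv_add[OF E1 W a(1)] conv_scale[of _ 2 ?n] vQ[THEN fun_cong, of z])
    \<comment> \<open>The cancellation: both sides equal - 2 w v, as the products n q on the right
      annihilate each other.\<close>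
    also have "(\<lambda>x. ?W x + 2 * ?n x) = (\<lambda>x. 2 * ?H x - 2 * (?n x * ?q x))"
      by (intro ext) (simp add: algebra_simps)
    also have "Qk \<dots> z = 2 * Qk ?H z - Qk (\<lambda>x. 2 * (?n x * ?q x)) z"
      by (simp only: conv_diff[OF E1 a(3,2)] conv_scale[of _ 2 ?H])
    finally show ?thesis
      by simp
  qed
  show ?thesis
    using NG(2) GG QF
  proof eventually_elim
    case (elim z)
    with key[of z] show ?case
      unfolding Qw' by linarith
  qed
qed

theorem theorem1:
  fixes g0 :: "real \<Rightarrow> real"
  assumes "g0 \<in> H2"
    and "integrable lborel g0" and "(\<integral>z. g0 z \<partial>lborel) = 0"
  shows "\<exists>T>0. \<exists>g :: real \<Rightarrow> real \<Rightarrow> real.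
    continuous_H2_on {0..T} g \<and> g 0 = g0 \<and>
    (\<forall>t\<in>{0..T}. \<exists>g\<^sub>t. has_H2_derivative g g\<^sub>t t {0..T} \<and>
      (AE z in lborel.
        g\<^sub>t z + 2 * N_op (g t) z =
          - N_op (\<lambda>x. (g t x)\<^sup>2) z
          + 2 * Q_op (\<lambda>x. weak_deriv2 (g t) x * N_op (g t) x
                           - g t x * N_op (weak_deriv2 (g t)) x) z))"
proof -
  have g0: "g0 \<in> L2"
    using assms(1) by (simp add: H2_def)
  obtain w0 where w0: "w0 \<in> L2" and g0w0: "AE x in lborel. g0 x = Qk w0 x"
    using H2_imp_Qk[OF assms(1)] by blast
  obtain T W W' K where T: "0 < T" and W0: "W 0 = w0" and sol: "\<forall>t\<in>{0..T}. W t \<in> L2 \<and> W' t \<in> L2 \<and>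
      (\<forall>s\<in>{0..T}. s \<noteq> t \<longrightarrow> l2norm (\<lambda>z. (W s z - W t z) / (s - t) - W' t z) \<le> K * \<bar>s - t\<bar>) \<and>
      (AE z in lborel. W' t z = - 2 * Nk (W t) z - 2 * (W t z * Nk (Qk (W t)) z))"
    using reduced_equation_solution[OF w0] by blast
  then have W: "\<And>t. t \<in> {0..T} \<Longrightarrow> W t \<in> L2" and W': "\<And>t. t \<in> {0..T} \<Longrightarrow> W' t \<in> L2"
    and quot: "\<And>s t. t \<in> {0..T} \<Longrightarrow> s \<in> {0..T} \<Longrightarrow> s \<noteq> t \<Longrightarrow>
      l2norm (\<lambda>z. (W s z - W t z) / (s - t) - W' t z) \<le> K * \<bar>s - t\<bar>"
    and eq: "\<And>t. t \<in> {0..T} \<Longrightarrow> AE z in lborel. W' t z = - 2 * Nk (W t) z - 2 * (W t z * Nk (Qk (W t)) z)"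
    by blast+
  have E1: "resolvent_kernel 1 \<in> L2"
    by (rule resolvent_kernel_L2(1)) simp
  \<comment> \<open>The initial datum coincides with \<open>Qk w0\<close> only almost everywhere,
    whereas g 0 = g0 is demanded as an equality of functions; hence the separate value at t =
    0.\<close>
  define g where "g t = (if t = 0 then g0 else Qk (W t))" for t :: real
  have g: "g t \<in> L2" "AE x in lborel. g t x = Qk (W t) x" if "t \<in> {0..T}" for t
    using g0 g0w0 Qk_L2[OF W[OF that]] by (auto simp: g_def W0)
  have dq: "H2_norm (\<lambda>z. (g s z - g t z) / (s - t) - Qk (W' t) z) \<le> sqrt (2 * pi) * (K * \<bar>s - t\<bar>)"
    if t: "t \<in> {0..T}" and s: "s \<in> {0..T}" and st: "s \<noteq> t" for s t
  proof -
    \<comment> \<open>The quotient is written as a product with 1 / (s - t) so that linearity of the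
      convolution applies to it.\<close>
    let ?h = "\<lambda>z. 1 / (s - t) * (W s z - W t z) - W' t z"
    have WW: "(\<lambda>z. W s z - W t z) \<in> L2" "(\<lambda>z. 1 / (s - t) * (W s z - W t z)) \<in> L2"
      by (intro L2_scale L2_diff W s t)+
    have h: "?h \<in> L2"
      by (intro L2_diff WW W' t)
    have Qh: "Qk ?h z = 1 / (s - t) * (Qk (W s) z - Qk (W t) z) - Qk (W' t) z" for z
      by (simp only: conv_diff[OF E1 WW(2) W'[OF t]] conv_scale[of _ "1 / (s - t)"] conv_diff[OF E1 W[OF s] W[OF t]])
    have ae: "AE z in lborel. 1 / (s - t) * (g s z - g t z) - Qk (W' t) z = Qk ?h z"
      using g(2)[OF s] g(2)[OF t] by eventually_elim (simp only: Qh)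
    have "(\<lambda>z. 1 / (s - t) * (g s z - g t z) - Qk (W' t) z) \<in> L2"
      by (intro L2_diff L2_scale g s t Qk_L2 W')
    from Qk_H2(2)[OF h this ae] have "H2_norm (\<lambda>z. (g s z - g t z) / (s - t) - Qk (W' t) z) = sqrt (2 * pi) * l2norm ?h"
      by simp
    also have "l2norm ?h \<le> K * \<bar>s - t\<bar>"
      using quot[OF t s st] by simp
    finally show ?thesis
      by simp
  qed
  have df: "H2_norm (\<lambda>z. g s z - g t z) \<le> sqrt (2 * pi) * (\<bar>s - t\<bar> * (l2norm (W' t) + K * \<bar>s - t\<bar>))"
    if t: "t \<in> {0..T}" and s: "s \<in> {0..T}" and st: "s \<noteq> t" for s t
  proof -
    let ?h = "\<lambda>z. 1 / (s - t) * (W s z - W t z) - W' t z"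
    have WW: "(\<lambda>z. W s z - W t z) \<in> L2" "(\<lambda>z. 1 / (s - t) * (W s z - W t z)) \<in> L2"
      by (intro L2_scale L2_diff W s t)+
    have h: "?h \<in> L2"
      by (intro L2_diff WW W' t)
    have ae: "AE z in lborel. g s z - g t z = Qk (\<lambda>z. W s z - W t z) z"
      using g(2)[OF s] g(2)[OF t] by eventually_elim (simp add: conv_diff[OF E1 W[OF s] W[OF t]])
    have "H2_norm (\<lambda>z. g s z - g t z) = sqrt (2 * pi) * l2norm (\<lambda>z. W s z - W t z)"
      by (rule Qk_H2(2)[OF WW(1) L2_diff(1)[OF g(1)[OF s] g(1)[OF t]] ae])
    \<comment> \<open>Continuity is drawn from differentiability: the increment is s - t times the
      derivative plus the error of the quotient.\<close>
    also have "(\<lambda>z. W s z - W t z) = (\<lambda>z. (s - t) * (W' t z + ?h z))"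
      using st by auto
    also have "l2norm \<dots> = \<bar>s - t\<bar> * l2norm (\<lambda>z. W' t z + ?h z)"
      using L2_scale(2)[OF L2_add(1)[OF W'[OF t] h], of "s - t"] by simp
    also have "l2norm (\<lambda>z. W' t z + ?h z) \<le> l2norm (W' t) + K * \<bar>s - t\<bar>"
      using L2_add(2)[OF W'[OF t] h] quot[OF t s st] by simp
    finally show ?thesis
      by (simp add: mult_left_mono)
  qed
  have "continuous_H2_on {0..T} g"
    unfolding continuous_H2_on_def
  proof (intro ballI conjI)
    fix t assume t: "t \<in> {0..T}"
    show "g t \<in> H2"
      by (rule Qk_H2(1)[OF W[OF t] g[OF t]])
    show "((\<lambda>s. H2_norm (\<lambda>z. g s z - g t z)) \<longlongrightarrow> 0) (at t within {0..T})"
    proof (rule Lim_null_comparison)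
      show "eventually (\<lambda>s. norm (H2_norm (\<lambda>z. g s z - g t z)) \<le> sqrt (2 * pi) * (\<bar>s - t\<bar> * (l2norm (W' t) + K * \<bar>s - t\<bar>))) (at t within {0..T})"
        unfolding eventually_at_filter using df[OF t]
        by (intro always_eventually allI impI) (simp add: H2_norm_def)
      show "((\<lambda>s. sqrt (2 * pi) * (\<bar>s - t\<bar> * (l2norm (W' t) + K * \<bar>s - t\<bar>))) \<longlongrightarrow> 0) (at t within {0..T})"
        by (auto intro!: tendsto_eq_intros)
    qed
  qed
  moreover have "g 0 = g0"
    by (simp add: g_def)
  moreover have "\<exists>g\<^sub>t. has_H2_derivative g g\<^sub>t t {0..T} \<and>
      (AE z in lborel.
        g\<^sub>t z + 2 * N_op (g t) z =
          - N_op (\<lambda>x. (g t x)\<^sup>2) z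
          + 2 * Q_op (\<lambda>x. weak_deriv2 (g t) x * N_op (g t) x
                           - g t x * N_op (weak_deriv2 (g t)) x) z)" if t: "t \<in> {0..T}" for t
  proof (intro exI conjI)
    show "has_H2_derivative g (Qk (W' t)) t {0..T}"
      unfolding has_H2_derivative_def
    proof
      show "Qk (W' t) \<in> H2"
        by (rule Qk_H2(1)[OF W'[OF t] Qk_L2[OF W'[OF t]]]) simp
      show "((\<lambda>s. H2_norm (\<lambda>z. (g s z - g t z) / (s - t) - Qk (W' t) z)) \<longlongrightarrow> 0) (at t within {0..T})"
      proof (rule Lim_null_comparison)
        show "eventually (\<lambda>s. norm (H2_norm (\<lambda>z. (g s z - g t z) / (s - t) - Qk (W' t) z)) \<le> sqrt (2 * pi) * (K * \<bar>s - t\<bar>)) (at t within {0..T})"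
          unfolding eventually_at_filter using dq[OF t]
          by (intro always_eventually allI impI) (simp add: H2_norm_def)
        show "((\<lambda>s. sqrt (2 * pi) * (K * \<bar>s - t\<bar>)) \<longlongrightarrow> 0) (at t within {0..T})"
          by (auto intro!: tendsto_eq_intros)
      qed
    qed
    show "AE z in lborel. Qk (W' t) z + 2 * N_op (g t) z =
          - N_op (\<lambda>x. (g t x)\<^sup>2) z
          + 2 * Q_op (\<lambda>x. weak_deriv2 (g t) x * N_op (g t) x
                           - g t x * N_op (weak_deriv2 (g t)) x) z"
      by (rule reduced_equation_imp_equation[OF W[OF t] g[OF t] W'[OF t] eq[OF t]])
  qed
  ultimately show ?thesis
    using T by blast
qed

end
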